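(* There is a universal constant $C>0$ and a randomized algorithm with the following guarantee. Given vectors $v_1,\dots,v_n \in \mathbb{R}^n$ with $\|v_i\|_2 \leq 1$ for all $i$, and a shift $t \in \sum_{i=1}^n [-v_i,v_i]$, the algorithm runs in expected polynomial time and outputs a random coloring $\chi \in \{-1,1\}^n$ such that the random vector $\sum_{i=1}^n \chi_i v_i - t$ is $C\sqrt{\log n}$-subgaussian (i.e. $O(\sqrt{\log n})$-subgaussian).
   Context: $\sum_{i=1}^n [-v_i,v_i] = \{\sum_{i=1}^n \lambda_i v_i : \lambda \in [-1,1]^n\}$. A random vector $Y \in \mathbb{R}^n$ is $s$-subgaussian if for every unit vector $\theta$ and every $t \geq 0$, $\Pr[|\langle Y, \theta\rangle| \geq t] \leq 2 e^{-(t/s)^2/2}$. Running time counts arithmetic operations on real numbers, each taking unit time. *)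

theory Defs
  imports "HOL-Probability.Probability" "HOL-Computational_Algebra.Polynomial"
begin

section \<open>Vectors, zonotopes and subgaussian random vectors\<close>

text \<open>
  The dimension \<open>n\<close> varies, so a vector of \<open>\<real>\<^sup>n\<close> is a function \<open>nat \<Rightarrow> real\<close> of which only
  the coordinates \<open>j < n\<close> are ever inspected; \<open>L2_set x {..<n}\<close> is its Euclidean norm.
\<close>

definition inner_dim :: "nat \<Rightarrow> (nat \<Rightarrow> real) \<Rightarrow> (nat \<Rightarrow> real) \<Rightarrow> real" where
  "inner_dim n x y = (\<Sum>j<n. x j * y j)"

definition zonotope :: "nat \<Rightarrow> (nat \<Rightarrow> nat \<Rightarrow> real) \<Rightarrow> (nat \<Rightarrow> real) set" where
  "zonotope n v =
     {t. \<exists>l. (\<forall>i<n. l i \<in> {-1..1}) \<and> (\<forall>j<n. t j = (\<Sum>i<n. l i * v i j))}"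

definition subgaussian ::
    "nat \<Rightarrow> real \<Rightarrow> 'a measure \<Rightarrow> ('a \<Rightarrow> nat \<Rightarrow> real) \<Rightarrow> bool" where
  "subgaussian n s M Y \<longleftrightarrow>
     (\<forall>\<theta>. L2_set \<theta> {..<n} = 1 \<longrightarrow>
       (\<forall>x\<ge>0. measure M {\<omega> \<in> space M. \<bar>inner_dim n (Y \<omega>) \<theta>\<bar> \<ge> x}
                 \<le> 2 * exp (- ((x / s)\<^sup>2 / 2))))"


section \<open>A randomized real-number machine\<close>

text \<open>
  Algorithms are programs of a WHILE language: finite syntactic objects that do not depend on \<open>n\<close>.
  There are two kinds of data. Natural-number variables serve as counters and as array indices;
  they admit only addition and truncated subtraction, so that unit cost is harmless for them.
  Real arrays are indexed by two natural numbers, and their entries admit exact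
  field operations and comparisons. There is no rounding, no conversion of a real number into
  an index, and the only constants are integers. The only source of randomness is a fair coin.
\<close>

datatype iexp =
    INum nat
  | IVar string
  | IPlus iexp iexp
  | IMinus iexp iexp

datatype rexp =
    RNum int
  | REntry string iexp iexp
  | RPlus rexp rexp
  | RMinus rexp rexp
  | RTimes rexp rexp
  | RDiv rexp rexp

datatype bexp =
    ILess iexp iexp
  | RLess rexp rexp
  | BNot bexp
  | BAnd bexp bexp

datatype com =
    Skip
  | ISet string iexp
  | RSet string iexp iexp rexp
  | Flip string
  | Seq com com
  | Cond bexp com com
  | While bexp com

record state =
  ivar :: "string \<Rightarrow> nat"
  rarr :: "string \<Rightarrow> nat \<Rightarrow> nat \<Rightarrow> real"

primrec ival :: "iexp \<Rightarrow> state \<Rightarrow> nat" where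
  "ival (INum k) s = k"
| "ival (IVar x) s = ivar s x"
| "ival (IPlus a b) s = ival a s + ival b s"
| "ival (IMinus a b) s = ival a s - ival b s"

text \<open>Division by zero yields \<open>0\<close>, as always in HOL; a program can test its divisors.\<close>

primrec rval :: "rexp \<Rightarrow> state \<Rightarrow> real" where
  "rval (RNum k) s = of_int k"
| "rval (REntry x a b) s = rarr s x (ival a s) (ival b s)"
| "rval (RPlus a b) s = rval a s + rval b s"
| "rval (RMinus a b) s = rval a s - rval b s"
| "rval (RTimes a b) s = rval a s * rval b s"
| "rval (RDiv a b) s = rval a s / rval b s"

primrec bval :: "bexp \<Rightarrow> state \<Rightarrow> bool" where
  "bval (ILess a b) s \<longleftrightarrow> ival a s < ival b s"
| "bval (RLess a b) s \<longleftrightarrow> rval a s < rval b s"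
| "bval (BNot b) s \<longleftrightarrow> \<not> bval b s"
| "bval (BAnd b c) s \<longleftrightarrow> bval b s \<and> bval c s"

text \<open>
  Every operation, comparison and memory access takes unit time, so evaluating an expression costs
  its number of nodes. Writing a variable, flipping a coin and \<open>Skip\<close> cost one more unit each.
\<close>

primrec icost :: "iexp \<Rightarrow> nat" where
  "icost (INum k) = 1"
| "icost (IVar x) = 1"
| "icost (IPlus a b) = icost a + icost b + 1"
| "icost (IMinus a b) = icost a + icost b + 1"

primrec rcost :: "rexp \<Rightarrow> nat" where
  "rcost (RNum k) = 1"
| "rcost (REntry x a b) = icost a + icost b + 1"
| "rcost (RPlus a b) = rcost a + rcost b + 1"
| "rcost (RMinus a b) = rcost a + rcost b + 1"
| "rcost (RTimes a b) = rcost a + rcost b + 1"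
| "rcost (RDiv a b) = rcost a + rcost b + 1"

primrec bcost :: "bexp \<Rightarrow> nat" where
  "bcost (ILess a b) = icost a + icost b + 1"
| "bcost (RLess a b) = rcost a + rcost b + 1"
| "bcost (BNot b) = bcost b + 1"
| "bcost (BAnd b c) = bcost b + bcost c + 1"

partial_function (spmf) while_spmf :: "('a \<Rightarrow> bool) \<Rightarrow> ('a \<Rightarrow> 'a spmf) \<Rightarrow> 'a \<Rightarrow> 'a spmf" where
  "while_spmf g f x = (if g x then bind_spmf (f x) (while_spmf g f) else return_spmf x)"

text \<open>
  The semantics maps a state and a clock to the joint sub-distribution of the final state and the
  final clock; the missing mass is the probability of nontermination.
\<close>

primrec exec :: "com \<Rightarrow> state \<times> nat \<Rightarrow> (state \<times> nat) spmf" where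
  "exec Skip = (\<lambda>(s, m). return_spmf (s, m + 1))"
| "exec (ISet x a) = (\<lambda>(s, m).
     return_spmf (s\<lparr>ivar := (ivar s)(x := ival a s)\<rparr>, m + icost a + 1))"
| "exec (RSet x a b e) = (\<lambda>(s, m).
     return_spmf
       (s\<lparr>rarr := (rarr s)(x := (rarr s x)(ival a s := (rarr s x (ival a s))(ival b s := rval e s)))\<rparr>,
        m + icost a + icost b + rcost e + 1))"
| "exec (Flip x) = (\<lambda>(s, m).
     bind_spmf coin_spmf (\<lambda>h. return_spmf (s\<lparr>ivar := (ivar s)(x := of_bool h)\<rparr>, m + 1)))"
| "exec (Seq c d) = (\<lambda>z. bind_spmf (exec c z) (exec d))"
| "exec (Cond b c d) = (\<lambda>(s, m). (if bval b s then exec c else exec d) (s, m + bcost b))"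
| "exec (While b c) = (\<lambda>z.
     bind_spmf (while_spmf (\<lambda>(s, m). bval b s) (\<lambda>(s, m). exec c (s, m + bcost b)) z)
       (\<lambda>(s, m). return_spmf (s, m + bcost b)))"

lemma exec_While_unfold:
  "exec (While b c) (s, m) =
     (if bval b s then bind_spmf (exec c (s, m + bcost b)) (exec (While b c))
      else return_spmf (s, m + bcost b))"
  by (subst exec.simps, subst while_spmf.simps) simp

definition run :: "com \<Rightarrow> state \<Rightarrow> (state \<times> nat) spmf" where
  "run c s = exec c (s, 0)"

definition expected_time :: "com \<Rightarrow> state \<Rightarrow> ennreal" where
  "expected_time c s = (\<integral>\<^sup>+ (s', m). of_nat m \<partial>measure_spmf (run c s))"


section \<open>Input and output conventions\<close>

text \<open>Everything that does not belong to the input is initialized to \<open>0\<close>.\<close>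

definition input_state :: "nat \<Rightarrow> (nat \<Rightarrow> nat \<Rightarrow> real) \<Rightarrow> (nat \<Rightarrow> real) \<Rightarrow> state" where
  "input_state n v t =
     \<lparr>ivar = (\<lambda>_. 0)(''n'' := n),
      rarr = (\<lambda>_ _ _. 0)
        (''v'' := (\<lambda>i j. if i < n \<and> j < n then v i j else 0),
         ''t'' := (\<lambda>i j. if i = 0 \<and> j < n then t j else 0))\<rparr>"

definition coloring :: "state \<Rightarrow> nat \<Rightarrow> real" where
  "coloring s i = rarr s ''chi'' 0 i"

end

theory Submission
  imports Defs
begin

text \<open>
  A point \<open>l\<close> of the cube with \<open>\<Sum> l\<^sub>i v\<^sub>i\<close> within distance 2 of \<open>t\<close> is found greedily: the average of
  sign vectors, each of which is chosen so that the accumulated residual is not increased to first order,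
  has residual \<open>O(n / \<surd>K)\<close> after \<open>K = n\<^sup>2\<close> rounds. It is expanded into \<open>n\<close> binary digits
  \<open>S\<^sub>k \<in> {-1, 1}\<^sup>n\<close> and rounded from the least significant digit upwards: a coloring \<open>x\<close> that rounds the
  digits seen so far is replaced by a rounding of \<open>(S\<^sub>k + x) / 2 \<in> {-1, 0, 1}\<^sup>n\<close>. The zero entries are
  rounded by the self-balancing walk of Alweiss, Liu and Sawhney: the sign of \<open>v\<^sub>i\<close> has mean
  \<open>- \<langle>w, v\<^sub>i\<rangle> / c\<close>, where \<open>w\<close> is the current partial sum and \<open>c = 12 H\<^sub>n\<close>, and the walk fails if this is
  not in \<open>[-1, 1]\<close>. By Hoeffding's lemma the exponential moment at \<open>\<theta>\<close> after the step is bounded by the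
  one at \<open>\<theta> - \<langle>v\<^sub>i, \<theta>\<rangle> v\<^sub>i / c\<close> before the step times \<open>exp (\<langle>v\<^sub>i, \<theta>\<rangle>\<^sup>2 / 2)\<close>, and this factor is paid for
  by the decrease of \<open>c \<parallel>\<theta>\<parallel>\<^sup>2 / 2\<close>; hence \<open>w\<close> is \<open>\<surd>c\<close>-subgaussian and failure is unlikely. The errors
  of the \<open>n\<close> digits add up to a geometric series. Failed attempts are repeated, at most \<open>n\<^sup>2\<close> times: the
  probability \<open>2 powr (- n\<^sup>2)\<close> that all of them fail is below the tail bound at the largest possible
  deviation \<open>2n\<close>. All loops are bounded, so that even the worst-case running time is polynomial.
\<close>

section \<open>Bounded loop programs\<close>

text \<open>\<open>PFor x c\<close> runs \<open>c\<close> for \<open>x = 0, \<dots>, n - 1\<close>; the only loop bound is the input variable \<open>n\<close>.\<close>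

datatype prog =
    PSkip
  | PRSet string iexp iexp rexp
  | PFlip string
  | PSeq prog prog (infixr ";;" 60)
  | PCond bexp prog prog
  | PFor string prog

primrec compile :: "prog \<Rightarrow> com" where
  "compile PSkip = Skip"
| "compile (PRSet x a b e) = RSet x a b e"
| "compile (PFlip x) = Flip x"
| "compile (c ;; d) = Seq (compile c) (compile d)"
| "compile (PCond b c d) = Cond b (compile c) (compile d)"
| "compile (PFor x c) = Seq (ISet x (INum 0))
     (While (ILess (IVar x) (IVar ''n'')) (Seq (compile c) (ISet x (IPlus (IVar x) (INum 1)))))"

primrec wvars :: "prog \<Rightarrow> string set" where
  "wvars PSkip = {}"
| "wvars (PRSet x a b e) = {}"
| "wvars (PFlip x) = {x}"
| "wvars (c ;; d) = wvars c \<union> wvars d"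
| "wvars (PCond b c d) = wvars c \<union> wvars d"
| "wvars (PFor x c) = insert x (wvars c)"

primrec warrs :: "prog \<Rightarrow> string set" where
  "warrs PSkip = {}"
| "warrs (PRSet x a b e) = {x}"
| "warrs (PFlip x) = {}"
| "warrs (c ;; d) = warrs c \<union> warrs d"
| "warrs (PCond b c d) = warrs c \<union> warrs d"
| "warrs (PFor x c) = warrs c"

text \<open>These conditions ensure that the while loop produced by \<open>compile\<close> performs
  exactly \<open>n\<close> rounds: the body can change neither the bound nor the counter.\<close>

primrec wf_prog :: "prog \<Rightarrow> bool" where
  "wf_prog PSkip = True"
| "wf_prog (PRSet x a b e) = True"
| "wf_prog (PFlip x) = (x \<noteq> ''n'')"
| "wf_prog (c ;; d) = (wf_prog c \<and> wf_prog d)"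
| "wf_prog (PCond b c d) = (wf_prog c \<and> wf_prog d)"
| "wf_prog (PFor x c) = (x \<noteq> ''n'' \<and> x \<notin> wvars c \<and> wf_prog c)"

lemma wf_prog_n: "wf_prog c \<Longrightarrow> ''n'' \<notin> wvars c"
  by (induction c) auto

section \<open>Denotation and cost of bounded loop programs\<close>

definition set_var :: "string \<Rightarrow> nat \<Rightarrow> state \<Rightarrow> state" where
  "set_var x k s = s\<lparr>ivar := (ivar s)(x := k)\<rparr>"

definition set_entry :: "string \<Rightarrow> nat \<Rightarrow> nat \<Rightarrow> real \<Rightarrow> state \<Rightarrow> state" where
  "set_entry x a b e s = s\<lparr>rarr := (rarr s)(x := (rarr s x)(a := (rarr s x a)(b := e)))\<rparr>"

lemma ivar_set_var [simp]: "ivar (set_var x k s) = (ivar s)(x := k)"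
  and rarr_set_var [simp]: "rarr (set_var x k s) = rarr s"
  and ivar_set_entry [simp]: "ivar (set_entry x a b e s) = ivar s"
  and rarr_set_entry [simp]: "rarr (set_entry x a b e s) = (rarr s)(x := (rarr s x)(a := (rarr s x a)(b := e)))"
  and set_var_set_var [simp]: "set_var x k (set_var x l s) = set_var x k s"
  by (simp_all add: set_var_def set_entry_def)

lemma set_var_same: "ivar s x = k \<Longrightarrow> set_var x k s = s"
  by (simp add: set_var_def fun_upd_idem)

text \<open>Recursion on the number \<open>r\<close> of remaining rounds gives loops a genuine
  probability distribution instead of a fixed point of sub-distributions; \<open>k\<close> is the
  current value of the counter.\<close>

primrec loop_pmf :: "(nat \<Rightarrow> 'a \<Rightarrow> 'a pmf) \<Rightarrow> nat \<Rightarrow> nat \<Rightarrow> 'a \<Rightarrow> 'a pmf" where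
  "loop_pmf f 0 k s = return_pmf s"
| "loop_pmf f (Suc r) k s = bind_pmf (f k s) (loop_pmf f r (Suc k))"

text \<open>The clock is dropped here and is accounted for by \<open>tcost\<close>. Writing the
  counter before every round and the bound after the last one reproduces what the compiled while
  loop leaves in \<open>x\<close>.\<close>

primrec den :: "prog \<Rightarrow> state \<Rightarrow> state pmf" where
  "den PSkip s = return_pmf s"
| "den (PRSet x a b e) s = return_pmf (set_entry x (ival a s) (ival b s) (rval e s) s)"
| "den (PFlip x) s = map_pmf (\<lambda>h. set_var x (of_bool h) s) (bernoulli_pmf (1/2))"
| "den (c ;; d) s = bind_pmf (den c s) (den d)"
| "den (PCond b c d) s = (if bval b s then den c s else den d s)"
| "den (PFor x c) s = map_pmf (set_var x (ivar s ''n''))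
     (loop_pmf (\<lambda>k s. den c (set_var x k s)) (ivar s ''n'') 0 s)"

text \<open>A worst-case bound: a conditional is charged for both branches. In the loop clause 5 is
  the initial assignment (2) plus the last, failing test (3), and 7 is one test (3) plus one
  increment (4).\<close>

primrec tcost :: "prog \<Rightarrow> nat \<Rightarrow> nat" where
  "tcost PSkip n = 1"
| "tcost (PRSet x a b e) n = icost a + icost b + rcost e + 1"
| "tcost (PFlip x) n = 1"
| "tcost (c ;; d) n = tcost c n + tcost d n"
| "tcost (PCond b c d) n = bcost b + tcost c n + tcost d n"
| "tcost (PFor x c) n = 5 + n * (tcost c n + 7)"

lemma poly_tcost: "\<exists>p :: real poly. \<forall>n. real (tcost c n) = poly p (real n)"
proof (induction c)
  case (PSeq c d)
  then obtain p q where "\<forall>n. real (tcost c n) = poly p (real n)" "\<forall>n. real (tcost d n) = poly q (real n)"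
    by blast
  then show ?case by (intro exI[of _ "p + q"]) simp
next
  case (PCond b c d)
  then obtain p q where "\<forall>n. real (tcost c n) = poly p (real n)" "\<forall>n. real (tcost d n) = poly q (real n)"
    by blast
  then show ?case by (intro exI[of _ "[:real (bcost b):] + p + q"]) simp
next
  case (PFor x c)
  then obtain p where "\<forall>n. real (tcost c n) = poly p (real n)" by blast
  then show ?case by (intro exI[of _ "[:5:] + [:0,1:] * (p + [:7:])"]) simp
qed (auto intro: exI[of _ "[:_:]"])

lemma loop_pmf_inv:
  assumes "s' \<in> set_pmf (loop_pmf f r k s)" "I k s"
    and "\<And>i s s'. k \<le> i \<Longrightarrow> i < k + r \<Longrightarrow> I i s \<Longrightarrow> s' \<in> set_pmf (f i s) \<Longrightarrow> I (Suc i) s'"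
  shows "I (k + r) s'"
  using assms
proof (induction r arbitrary: k s)
  case (Suc r)
  from Suc.prems(1) obtain s1 where s1: "s1 \<in> set_pmf (f k s)" "s' \<in> set_pmf (loop_pmf f r (Suc k) s1)"
    by auto
  have "I (Suc k) s1" using Suc.prems s1 by auto
  from Suc.IH[OF s1(2) this] Suc.prems(3) show ?case by auto
qed simp

lemma den_frame:
  assumes "s' \<in> set_pmf (den c s)"
  shows "(\<forall>x. x \<notin> wvars c \<longrightarrow> ivar s' x = ivar s x) \<and> (\<forall>x. x \<notin> warrs c \<longrightarrow> rarr s' x = rarr s x)"
  using assms
proof (induction c arbitrary: s s')
  case (PSeq c d)
  then show ?case by fastforce
next
  case (PCond b c d)
  then show ?case by (auto split: if_splits)
next
  case (PFor x c)
  from PFor.prems obtain s1 where s1: "s' = set_var x (ivar s ''n'') s1"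
    "s1 \<in> set_pmf (loop_pmf (\<lambda>k s. den c (set_var x k s)) (ivar s ''n'') 0 s)" by auto
  let ?I = "\<lambda>_ s1. (\<forall>z. z \<notin> insert x (wvars c) \<longrightarrow> ivar s1 z = ivar s z) \<and>
     (\<forall>z. z \<notin> warrs c \<longrightarrow> rarr s1 z = rarr s z)"
  have "?I (0 + ivar s ''n'') s1"
    by (rule loop_pmf_inv[OF s1(2), where I = "?I"]) (auto dest!: PFor.IH)
  then show ?case by (auto simp: s1)
qed auto

lemma den_n: "wf_prog c \<Longrightarrow> s' \<in> set_pmf (den c s) \<Longrightarrow> ivar s' ''n'' = ivar s ''n''"
  using den_frame wf_prog_n by blast

text \<open>The clock can be forgotten before binding as long as the continuation lets it influence
  nothing but the final clock.\<close>

lemma map_bind_spmf_fst: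
  assumes "map_spmf fst p = spmf_of_pmf P"
    and "\<And>z. z \<in> set_spmf p \<Longrightarrow> map_spmf fst (f z) = spmf_of_pmf (Q (fst z))"
  shows "map_spmf fst (bind_spmf p f) = spmf_of_pmf (bind_pmf P Q)"
proof -
  have "map_spmf fst (bind_spmf p f) = bind_spmf p (\<lambda>z. map_spmf fst (f z))"
    by (simp add: map_spmf_bind_spmf o_def)
  also have "\<dots> = bind_spmf p (\<lambda>z. spmf_of_pmf (Q (fst z)))"
    by (intro bind_spmf_cong refl assms(2))
  also have "\<dots> = bind_spmf (map_spmf fst p) (\<lambda>s. spmf_of_pmf (Q s))"
    by (simp add: bind_map_spmf o_def)
  also have "\<dots> = spmf_of_pmf (bind_pmf P Q)"
    by (simp add: assms(1) bind_spmf_of_pmf spmf_of_pmf_bind)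
  finally show ?thesis .
qed

lemma set_spmf_fst:
  assumes "map_spmf fst p = spmf_of_pmf P" "z \<in> set_spmf p"
  shows "fst z \<in> set_pmf P"
proof -
  have "fst z \<in> set_spmf (map_spmf fst p)" using assms(2) by simp
  then show ?thesis by (simp add: assms(1))
qed

lemma map_spmf_coin:
  "map_spmf fst (bind_spmf coin_spmf (\<lambda>h. return_spmf (f h, (m::nat) + 1))) =
    spmf_of_pmf (map_pmf f (bernoulli_pmf (1/2)))"
proof -
  have "coin_spmf = spmf_of_pmf (bernoulli_pmf (1/2))"
    unfolding bernoulli_pmf_half_conv_pmf_of_set by (simp add: spmf_of_pmf_pmf_of_set)
  then have "map_spmf fst (bind_spmf coin_spmf (\<lambda>h. return_spmf (f h, m + 1))) =
      bind_pmf (bernoulli_pmf (1/2)) (\<lambda>h. return_pmf (Some (f h)))"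
    by (simp only: bind_spmf_of_pmf) (simp add: map_bind_pmf)
  then show ?thesis by (simp only: spmf_of_pmf_def map_pmf_comp map_pmf_def[of "\<lambda>x. Some (f x)"])
qed

text \<open>This transfers all later work to \<open>den\<close>. The clock is bounded on every run,
  so the time bound is a worst-case one. Loops require an inner induction on the number of remaining
  rounds.\<close>

lemma exec_compile:
  assumes "wf_prog c"
  shows "map_spmf fst (exec (compile c) (s, m)) = spmf_of_pmf (den c s)
    \<and> (\<forall>z \<in> set_spmf (exec (compile c) (s, m)). snd z \<le> m + tcost c (ivar s ''n''))"
  using assms
proof (induction c arbitrary: s m)
  case (PFlip x)
  show ?case using map_spmf_coin[of "\<lambda>h. set_var x (of_bool h) s" m]
    by (auto simp: set_bind_spmf set_var_def)
next
  case (PSeq c d)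
  note c = PSeq.IH(1)[of s m]
  have m: "map_spmf fst (exec (compile d) z) = spmf_of_pmf (den d (fst z))" for z
    using PSeq by (cases z) auto
  have "snd z \<le> m + (tcost c (ivar s ''n'') + tcost d (ivar s ''n''))"
    if z: "z \<in> set_spmf (bind_spmf (exec (compile c) (s, m)) (exec (compile d)))" for z
  proof -
    from z obtain z1 where z1: "z1 \<in> set_spmf (exec (compile c) (s, m))" "z \<in> set_spmf (exec (compile d) z1)"
      by (auto simp: set_bind_spmf set_var_def)
    have "ivar (fst z1) ''n'' = ivar s ''n''"
      using set_spmf_fst[OF _ z1(1)] c den_n PSeq.prems by auto
    moreover have "snd z \<le> snd z1 + tcost d (ivar (fst z1) ''n'')"
      using PSeq.IH(2)[of "fst z1" "snd z1"] PSeq.prems z1 by auto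
    ultimately show ?thesis using c z1 PSeq.prems by fastforce
  qed
  moreover have "map_spmf fst (bind_spmf (exec (compile c) (s, m)) (exec (compile d)))
      = spmf_of_pmf (bind_pmf (den c s) (den d))"
    by (rule map_bind_spmf_fst) (use c m PSeq.prems in auto)
  ultimately show ?case by simp
next
  case (PCond b c d)
  have wf: "wf_prog c" "wf_prog d" using PCond.prems by auto
  show ?case
    using PCond.IH(1)[OF wf(1), of s "m + bcost b"] PCond.IH(2)[OF wf(2), of s "m + bcost b"]
    by (cases "bval b s"; simp; force)
next
  case (PFor x c)
  have wf: "wf_prog c" "x \<noteq> ''n''" "x \<notin> wvars c" "''n'' \<notin> wvars c"
    using PFor.prems wf_prog_n by auto
  let ?b = "ILess (IVar x) (IVar ''n'')"
  let ?c = "Seq (compile c) (ISet x (IPlus (IVar x) (INum 1)))"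
  let ?f = "\<lambda>k s. den c (set_var x k s)"
  \<comment> \<open>Generalized to a loop entered in the middle, with counter \<open>k\<close> and
    \<open>r\<close> rounds left; the summand 3 pays for the final test.\<close>
  have W: "map_spmf fst (exec (While ?b ?c) (s, m)) = spmf_of_pmf (map_pmf (set_var x (k + r)) (loop_pmf ?f r k s))
    \<and> (\<forall>z \<in> set_spmf (exec (While ?b ?c) (s, m)). snd z \<le> m + 3 + r * (tcost c (k + r) + 7))"
    if "ivar s ''n'' = k + r" "ivar s x = k" for s m k r
    using that
  proof (induction r arbitrary: s m k)
    case 0
    have "set_var x k s = s" using 0 by (simp add: set_var_same)
    then show ?case using 0 by (subst (1 2) exec_While_unfold) simp
  next
    case (Suc r)
    let ?S = "\<lambda>(s, m). (set_var x (Suc (ivar s x)) s, m + 4)"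
    have b: "bval ?b s" using Suc.prems by simp
    have s: "set_var x k s = s" using Suc.prems by (simp add: set_var_same)
    note c = PFor.IH[OF wf(1), of s "m + 3"]
    have eq: "exec (While ?b ?c) (s, m) =
        bind_spmf (exec (compile c) (s, m + 3)) (\<lambda>z. exec (While ?b ?c) (?S z))"
      by (subst exec_While_unfold, subst if_P[OF b]) (simp add: split_def numeral_eq_Suc set_var_def del: exec.simps(7))
    have ih: "map_spmf fst (exec (While ?b ?c) (?S z)) = spmf_of_pmf (map_pmf (set_var x (k + Suc r)) (loop_pmf ?f r (Suc k) (fst z)))
       \<and> (\<forall>y \<in> set_spmf (exec (While ?b ?c) (?S z)). snd y \<le> snd z + 4 + 3 + r * (tcost c (k + Suc r) + 7))"
      if z: "z \<in> set_spmf (exec (compile c) (s, m + 3))" for z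
    proof -
      obtain s1 m1 where z1: "z = (s1, m1)" by force
      have "s1 \<in> set_pmf (den c s)" using c set_spmf_fst[OF _ z] z1 by auto
      then have s1: "ivar s1 x = k" "ivar s1 ''n'' = k + Suc r"
        using den_frame[of s1 c s] wf Suc.prems by auto
      \<comment> \<open>The value stored in \<open>x\<close> between rounds is immaterial: the next
        round overwrites it, and after the last round the outer map does.\<close>
      have l: "map_pmf (set_var x a) (loop_pmf ?f r (Suc k) (set_var x b s1)) = map_pmf (set_var x a) (loop_pmf ?f r (Suc k) s1)" for a b
        by (cases r) simp_all
      have S: "?S z = (set_var x (Suc k) s1, m1 + 4)" "fst z = s1" "snd z = m1" using z1 s1 by auto
      have "ivar (set_var x (Suc k) s1) ''n'' = Suc k + r" "ivar (set_var x (Suc k) s1) x = Suc k"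
        using s1 wf by simp_all
      from Suc.IH[OF this, of "m1 + 4"] show ?thesis
        unfolding S l add_Suc add_Suc_right .
    qed
    have "snd y \<le> m + 3 + Suc r * (tcost c (k + Suc r) + 7)"
      if y: "y \<in> set_spmf (exec (While ?b ?c) (s, m))" for y
    proof -
      from y[unfolded eq] obtain z where z: "z \<in> set_spmf (exec (compile c) (s, m + 3))"
        "y \<in> set_spmf (exec (While ?b ?c) (?S z))" unfolding set_bind_spmf by auto
      have "snd z \<le> m + 3 + tcost c (k + Suc r)" using c z Suc.prems by auto
      moreover have "snd y \<le> snd z + 4 + 3 + r * (tcost c (k + Suc r) + 7)" using ih[OF z(1)] z(2) by blast
      ultimately show ?thesis by simp
    qed
    moreover have "map_spmf fst (exec (While ?b ?c) (s, m)) =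
       spmf_of_pmf (bind_pmf (den c s) (\<lambda>s. map_pmf (set_var x (k + Suc r)) (loop_pmf ?f r (Suc k) s)))"
      unfolding eq by (rule map_bind_spmf_fst) (use c ih in auto)
    ultimately show ?case by (simp add: s map_bind_pmf del: exec.simps(7))
  qed
  have l: "loop_pmf ?f r 0 (set_var x 0 s) = loop_pmf ?f r 0 s \<or> r = 0" for r
    by (cases r) auto
  have l': "map_pmf (set_var x a) (loop_pmf ?f r 0 (set_var x 0 s)) = map_pmf (set_var x a) (loop_pmf ?f r 0 s)" for a r
    using l[of r] by auto
  have e: "exec (compile (PFor x c)) (s, m) = exec (While ?b ?c) (set_var x 0 s, m + 2)"
    by (simp add: set_var_def del: exec.simps(7))
  have "ivar (set_var x 0 s) ''n'' = 0 + ivar s ''n''" "ivar (set_var x 0 s) x = 0" using wf by auto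
  from W[OF this, of "m + 2"] show ?case
    unfolding e l' by (simp add: add_ac del: exec.simps(7))
next
  case PSkip
  show ?case by simp
next
  case (PRSet x a b e)
  show ?case by (simp add: set_entry_def)
qed

section \<open>Invariant and expectation rules for loops\<close>

lemma For_inv:
  assumes wf: "wf_prog (PFor x c)" and s': "s' \<in> set_pmf (den (PFor x c) s)" and N: "ivar s ''n'' = N"
    and I: "I 0 (rarr s)"
    and step: "\<And>k s1 s2. k < N \<Longrightarrow> I k (rarr s1) \<Longrightarrow> ivar s1 x = k \<Longrightarrow>
      (\<forall>z. z \<noteq> x \<longrightarrow> z \<notin> wvars c \<longrightarrow> ivar s1 z = ivar s z) \<Longrightarrow>
      (\<forall>z. z \<notin> warrs c \<longrightarrow> rarr s1 z = rarr s z) \<Longrightarrow> s2 \<in> set_pmf (den c s1) \<Longrightarrow> I (Suc k) (rarr s2)"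
  shows "I N (rarr s')"
proof -
  let ?f = "\<lambda>k s. den c (set_var x k s)"
  \<comment> \<open>The frame facts travel along with the invariant, so that \<open>I\<close> itself
    may speak of the arrays only.\<close>
  let ?J = "\<lambda>k (s1 :: state). I k (rarr s1) \<and> (\<forall>z. z \<noteq> x \<longrightarrow> z \<notin> wvars c \<longrightarrow> ivar s1 z = ivar s z) \<and>
      (\<forall>z. z \<notin> warrs c \<longrightarrow> rarr s1 z = rarr s z)"
  from s' N obtain s1 where s1: "s' = set_var x N s1" "s1 \<in> set_pmf (loop_pmf ?f N 0 s)" by auto
  have "?J (0 + N) s1"
  proof (rule loop_pmf_inv[OF s1(2), where I = ?J])
    fix k and s1 s2 :: state
    assume k: "k < 0 + N" and J: "?J k s1" and s2: "s2 \<in> set_pmf (?f k s1)"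
    have "I (Suc k) (rarr s2)"
      by (rule step[OF _ _ _ _ _ s2]) (use k J in auto)
    then show "?J (Suc k) s2" using den_frame[OF s2] J by auto
  qed (use I in auto)
  then show ?thesis by (simp add: s1)
qed

text \<open>A supermartingale argument: the one-round inequality is iterated over the rounds, and
  \<open>I\<close> confines it to reachable states.\<close>

lemma loop_pmf_nn_integral:
  assumes "I k s"
    and "\<And>i s s'. k \<le> i \<Longrightarrow> i < k + r \<Longrightarrow> I i s \<Longrightarrow> s' \<in> set_pmf (f i s) \<Longrightarrow> I (Suc i) s'"
    and "\<And>i s. k \<le> i \<Longrightarrow> i < k + r \<Longrightarrow> I i s \<Longrightarrow> (\<integral>\<^sup>+ s'. G (Suc i) s' \<partial>measure_pmf (f i s)) \<le> G i s"
  shows "(\<integral>\<^sup>+ s'. G (k + r) s' \<partial>measure_pmf (loop_pmf f r k s)) \<le> G k s"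
  using assms
proof (induction r arbitrary: k s)
  case 0
  then show ?case by (simp add: nn_integral_return_pmf)
next
  case (Suc r)
  have "(\<integral>\<^sup>+ s'. G (k + Suc r) s' \<partial>measure_pmf (loop_pmf f (Suc r) k s)) =
    (\<integral>\<^sup>+ s1. \<integral>\<^sup>+ s'. G (Suc k + r) s' \<partial>measure_pmf (loop_pmf f r (Suc k) s1) \<partial>measure_pmf (f k s))"
    by simp
  also have "\<dots> \<le> (\<integral>\<^sup>+ s1. G (Suc k) s1 \<partial>measure_pmf (f k s))"
  proof (intro nn_integral_mono_AE, simp only: AE_measure_pmf_iff, intro ballI)
    fix s1 assume "s1 \<in> set_pmf (f k s)"
    then have "I (Suc k) s1" using Suc.prems by auto
    then show "(\<integral>\<^sup>+ s'. G (Suc k + r) s' \<partial>measure_pmf (loop_pmf f r (Suc k) s1)) \<le> G (Suc k) s1"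
      by (rule Suc.IH) (use Suc.prems in auto)
  qed
  also have "\<dots> \<le> G k s" using Suc.prems by auto
  finally show ?case .
qed

text \<open>The probabilistic estimates on loops are instances of this rule. Since \<open>G\<close>
  depends on the round, it can contain a budget reserved for the rounds still to come.\<close>

lemma For_nn_integral:
  assumes wf: "wf_prog (PFor x c)" and N: "ivar s ''n'' = N" and I: "I 0 (rarr s)"
    and step: "\<And>k s1 s2. k < N \<Longrightarrow> I k (rarr s1) \<Longrightarrow> ivar s1 x = k \<Longrightarrow>
      (\<forall>z. z \<noteq> x \<longrightarrow> z \<notin> wvars c \<longrightarrow> ivar s1 z = ivar s z) \<Longrightarrow>
      (\<forall>z. z \<notin> warrs c \<longrightarrow> rarr s1 z = rarr s z) \<Longrightarrow> s2 \<in> set_pmf (den c s1) \<Longrightarrow> I (Suc k) (rarr s2)"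
    and G: "\<And>k s1. k < N \<Longrightarrow> I k (rarr s1) \<Longrightarrow> ivar s1 x = k \<Longrightarrow>
      (\<forall>z. z \<noteq> x \<longrightarrow> z \<notin> wvars c \<longrightarrow> ivar s1 z = ivar s z) \<Longrightarrow>
      (\<forall>z. z \<notin> warrs c \<longrightarrow> rarr s1 z = rarr s z) \<Longrightarrow>
      (\<integral>\<^sup>+ s2. G (Suc k) (rarr s2) \<partial>measure_pmf (den c s1)) \<le> G k (rarr s1)"
  shows "(\<integral>\<^sup>+ s'. G N (rarr s') \<partial>measure_pmf (den (PFor x c) s)) \<le> G 0 (rarr s)"
proof -
  let ?f = "\<lambda>k s. den c (set_var x k s)"
  let ?J = "\<lambda>k (s1 :: state). I k (rarr s1) \<and> (\<forall>z. z \<noteq> x \<longrightarrow> z \<notin> wvars c \<longrightarrow> ivar s1 z = ivar s z) \<and>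
      (\<forall>z. z \<notin> warrs c \<longrightarrow> rarr s1 z = rarr s z)"
  have "(\<integral>\<^sup>+ s'. G (0 + N) (rarr s') \<partial>measure_pmf (loop_pmf ?f N 0 s)) \<le> G 0 (rarr s)"
  proof (rule loop_pmf_nn_integral[where I = ?J and G = "\<lambda>k (s :: state). G k (rarr s)"])
    fix k and s1 s2 :: state
    assume k: "k < 0 + N" and J: "?J k s1" and s2: "s2 \<in> set_pmf (?f k s1)"
    have "I (Suc k) (rarr s2)"
      by (rule step[OF _ _ _ _ _ s2]) (use k J in auto)
    then show "?J (Suc k) s2" using den_frame[OF s2] J by auto
  next
    fix k and s1 :: state
    assume k: "k < 0 + N" and J: "?J k s1"
    have "(\<integral>\<^sup>+ s2. G (Suc k) (rarr s2) \<partial>measure_pmf (?f k s1)) \<le> G k (rarr (set_var x k s1))"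
      by (rule G) (use k J in auto)
    then show "(\<integral>\<^sup>+ s2. G (Suc k) (rarr s2) \<partial>measure_pmf (?f k s1)) \<le> G k (rarr s1)" by simp
  qed (use I in auto)
  then show ?thesis using N by simp
qed

section \<open>The algorithm as a bounded loop program\<close>

abbreviation "num k \<equiv> RNum k"
abbreviation "cell x \<equiv> REntry x (INum 0) (INum 0)"
abbreviation "entry x i \<equiv> REntry x (INum 0) (IVar i)"
abbreviation "set_cell x e \<equiv> PRSet x (INum 0) (INum 0) e"
abbreviation "set_vec x i e \<equiv> PRSet x (INum 0) (IVar i) e"
abbreviation "mat_v \<equiv> REntry ''v'' (IVar ''i'') (IVar ''j'')"
abbreviation "BEq a b \<equiv> BAnd (BNot (RLess a b)) (BNot (RLess b a))"

text \<open>The constant \<open>c = 12 H\<^sub>n\<close>; the harmonic number replaces the logarithm, which the machine cannot compute.\<close>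

definition prog_const :: prog where
  "prog_const = PFor ''i'' (set_cell ''q'' (RPlus (cell ''q'') (num 1)) ;;
     set_cell ''c'' (RPlus (cell ''c'') (RDiv (num 12) (cell ''q''))))"

definition prog_dot :: "string \<Rightarrow> prog" where
  "prog_dot x = set_cell ''g'' (num 0) ;;
     PFor ''j'' (set_cell ''g'' (RPlus (cell ''g'') (RTimes mat_v (entry x ''j''))))"

definition prog_signs :: prog where
  "prog_signs = PFor ''i'' (prog_dot ''R'' ;;
     PCond (RLess (cell ''g'') (num 0)) (set_vec ''s'' ''i'' (num 1)) (set_vec ''s'' ''i'' (num (-1))))"

text \<open>\<open>A\<close> sums the sign vectors, \<open>K\<close> counts them, and
  \<open>R\<close> keeps the value \<open>\<Sum> A\<^sub>i v\<^sub>i - K t\<close>; the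
  approximating point is \<open>A / K\<close>. All signs of one round are computed from the residual
  before that round.\<close>

definition prog_round :: prog where
  "prog_round = prog_signs ;;
     PFor ''i'' (set_vec ''A'' ''i'' (RPlus (entry ''A'' ''i'') (entry ''s'' ''i'')) ;;
       PFor ''j'' (set_vec ''R'' ''j'' (RPlus (entry ''R'' ''j'') (RTimes (entry ''s'' ''i'') mat_v)))) ;;
     PFor ''j'' (set_vec ''R'' ''j'' (RMinus (entry ''R'' ''j'') (entry ''t'' ''j''))) ;;
     set_cell ''K'' (RPlus (cell ''K'') (num 1))"

definition prog_greedy :: prog where
  "prog_greedy = PFor ''a'' (PFor ''b'' prog_round)"

text \<open>Row \<open>p\<close> of \<open>r\<close> is the remainder whose digits are the rows \<open>p - 1, \<dots>, 0\<close> of \<open>S\<close>, most significant first.\<close>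

definition prog_digits :: prog where
  "prog_digits = PFor ''i'' (PRSet ''r'' (IVar ''n'') (IVar ''i'') (RDiv (entry ''A'' ''i'') (cell ''K'')) ;;
     PFor ''k'' (
       (let p = IMinus (IVar ''n'') (IVar ''k''); p' = IMinus p (INum 1); i = IVar ''i'' in
        PCond (RLess (REntry ''r'' p i) (num 0)) (PRSet ''S'' p' i (num (-1))) (PRSet ''S'' p' i (num 1)) ;;
        PRSet ''r'' p' i (RMinus (RTimes (num 2) (REntry ''r'' p i)) (REntry ''S'' p' i)))))"

text \<open>
  One step of a bounded martingale that moves \<open>y\<close> by \<open>\<plusminus>(1 - \<bar>y\<bar>)\<close> and thus reaches \<open>\<plusminus>1\<close> with probability
  at least \<open>1/2\<close>. It turns fair coins into a sign of prescribed real mean.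
\<close>

definition prog_coin :: prog where
  "prog_coin = (let y = cell ''y'' in PFlip ''h'' ;;
     PCond (RLess y (num 0))
       (PCond (ILess (INum 0) (IVar ''h'')) (set_cell ''y'' (RPlus (RTimes (num 2) y) (num 1))) (set_cell ''y'' (num (-1))))
       (PCond (ILess (INum 0) (IVar ''h'')) (set_cell ''y'' (num 1)) (set_cell ''y'' (RMinus (RTimes (num 2) y) (num 1)))))"

text \<open>With \<open>4 * n\<close> coins a sign stays undecided with probability at most
  \<open>1 / 16 ^ n\<close>, which survives a union bound over the \<open>n * n\<close> steps of one
  trial.\<close>

definition prog_sign :: prog where
  "prog_sign = PFor ''l'' (prog_coin ;; prog_coin ;; prog_coin ;; prog_coin)"

text \<open>If \<open>chi\<close> and the digit agree, their average is already a sign and nothing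
  has to be rounded; otherwise the average is 0 and the walk supplies the sign. After a failure the
  program continues with some sign, so that every entry remains \<open>-1\<close> or
  \<open>1\<close>.\<close>

definition prog_step :: prog where
  "prog_step = PCond (BEq (entry ''chi'' ''i'') (REntry ''S'' (IVar ''k'') (IVar ''i''))) PSkip
     (prog_dot ''w'' ;;
      set_cell ''y'' (RDiv (RMinus (num 0) (cell ''g'')) (cell ''c'')) ;;
      PCond (BAnd (BNot (RLess (cell ''y'') (num (-1)))) (BNot (RLess (num 1) (cell ''y'')))) PSkip (set_cell ''f'' (num 1)) ;;
      prog_sign ;;
      PCond (BEq (cell ''y'') (num 1)) (set_vec ''chi'' ''i'' (num 1))
        (PCond (BEq (cell ''y'') (num (-1))) (set_vec ''chi'' ''i'' (num (-1)))
          (set_vec ''chi'' ''i'' (num 1) ;; set_cell ''f'' (num 1))) ;;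
      PFor ''j'' (set_vec ''w'' ''j'' (RPlus (entry ''w'' ''j'') (RTimes (entry ''chi'' ''i'') mat_v))))"

definition prog_level :: prog where
  "prog_level = PFor ''j'' (set_vec ''w'' ''j'' (num 0)) ;; PFor ''i'' prog_step"

definition prog_ones :: prog where
  "prog_ones = PFor ''i'' (set_vec ''chi'' ''i'' (num 1))"

text \<open>The flag \<open>f\<close> is raised when the walk leaves its range or when a sign is still undecided after \<open>4n\<close> coins.\<close>

definition prog_attempt :: prog where
  "prog_attempt = set_cell ''f'' (num 0) ;; prog_ones ;; PFor ''k'' prog_level"

definition prog_retry :: prog where
  "prog_retry = PFor ''a'' (PFor ''b'' (PCond (RLess (num 0) (cell ''f'')) prog_attempt PSkip))"

definition prog_main :: prog where
  "prog_main = prog_const ;; prog_greedy ;; prog_digits ;; set_cell ''f'' (num 1) ;; prog_ones ;; prog_retry"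

lemmas prog_defs = prog_const_def prog_dot_def prog_signs_def prog_round_def prog_greedy_def
  prog_digits_def prog_coin_def prog_sign_def prog_step_def prog_level_def prog_ones_def
  prog_attempt_def prog_retry_def prog_main_def Let_def

lemma wf_main: "wf_prog prog_main" by (simp add: prog_defs)

lemma wvars_simps [simp]:
  "wvars (prog_dot x) = {''j''}"
  "wvars prog_signs = {''i'', ''j''}"
  "wvars prog_round = {''i'', ''j''}"
  "wvars prog_sign = {''h'', ''l''}"
  "wvars prog_step = {''j'', ''h'', ''l''}"
  "wvars prog_level = {''j'', ''i'', ''h'', ''l''}"
  "wvars prog_attempt = {''j'', ''i'', ''h'', ''k'', ''l''}"
  "warrs (prog_dot x) = {''g''}"
  "warrs prog_signs = {''g'', ''s''}"
  "warrs prog_round = {''g'', ''s'', ''A'', ''R'', ''K''}"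
  "warrs prog_sign = {''y''}"
  "warrs prog_step = {''g'', ''y'', ''f'', ''chi'', ''w''}"
  "warrs prog_level = {''g'', ''y'', ''f'', ''chi'', ''w''}"
  "warrs prog_attempt = {''g'', ''y'', ''f'', ''chi'', ''w''}"
  by (auto simp: prog_defs)

section \<open>Effect of the deterministic phases on the arrays\<close>

lemma dot_spec:
  assumes "s' \<in> set_pmf (den (prog_dot x) s)" "ivar s ''n'' = n" "x \<noteq> ''g''"
  shows "rarr s' ''g'' 0 0 = inner_dim n (rarr s ''v'' (ivar s ''i'')) (rarr s x 0)"
proof -
  let ?c = "set_cell ''g'' (RPlus (cell ''g'') (RTimes mat_v (entry x ''j'')))"
  let ?s = "set_entry ''g'' 0 0 0 s"
  have s': "s' \<in> set_pmf (den (PFor ''j'' ?c) ?s)"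
    using assms(1) by (simp add: prog_dot_def del: den.simps(6))
  have "rarr s' ''g'' 0 0 = inner_dim n (rarr s ''v'' (ivar s ''i'')) (rarr s x 0)"
    by (rule For_inv[OF _ s', where N = n and I = "\<lambda>k r. r ''g'' 0 0 = inner_dim k (rarr s ''v'' (ivar s ''i'')) (rarr s x 0)"])
      (use assms in \<open>auto simp: inner_dim_def\<close>)
  then show ?thesis .
qed

lemma const_spec:
  assumes "s' \<in> set_pmf (den prog_const s)" "ivar s ''n'' = n" "rarr s ''q'' 0 0 = 0" "rarr s ''c'' 0 0 = 0"
  shows "rarr s' ''c'' 0 0 = 12 * harm n"
proof -
  let ?I = "\<lambda>k r. r ''c'' 0 0 = 12 * harm k \<and> r ''q'' 0 0 = real k"
  have "?I n (rarr s')"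
    by (rule For_inv[OF _ assms(1)[unfolded prog_const_def], where I = ?I])
      (use assms in \<open>auto simp: harm_Suc harm_expand(1) field_simps\<close>)
  then show ?thesis by simp
qed

lemma signs_spec:
  assumes "s' \<in> set_pmf (den prog_signs s)" "ivar s ''n'' = n" "i < n"
  shows "rarr s' ''s'' 0 i = (if inner_dim n (rarr s ''v'' i) (rarr s ''R'' 0) < 0 then 1 else -1)"
proof -
  let ?h = "\<lambda>i. if inner_dim n (rarr s ''v'' i) (rarr s ''R'' 0) < 0 then 1 else -1 :: real"
  let ?I = "\<lambda>k r. \<forall>i<k. r ''s'' 0 i = ?h i"
  let ?d = "PCond (RLess (cell ''g'') (num 0)) (set_vec ''s'' ''i'' (num 1)) (set_vec ''s'' ''i'' (num (-1)))"
  have "?I n (rarr s')"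
  proof (rule For_inv[OF _ assms(1)[unfolded prog_signs_def], where I = ?I])
    fix k and s1 s2 :: state
    assume k: "k < n" "?I k (rarr s1)" "ivar s1 ''i'' = k"
      and z: "\<forall>z. z \<noteq> ''i'' \<longrightarrow> z \<notin> wvars (prog_dot ''R'' ;; ?d) \<longrightarrow> ivar s1 z = ivar s z"
       "\<forall>z. z \<notin> warrs (prog_dot ''R'' ;; ?d) \<longrightarrow> rarr s1 z = rarr s z"
      and s2: "s2 \<in> set_pmf (den (prog_dot ''R'' ;; ?d) s1)"
    from s2 obtain s3 where s3: "s3 \<in> set_pmf (den (prog_dot ''R'') s1)" "s2 \<in> set_pmf (den ?d s3)"
      by auto
    have s1: "ivar s1 ''n'' = n" "rarr s1 ''v'' = rarr s ''v''" "rarr s1 ''R'' = rarr s ''R''"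
      using z assms by simp_all
    have s3': "ivar s3 ''i'' = k" "rarr s3 ''s'' = rarr s1 ''s''"
      using den_frame[OF s3(1)] k by simp_all
    have "s2 = set_entry ''s'' 0 k (?h k) s3"
      using s3(2) dot_spec[OF s3(1) s1(1)] k(3) s1 s3' by (simp split: if_splits)
    then show "?I (Suc k) (rarr s2)" using k s3' by (simp add: less_Suc_eq)
  qed (use assms in \<open>simp_all add: prog_defs\<close>)
  then show ?thesis using assms by simp
qed

lemma round_spec:
  assumes "s' \<in> set_pmf (den prog_round s)" "ivar s ''n'' = n"
  defines "sg \<equiv> \<lambda>i. (if inner_dim n (rarr s ''v'' i) (rarr s ''R'' 0) < 0 then 1 else -1 :: real)"
  shows "\<forall>i<n. rarr s' ''A'' 0 i = rarr s ''A'' 0 i + sg i"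
    and "\<forall>j<n. rarr s' ''R'' 0 j = rarr s ''R'' 0 j + (\<Sum>i<n. sg i * rarr s ''v'' i j) - rarr s ''t'' 0 j"
    and "rarr s' ''K'' 0 0 = rarr s ''K'' 0 0 + 1"
proof -
  let ?c1 = "PFor ''j'' (set_vec ''R'' ''j'' (RPlus (entry ''R'' ''j'') (RTimes (entry ''s'' ''i'') mat_v)))"
  let ?c2 = "PFor ''i'' (set_vec ''A'' ''i'' (RPlus (entry ''A'' ''i'') (entry ''s'' ''i'')) ;; ?c1)"
  let ?c3 = "PFor ''j'' (set_vec ''R'' ''j'' (RMinus (entry ''R'' ''j'') (entry ''t'' ''j'')))"
  obtain s1 s2 s3 where s1: "s1 \<in> set_pmf (den prog_signs s)" and s2: "s2 \<in> set_pmf (den ?c2 s1)"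
    and s3: "s3 \<in> set_pmf (den ?c3 s2)" and s'_eq: "s' = set_entry ''K'' 0 0 (rarr s3 ''K'' 0 0 + 1) s3"
    using assms(1) unfolding prog_round_def by (auto simp del: den.simps(6))
  have sg: "rarr s1 ''s'' 0 i = sg i" if "i < n" for i
    using signs_spec[OF s1] assms that by simp
  note f1 = den_frame[OF s1]
  let ?I = "\<lambda>k r. (\<forall>i<n. r ''A'' 0 i = rarr s ''A'' 0 i + (if i < k then sg i else 0))
    \<and> (\<forall>j<n. r ''R'' 0 j = rarr s ''R'' 0 j + (\<Sum>i<k. sg i * rarr s ''v'' i j))"
  have 2: "?I n (rarr s2)"
  proof (rule For_inv[OF _ s2, where I = ?I])
    fix k and t1 t2 :: state
    assume k: "k < n" "?I k (rarr t1)" "ivar t1 ''i'' = k"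
      and z: "\<forall>z. z \<noteq> ''i'' \<longrightarrow> z \<notin> wvars (set_vec ''A'' ''i'' (RPlus (entry ''A'' ''i'') (entry ''s'' ''i'')) ;; ?c1) \<longrightarrow> ivar t1 z = ivar s1 z"
       "\<forall>z. z \<notin> warrs (set_vec ''A'' ''i'' (RPlus (entry ''A'' ''i'') (entry ''s'' ''i'')) ;; ?c1) \<longrightarrow> rarr t1 z = rarr s1 z"
      and t2: "t2 \<in> set_pmf (den (set_vec ''A'' ''i'' (RPlus (entry ''A'' ''i'') (entry ''s'' ''i'')) ;; ?c1) t1)"
    let ?t = "set_entry ''A'' 0 k (rarr t1 ''A'' 0 k + rarr t1 ''s'' 0 k) t1"
    have t2': "t2 \<in> set_pmf (den ?c1 ?t)"
      using t2 k by (simp del: den.simps(6))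
    let ?J = "\<lambda>l r. \<forall>j<n. r ''R'' 0 j = rarr t1 ''R'' 0 j + (if j < l then sg k * rarr s ''v'' k j else 0)"
    have "?J n (rarr t2)"
      by (rule For_inv[OF _ t2', where I = ?J]) (use z k f1 assms sg in \<open>auto simp: less_Suc_eq\<close>)
    then show "?I (Suc k) (rarr t2)"
      using den_frame[OF t2'] z k f1 sg by (auto simp: less_Suc_eq)
  qed (use f1 assms in auto)
  let ?J = "\<lambda>l r. \<forall>j<n. r ''R'' 0 j = rarr s2 ''R'' 0 j - (if j < l then rarr s ''t'' 0 j else 0)"
  note f2 = den_frame[OF s2] and f3 = den_frame[OF s3]
  have 3: "?J n (rarr s3)"
    by (rule For_inv[OF _ s3, where I = ?J]) (use f1 f2 assms in \<open>auto simp: less_Suc_eq\<close>)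
  show "\<forall>i<n. rarr s' ''A'' 0 i = rarr s ''A'' 0 i + sg i"
    "\<forall>j<n. rarr s' ''R'' 0 j = rarr s ''R'' 0 j + (\<Sum>i<n. sg i * rarr s ''v'' i j) - rarr s ''t'' 0 j"
    "rarr s' ''K'' 0 0 = rarr s ''K'' 0 0 + 1"
    using 2 3 f1 f2 f3 by (auto simp: s'_eq)
qed

section \<open>Greedy approximation and binary digits\<close>

lemma inner_dim_cong: "(\<And>j. j < n \<Longrightarrow> x j = x' j) \<Longrightarrow> (\<And>j. j < n \<Longrightarrow> y j = y' j) \<Longrightarrow> inner_dim n x y = inner_dim n x' y'"
  by (simp add: inner_dim_def)

lemma inner_dim_commute: "inner_dim n x y = inner_dim n y x"
  by (simp add: inner_dim_def mult.commute)

lemma inner_dim_sum: "inner_dim n (\<lambda>j. \<Sum>i\<in>I. a i * v i j) y = (\<Sum>i\<in>I. a i * inner_dim n (v i) y)"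
  unfolding inner_dim_def sum_distrib_right sum_distrib_left by (subst sum.swap) (simp add: mult.assoc)

lemma inner_dim_add: "inner_dim n (\<lambda>j. x j + y j) z = inner_dim n x z + inner_dim n y z"
  and inner_dim_diff: "inner_dim n (\<lambda>j. x j - y j) z = inner_dim n x z - inner_dim n y z"
  and inner_dim_scale: "inner_dim n (\<lambda>j. a * x j) z = a * inner_dim n x z"
  by (simp_all add: inner_dim_def algebra_simps sum.distrib sum_subtractf sum_distrib_left)

lemma inner_dim_nonneg: "0 \<le> inner_dim n x x"
  by (simp add: inner_dim_def sum_nonneg)

lemma inner_dim_CS: "(inner_dim n x y)\<^sup>2 \<le> inner_dim n x x * inner_dim n y y"
  unfolding inner_dim_def using Cauchy_Schwarz_ineq_sum[of x y "{..<n}"] by (simp add: power2_eq_square)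

lemma inner_dim_bound:
  assumes "inner_dim n x x \<le> a\<^sup>2" "inner_dim n y y \<le> b\<^sup>2" "0 \<le> a" "0 \<le> b"
  shows "\<bar>inner_dim n x y\<bar> \<le> a * b"
proof -
  have "(inner_dim n x y)\<^sup>2 \<le> a\<^sup>2 * b\<^sup>2"
    using inner_dim_CS[of n x y] mult_mono[OF assms(1,2)] inner_dim_nonneg[of n y] by simp
  then show ?thesis using assms by (simp add: abs_le_square_iff[symmetric] power_mult_distrib[symmetric])
qed

text \<open>The triangle inequality in squared form: the left-hand side expands into
  \<open>m * m\<close> Gram entries, each at most 1 in absolute value by Cauchy-Schwarz and weighted
  by at most \<open>b * b\<close>.\<close>

lemma inner_dim_comb_bound:
  assumes "\<forall>i<m. \<bar>a i\<bar> \<le> b" "\<forall>i<m. inner_dim n (v i) (v i) \<le> 1" "0 \<le> b"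
  shows "inner_dim n (\<lambda>j. \<Sum>i<m. a i * v i j) (\<lambda>j. \<Sum>i<m. a i * v i j) \<le> (b * real m)\<^sup>2"
proof -
  let ?d = "\<lambda>j. \<Sum>i<m. a i * v i j"
  have "inner_dim n ?d ?d = (\<Sum>i<m. a i * (\<Sum>k<m. a k * inner_dim n (v k) (v i)))"
    by (subst inner_dim_sum, subst inner_dim_commute, subst inner_dim_sum) simp
  also have "\<dots> \<le> (\<Sum>i<m. b * (\<Sum>k<m. b * 1))"
  proof -
    have *: "\<bar>a k * inner_dim n (v k) (v i)\<bar> \<le> b * 1" if "k < m" "i < m" for k i
      unfolding abs_mult using that assms inner_dim_bound[of n "v k" 1 "v i" 1] by (intro mult_mono) auto
    have "a i * (\<Sum>k<m. a k * inner_dim n (v k) (v i)) \<le> b * (\<Sum>k<m. b * 1)" if "i < m" for i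
    proof -
      have "\<bar>\<Sum>k<m. a k * inner_dim n (v k) (v i)\<bar> \<le> (\<Sum>k<m. b * 1)"
        by (rule order_trans[OF sum_abs], rule sum_mono) (use * that in auto)
      then have "\<bar>a i\<bar> * \<bar>\<Sum>k<m. a k * inner_dim n (v k) (v i)\<bar> \<le> b * (\<Sum>k<m. b * 1)"
        using that assms by (intro mult_mono) auto
      then show ?thesis by (simp add: abs_mult[symmetric])
    qed
    then show ?thesis by (intro sum_mono) auto
  qed
  finally show ?thesis by (simp add: power2_eq_square algebra_simps)
qed

text \<open>Since \<open>l i\<close> lies in \<open>[-1, 1]\<close>, the difference
  \<open>sg i - l i\<close> is zero or has the sign of \<open>sg i\<close>, which is chosen against
  the inner product of \<open>v i\<close> and \<open>R\<close>. Hence the cross term is nonpositive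
  and only the quadratic term remains.\<close>

lemma greedy_step:
  fixes R :: "nat \<Rightarrow> real"
  assumes v: "\<forall>i<m. inner_dim n (v i) (v i) \<le> 1" and l: "\<forall>i<m. \<bar>l i\<bar> \<le> 1"
  defines "sg \<equiv> \<lambda>i. (if inner_dim n (v i) R < 0 then 1 else -1 :: real)"
  defines "d \<equiv> \<lambda>j. \<Sum>i<m. (sg i - l i) * v i j"
  shows "inner_dim n (\<lambda>j. R j + d j) (\<lambda>j. R j + d j) \<le> inner_dim n R R + (2 * real m)\<^sup>2"
proof -
  have "(sg i - l i) * inner_dim n (v i) R \<le> 0" if "i < m" for i
    using l[rule_format, OF that] unfolding sg_def by (auto simp: mult_nonneg_nonpos mult_nonpos_nonneg)
  then have 1: "inner_dim n d R \<le> 0"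
    unfolding d_def inner_dim_sum by (intro sum_nonpos) auto
  have "\<forall>i<m. \<bar>sg i - l i\<bar> \<le> 2"
    using l unfolding sg_def by (auto simp: abs_le_iff)
  then have 2: "inner_dim n d d \<le> (2 * real m)\<^sup>2"
    unfolding d_def by (intro inner_dim_comb_bound v) auto
  have "inner_dim n (\<lambda>j. R j + d j) (\<lambda>j. R j + d j) = inner_dim n R R + 2 * inner_dim n d R + inner_dim n d d"
    by (simp add: inner_dim_add inner_dim_commute[of n _ "\<lambda>j. R j + d j"] inner_dim_commute[of n R d])
  then show ?thesis using 1 2 by simp
qed

text \<open>The squared residual grows only linearly in the number \<open>m\<close> of rounds. At
  \<open>m = n * n\<close> this bounds the norm of \<open>R\<close> by \<open>2 * n\<^sup>2\<close>,
  so that \<open>A / K\<close> misses \<open>t\<close> by at most 2.\<close>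

definition greedy_inv :: "nat \<Rightarrow> (nat \<Rightarrow> nat \<Rightarrow> real) \<Rightarrow> (nat \<Rightarrow> real) \<Rightarrow> nat \<Rightarrow> (string \<Rightarrow> nat \<Rightarrow> nat \<Rightarrow> real) \<Rightarrow> bool" where
  "greedy_inv n v t m r \<longleftrightarrow> r ''K'' 0 0 = real m \<and> (\<forall>i<n. \<bar>r ''A'' 0 i\<bar> \<le> real m) \<and>
     (\<forall>j<n. r ''R'' 0 j = (\<Sum>i<n. r ''A'' 0 i * v i j) - real m * t j) \<and>
     inner_dim n (r ''R'' 0) (r ''R'' 0) \<le> real m * (2 * real n)\<^sup>2"

text \<open>The coefficients \<open>l\<close> of \<open>t\<close> are unknown to the program and
  occur only in the analysis: they turn the increment of \<open>R\<close> into
  \<open>\<Sum> (sg\<^sub>i - l\<^sub>i) v\<^sub>i\<close>, to which \<open>greedy_step\<close>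
  applies.\<close>

lemma round_inv:
  assumes s': "s' \<in> set_pmf (den prog_round s)" and n: "ivar s ''n'' = n"
    and vt: "\<forall>i<n. \<forall>j<n. rarr s ''v'' i j = v i j" "\<forall>j<n. rarr s ''t'' 0 j = t j"
    and v: "\<forall>i<n. inner_dim n (v i) (v i) \<le> 1" and t: "t \<in> zonotope n v"
    and I: "greedy_inv n v t m (rarr s)"
  shows "greedy_inv n v t (Suc m) (rarr s')"
proof -
  obtain l where l: "\<forall>i<n. l i \<in> {-1..1}" "\<forall>j<n. t j = (\<Sum>i<n. l i * v i j)"
    using t by (auto simp: zonotope_def)
  let ?R = "rarr s ''R'' 0"
  define sg where "sg i = (if inner_dim n (v i) ?R < 0 then 1 else -1 :: real)" for i
  have vi: "inner_dim n (rarr s ''v'' i) ?R = inner_dim n (v i) ?R" if "i < n" for i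
    by (rule inner_dim_cong) (use vt that in auto)
  note r = round_spec[OF s' n]
  have A: "\<forall>i<n. rarr s' ''A'' 0 i = rarr s ''A'' 0 i + sg i"
    using r(1) vi by (auto simp: sg_def)
  have "(\<Sum>i<n. (if inner_dim n (rarr s ''v'' i) ?R < 0 then 1 else -1 :: real) * rarr s ''v'' i j) = (\<Sum>i<n. sg i * v i j)"
    if "j < n" for j using vi vt that by (intro sum.cong) (auto simp: sg_def)
  then have R: "\<forall>j<n. rarr s' ''R'' 0 j = ?R j + (\<Sum>i<n. sg i * v i j) - t j"
    using r(2) vt by simp
  have R': "rarr s' ''R'' 0 j = ?R j + (\<Sum>i<n. (sg i - l i) * v i j)" if "j < n" for j
    using R l that by (simp add: left_diff_distrib sum_subtractf)
  have "inner_dim n (rarr s' ''R'' 0) (rarr s' ''R'' 0) \<le> inner_dim n ?R ?R + (2 * real n)\<^sup>2"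
    using greedy_step[OF v, of l ?R] l(1) inner_dim_cong[OF R' R'] by (simp add: sg_def abs_le_iff)
  moreover have "\<bar>rarr s' ''A'' 0 i\<bar> \<le> real (Suc m)" if "i < n" for i
  proof -
    have "\<bar>rarr s ''A'' 0 i\<bar> \<le> real m" "\<bar>sg i\<bar> \<le> 1" using I that by (auto simp: greedy_inv_def sg_def)
    then show ?thesis using A that by simp
  qed
  moreover have "rarr s' ''R'' 0 j = (\<Sum>i<n. rarr s' ''A'' 0 i * v i j) - real (Suc m) * t j" if "j < n" for j
  proof -
    have "(\<Sum>i<n. rarr s' ''A'' 0 i * v i j) = (\<Sum>i<n. rarr s ''A'' 0 i * v i j) + (\<Sum>i<n. sg i * v i j)"
      by (subst sum.distrib[symmetric], rule sum.cong) (use A in \<open>auto simp: distrib_right\<close>)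
    then show ?thesis using I R that by (simp add: greedy_inv_def distrib_right)
  qed
  ultimately show ?thesis
    using I r(3) by (auto simp: greedy_inv_def distrib_right)
qed

lemma greedy_spec:
  assumes s': "s' \<in> set_pmf (den prog_greedy s)" and n: "ivar s ''n'' = n"
    and vt: "\<forall>i<n. \<forall>j<n. rarr s ''v'' i j = v i j" "\<forall>j<n. rarr s ''t'' 0 j = t j"
    and v: "\<forall>i<n. inner_dim n (v i) (v i) \<le> 1" and t: "t \<in> zonotope n v"
    and I: "rarr s ''K'' 0 0 = 0" "\<forall>i<n. rarr s ''A'' 0 i = 0" "\<forall>i<n. rarr s ''R'' 0 i = 0"
  shows "greedy_inv n v t (n * n) (rarr s')"
proof -
  have "greedy_inv n v t (n * n) (rarr s')"
  proof (rule For_inv[OF _ s'[unfolded prog_greedy_def], where I = "\<lambda>k. greedy_inv n v t (n * k)"])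
    fix k and s1 s2 :: state
    assume k: "k < n" "greedy_inv n v t (n * k) (rarr s1)"
      and z: "\<forall>z. z \<noteq> ''a'' \<longrightarrow> z \<notin> wvars (PFor ''b'' prog_round) \<longrightarrow> ivar s1 z = ivar s z"
       "\<forall>z. z \<notin> warrs (PFor ''b'' prog_round) \<longrightarrow> rarr s1 z = rarr s z"
      and s2: "s2 \<in> set_pmf (den (PFor ''b'' prog_round) s1)"
    have "greedy_inv n v t (n * k + n) (rarr s2)"
    proof (rule For_inv[OF _ s2, where I = "\<lambda>l. greedy_inv n v t (n * k + l)"])
      fix l and t1 t2 :: state
      assume l: "l < n" "greedy_inv n v t (n * k + l) (rarr t1)"
      and y: "\<forall>z. z \<noteq> ''b'' \<longrightarrow> z \<notin> wvars prog_round \<longrightarrow> ivar t1 z = ivar s1 z"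
       "\<forall>z. z \<notin> warrs prog_round \<longrightarrow> rarr t1 z = rarr s1 z"
      and t2: "t2 \<in> set_pmf (den prog_round t1)"
      have "ivar t1 ''n'' = n" "rarr t1 ''v'' = rarr s ''v''" "rarr t1 ''t'' = rarr s ''t''"
        using y z n by simp_all
      then show "greedy_inv n v t (n * k + Suc l) (rarr t2)"
        using round_inv[OF t2 _ _ _ v t l(2)] vt by simp
    qed (use k z n in \<open>simp_all add: prog_defs\<close>)
    then show "greedy_inv n v t (n * Suc k) (rarr s2)" by (simp add: add.commute)
  qed (use I n in \<open>simp_all add: greedy_inv_def prog_defs inner_dim_def\<close>)
  then show ?thesis .
qed

section \<open>Binary digits of the approximating point\<close>

definition digits_inv :: "nat \<Rightarrow> nat \<Rightarrow> (string \<Rightarrow> nat \<Rightarrow> nat \<Rightarrow> real) \<Rightarrow> nat \<Rightarrow> bool" where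
  "digits_inv n m r i \<longleftrightarrow> r ''r'' n i = r ''A'' 0 i / r ''K'' 0 0 \<and> (\<forall>p. m \<le> p \<longrightarrow> p \<le> n \<longrightarrow> \<bar>r ''r'' p i\<bar> \<le> 1) \<and>
    (\<forall>p. m \<le> p \<longrightarrow> p < n \<longrightarrow> r ''S'' p i \<in> {-1, 1} \<and> r ''r'' (Suc p) i = (r ''S'' p i + r ''r'' p i) / 2)"

lemma digits_inv_cong:
  assumes "r' ''A'' 0 i = r ''A'' 0 i" "r' ''K'' 0 0 = r ''K'' 0 0" "\<And>p. r' ''r'' p i = r ''r'' p i"
    "\<And>p. r' ''S'' p i = r ''S'' p i"
  shows "digits_inv n m r' i \<longleftrightarrow> digits_inv n m r i"
  by (simp add: digits_inv_def assms)

text \<open>If \<open>x\<close> lies in \<open>[-1, 1]\<close> and \<open>S\<close> is its sign,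
  then \<open>2 * x - S\<close> lies in \<open>[-1, 1]\<close> again, and \<open>x\<close> is the
  average of \<open>S\<close> and \<open>2 * x - S\<close>. The rows are filled from
  \<open>n\<close> downwards.\<close>

lemma digits_spec:
  assumes s': "s' \<in> set_pmf (den prog_digits s)" and n: "ivar s ''n'' = n"
    and A: "\<forall>i<n. \<bar>rarr s ''A'' 0 i\<bar> \<le> rarr s ''K'' 0 0"
  shows "\<forall>i<n. digits_inv n 0 (rarr s') i"
proof -
  let ?p = "IMinus (IVar ''n'') (IVar ''k'')" and ?q = "IMinus (IMinus (IVar ''n'') (IVar ''k'')) (INum 1)" and ?i = "IVar ''i''"
  let ?c = "PCond (RLess (REntry ''r'' ?p ?i) (num 0)) (PRSet ''S'' ?q ?i (num (-1))) (PRSet ''S'' ?q ?i (num 1)) ;;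
        PRSet ''r'' ?q ?i (RMinus (RTimes (num 2) (REntry ''r'' ?p ?i)) (REntry ''S'' ?q ?i))"
  let ?d = "PRSet ''r'' (IVar ''n'') (IVar ''i'') (RDiv (entry ''A'' ''i'') (cell ''K''))"
  let ?I = "\<lambda>k r. \<forall>i<k. digits_inv n 0 r i"
  have s'': "s' \<in> set_pmf (den (PFor ''i'' (?d ;; PFor ''k'' ?c)) s)"
    using s' by (simp add: prog_digits_def Let_def del: den.simps)
  have "?I n (rarr s')"
  proof (rule For_inv[OF _ s'', where I = ?I])
    fix k and s1 s2 :: state
    assume k: "k < n" "?I k (rarr s1)" "ivar s1 ''i'' = k"
      and z: "\<forall>z. z \<noteq> ''i'' \<longrightarrow> z \<notin> wvars (?d ;; PFor ''k'' ?c) \<longrightarrow> ivar s1 z = ivar s z"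
       "\<forall>z. z \<notin> warrs (?d ;; PFor ''k'' ?c) \<longrightarrow> rarr s1 z = rarr s z"
      and s2: "s2 \<in> set_pmf (den (?d ;; PFor ''k'' ?c) s1)"
    have s1: "ivar s1 ''n'' = n" "rarr s1 ''A'' = rarr s ''A''" "rarr s1 ''K'' = rarr s ''K''" using z n by simp_all
    let ?t = "set_entry ''r'' n k (rarr s ''A'' 0 k / rarr s ''K'' 0 0) s1"
    have s2': "s2 \<in> set_pmf (den (PFor ''k'' ?c) ?t)"
      using s2 s1 k by (simp del: den.simps(6))
    let ?J = "\<lambda>l r. digits_inv n (n - l) r k \<and> (\<forall>i<k. digits_inv n 0 r i)"
    have "?J n (rarr s2)"
    proof (rule For_inv[OF _ s2', where I = ?J])
      have "digits_inv n 0 (rarr ?t) i" if "i < k" for i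
        using k(2) that digits_inv_cong[of "rarr ?t" i "rarr s1" n 0] by simp
      \<comment> \<open>The case \<open>K = 0\<close> is covered by the convention that division by
        zero yields 0.\<close>
      moreover have "\<bar>rarr s ''A'' 0 k / rarr s ''K'' 0 0\<bar> \<le> 1"
        using A[rule_format, OF k(1)] by (cases "rarr s ''K'' 0 0 = 0") (auto simp: abs_divide divide_le_eq_1)
      then have "digits_inv n n (rarr ?t) k" using s1 by (auto simp: digits_inv_def)
      ultimately show "?J 0 (rarr ?t)" by simp
    next
      fix l and t1 t2 :: state
      assume l: "l < n" "?J l (rarr t1)" "ivar t1 ''k'' = l"
        and y: "\<forall>z. z \<noteq> ''k'' \<longrightarrow> z \<notin> wvars ?c \<longrightarrow> ivar t1 z = ivar ?t z"
         "\<forall>z. z \<notin> warrs ?c \<longrightarrow> rarr t1 z = rarr ?t z"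
        and t2: "t2 \<in> set_pmf (den ?c t1)"
      define x where "x = rarr t1 ''r'' (n - l) k"
      \<comment> \<open>Round \<open>l\<close> reads row \<open>n - l\<close> of \<open>r\<close>
        and writes row \<open>q\<close> of \<open>S\<close> and \<open>r\<close>.\<close>
      define q where "q = n - l - 1"
      have q: "Suc q = n - l" "q < n" using l by (auto simp: q_def)
      define S where "S = (if x < 0 then -1 else 1 :: real)"
      have t1: "ivar t1 ''n'' = n" "ivar t1 ''i'' = k" using y s1 k by simp_all
      have t2': "t2 = set_entry ''r'' q k (2 * x - S) (set_entry ''S'' q k S t1)"
        using t2 t1 l q by (auto simp: x_def S_def q_def split: if_splits)
      have "\<bar>x\<bar> \<le> 1" using l by (auto simp: digits_inv_def x_def)
      then have S: "\<bar>2 * x - S\<bar> \<le> 1" "S \<in> {-1, 1}" by (auto simp: S_def)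
      have x: "rarr t1 ''r'' (Suc q) k = x" using q by (simp add: x_def)
      have q': "n - Suc l = q" by (simp add: q_def)
      have "digits_inv n q (rarr t2) k"
        unfolding digits_inv_def
      proof (intro conjI allI impI)
        show "rarr t2 ''r'' n k = rarr t2 ''A'' 0 k / rarr t2 ''K'' 0 0"
          using l q by (simp add: t2' digits_inv_def)
      next
        fix p assume "q \<le> p" "p \<le> n"
        then show "\<bar>rarr t2 ''r'' p k\<bar> \<le> 1"
          using l(2) S q by (cases "p = q") (auto simp: t2' digits_inv_def)
      next
        fix p assume p: "q \<le> p" "p < n"
        show "rarr t2 ''S'' p k \<in> {-1, 1}"
          using l(2) S q p by (cases "p = q") (auto simp: t2' digits_inv_def)
        show "rarr t2 ''r'' (Suc p) k = (rarr t2 ''S'' p k + rarr t2 ''r'' p k) / 2"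
          using l(2) S q p x by (cases "p = q") (auto simp: t2' digits_inv_def)
      qed
      moreover have "digits_inv n 0 (rarr t2) i" if "i < k" for i
        using l(2) that digits_inv_cong[of "rarr t2" i "rarr t1" n 0] by (simp add: t2')
      ultimately show "?J (Suc l) (rarr t2)" by (simp add: q')
    qed (use s1 in simp_all)
    then show "?I (Suc k) (rarr s2)" by (simp add: less_Suc_eq)
  qed (use n in simp_all)
  then show ?thesis .
qed

lemma ones_spec:
  assumes "s' \<in> set_pmf (den prog_ones s)" "ivar s ''n'' = n"
  shows "\<forall>i<n. rarr s' ''chi'' 0 i = 1"
proof -
  have "\<forall>i<n. rarr s' ''chi'' 0 i = 1"
    by (rule For_inv[OF _ assms(1)[unfolded prog_ones_def], where I = "\<lambda>k r. \<forall>i<k. r ''chi'' 0 i = 1"])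
      (use assms in \<open>simp_all add: less_Suc_eq\<close>)
  then show ?thesis .
qed

text \<open>The rounding process starts from the all-ones coloring, which stands for the remainder of the expansion.\<close>

primrec lam :: "(nat \<Rightarrow> nat \<Rightarrow> real) \<Rightarrow> nat \<Rightarrow> nat \<Rightarrow> real" where
  "lam S 0 i = 1"
| "lam S (Suc k) i = (S k i + lam S k i) / 2"

text \<open>Both sequences satisfy the same averaging recursion with the same digits, so their
  difference halves at every level; it is at most 2 at level 0, where 1 is compared with a number in
  \<open>[-1, 1]\<close>.\<close>

lemma lam_digits:
  assumes "digits_inv n 0 r i" "p \<le> n"
  shows "\<bar>lam (r ''S'') p i - r ''r'' p i\<bar> \<le> 2 / 2 ^ p"
  using assms(2)
proof (induction p)
  case 0
  have "\<bar>r ''r'' 0 i\<bar> \<le> 1" using assms by (auto simp: digits_inv_def)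
  then show ?case by simp
next
  case (Suc p)
  then have "r ''r'' (Suc p) i = (r ''S'' p i + r ''r'' p i) / 2" using assms by (auto simp: digits_inv_def)
  then have "lam (r ''S'') (Suc p) i - r ''r'' (Suc p) i = (lam (r ''S'') p i - r ''r'' p i) / 2"
    by (simp add: field_simps)
  then have "\<bar>lam (r ''S'') (Suc p) i - r ''r'' (Suc p) i\<bar> = \<bar>lam (r ''S'') p i - r ''r'' p i\<bar> / 2"
    by (simp only: abs_divide abs_numeral)
  then show ?case using Suc by (simp del: lam.simps)
qed

text \<open>The bound 3 is the sum of two errors: at most 1 from truncating the expansion, because
  \<open>n * (2 / 2 ^ n)\<close> is at most 1, and at most 2 from the greedy residual divided by
  \<open>n * n\<close>.\<close>

lemma lam_error:
  assumes n: "n \<ge> 1" and v: "\<forall>i<n. inner_dim n (v i) (v i) \<le> 1" and g: "greedy_inv n v t (n * n) r" and d: "\<forall>i<n. digits_inv n 0 r i"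
    and \<theta>: "inner_dim n \<theta> \<theta> = 1"
  shows "\<bar>inner_dim n (\<lambda>j. (\<Sum>i<n. lam (r ''S'') n i * v i j) - t j) \<theta>\<bar> \<le> 3"
proof -
  let ?e = "\<lambda>j. \<Sum>i<n. (lam (r ''S'') n i - r ''r'' n i) * v i j"
  have "real n / 2 ^ n \<le> 1 / 2"
  proof -
    obtain m where m: "n = Suc m" using n by (cases n) auto
    have "Suc m \<le> 2 ^ m" by (induction m) auto
    then have "real (Suc m) \<le> 2 ^ m" by (metis of_nat_le_iff of_nat_numeral of_nat_power)
    then show ?thesis by (simp add: m field_simps)
  qed
  then have nn: "2 / 2 ^ n * real n \<le> 1" by simp
  have "inner_dim n ?e ?e \<le> (2 / 2 ^ n * real n)\<^sup>2"
    by (intro inner_dim_comb_bound v) (use lam_digits[OF d[rule_format]] in auto)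
  also have "\<dots> \<le> 1\<^sup>2" using nn by (intro power_mono) auto
  finally have 1: "\<bar>inner_dim n ?e \<theta>\<bar> \<le> 1 * 1" using \<theta> by (intro inner_dim_bound) auto
  let ?R = "r ''R'' 0" and ?N = "real (n * n)"
  have N: "?N > 0" using n by simp
  have "inner_dim n ?R ?R \<le> (2 * ?N)\<^sup>2"
    using g by (simp add: greedy_inv_def power2_eq_square algebra_simps)
  then have 2: "\<bar>inner_dim n ?R \<theta>\<bar> \<le> 2 * ?N * 1" using \<theta> by (intro inner_dim_bound) auto
  have eq: "(\<Sum>i<n. lam (r ''S'') n i * v i j) - t j = ?e j + (1 / ?N) * ?R j" if "j < n" for j
  proof -
    have "?R j = (\<Sum>i<n. r ''A'' 0 i * v i j) - ?N * t j" using g that by (simp add: greedy_inv_def)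
    then have *: "(1 / ?N) * ?R j = (\<Sum>i<n. (r ''A'' 0 i / ?N) * v i j) - t j"
      using N n by (simp add: right_diff_distrib sum_divide_distrib diff_divide_distrib)
    have "r ''A'' 0 i / ?N = r ''r'' n i" if "i < n" for i
      using d that g by (auto simp: digits_inv_def greedy_inv_def)
    then have "(\<Sum>i<n. (r ''A'' 0 i / ?N) * v i j) = (\<Sum>i<n. r ''r'' n i * v i j)"
      by (intro sum.cong) auto
    then show ?thesis unfolding * by (simp add: left_diff_distrib sum_subtractf)
  qed
  have "inner_dim n (\<lambda>j. (\<Sum>i<n. lam (r ''S'') n i * v i j) - t j) \<theta> = inner_dim n (\<lambda>j. ?e j + (1 / ?N) * ?R j) \<theta>"
    by (rule inner_dim_cong) (use eq in auto)
  also have "\<dots> = inner_dim n ?e \<theta> + inner_dim n ?R \<theta> / ?N"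
    by (simp only: inner_dim_add inner_dim_scale) simp
  also have "\<bar>\<dots>\<bar> \<le> 3"
  proof -
    have "\<bar>inner_dim n ?R \<theta> / ?N\<bar> \<le> 2" using 2 N by (simp add: abs_divide divide_le_eq)
    then show ?thesis using 1 by linarith
  qed
  finally show ?thesis .
qed

section \<open>The self-balancing walk\<close>

lemma wf_simps [simp]:
  "wf_prog (prog_dot x)" "wf_prog prog_coin" "wf_prog prog_sign" "wf_prog prog_step" "wf_prog prog_level"
  "wf_prog prog_ones" "wf_prog prog_attempt" "wvars prog_coin = {''h''}" "warrs prog_coin = {''y''}"
  by (simp_all add: prog_defs)

text \<open>Hoeffding's lemma: the left-hand side is the exponential moment at \<open>a\<close> of a
  sign with mean \<open>y\<close>. The library inequality is applied with success probability
  \<open>p = (1 + y) / 2\<close> and range \<open>2 * a\<close>, after factoring out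
  \<open>exp a\<close>. Negative \<open>a\<close> follows by flipping the signs of both
  \<open>a\<close> and \<open>y\<close>.\<close>

lemma cosh_sinh_le:
  fixes a y :: real
  assumes "\<bar>y\<bar> \<le> 1"
  shows "cosh a + y * sinh a \<le> exp (a * y + a\<^sup>2 / 2)"
proof -
  have pos: "cosh a + y * sinh a \<le> exp (a * y + a\<^sup>2 / 2)" if "a \<ge> 0" "\<bar>y\<bar> \<le> 1" for a y :: real
  proof -
    define p where "p = (1 + y) / 2"
    let ?c = "cosh a + y * sinh a"
    have "exp (2 * a) = exp a * exp a" by (simp add: mult_exp_exp)
    then have eq: "1 + p * (exp (2 * a) - 1) = exp a * ?c"
      by (simp add: p_def cosh_def sinh_def field_simps exp_minus)
    have "\<bar>y * sinh a\<bar> \<le> 1 * sinh a"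
      unfolding abs_mult using that by (intro mult_mono) auto
    then have "?c \<ge> cosh a - sinh a" by linarith
    also have "cosh a - sinh a = exp (- a)" by (simp add: cosh_minus_sinh)
    finally have c: "?c > 0" using exp_gt_zero[of "-a"] by linarith
    have "- (2 * a) * p + ln (1 + p * (exp (2 * a) - 1)) \<le> (2 * a)\<^sup>2 / 8"
      by (rule Hoeffdings_lemma_aux) (use that in \<open>auto simp: p_def\<close>)
    then have "- (2 * a) * p + (a + ln ?c) \<le> a\<^sup>2 / 2"
      unfolding eq using c by (simp add: ln_mult power2_eq_square)
    then have "ln ?c \<le> a * y + a\<^sup>2 / 2" by (simp add: p_def field_simps)
    then have "exp (ln ?c) \<le> exp (a * y + a\<^sup>2 / 2)" by simp
    then show ?thesis using c by simp
  qed
  show ?thesis using pos[of a y] pos[of "- a" "- y"] assms by (cases "a \<ge> 0") auto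
qed

lemma coin_nn_integral:
  fixes F :: "real \<Rightarrow> ennreal" and s :: state
  shows "(\<integral>\<^sup>+ s'. F (rarr s' ''y'' 0 0) \<partial>measure_pmf (den prog_coin s)) =
    (let y = rarr s ''y'' 0 0 in if y < 0 then F (2 * y + 1) / 2 + F (-1) / 2 else F 1 / 2 + F (2 * y - 1) / 2)"
  by (simp add: prog_coin_def Let_def nn_integral_bind_pmf bind_map_pmf divide_ennreal_def)

lemma coin_range:
  assumes "s' \<in> set_pmf (den prog_coin s)" "\<bar>rarr s ''y'' 0 0\<bar> \<le> 1"
  shows "\<bar>rarr s' ''y'' 0 0\<bar> \<le> 1"
  using assms by (cases "rarr s ''y'' 0 0 < 0") (auto simp: prog_coin_def Let_def abs_le_iff split: if_split_asm)

lemma sign_range: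
  assumes "s' \<in> set_pmf (den prog_sign s)" "\<bar>rarr s ''y'' 0 0\<bar> \<le> 1"
  shows "\<bar>rarr s' ''y'' 0 0\<bar> \<le> 1"
  by (rule For_inv[OF _ assms(1)[unfolded prog_sign_def] refl, where I = "\<lambda>_ r. \<bar>r ''y'' 0 0\<bar> \<le> 1"])
    (use assms in \<open>auto dest!: coin_range\<close>)

text \<open>The martingale property: the two successors of \<open>y\<close> have average
  \<open>y\<close>. The condition relating \<beta> and \<alpha> keeps the affine function
  nonnegative on \<open>[-1, 1]\<close>, so that \<open>ennreal\<close> does not truncate
  it.\<close>

lemma coin_linear:
  assumes "\<bar>rarr s ''y'' 0 0\<bar> \<le> 1" "\<bar>\<beta>\<bar> \<le> \<alpha>"
  shows "(\<integral>\<^sup>+ s'. ennreal (\<alpha> + \<beta> * rarr s' ''y'' 0 0) \<partial>measure_pmf (den prog_coin s)) = ennreal (\<alpha> + \<beta> * rarr s ''y'' 0 0)"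
proof -
  have p: "0 \<le> \<alpha> + \<beta> * y" if "\<bar>y\<bar> \<le> 1" for y
  proof -
    have "\<bar>\<beta> * y\<bar> \<le> \<alpha> * 1" unfolding abs_mult using that assms by (intro mult_mono) auto
    then show ?thesis by linarith
  qed
  have "ennreal (\<alpha> + \<beta> * a) / 2 + ennreal (\<alpha> + \<beta> * b) / 2 = ennreal (\<alpha> + \<beta> * ((a + b) / 2))"
    if "\<bar>a\<bar> \<le> 1" "\<bar>b\<bar> \<le> 1" for a b
  proof -
    have "ennreal (\<alpha> + \<beta> * a) / 2 + ennreal (\<alpha> + \<beta> * b) / 2 = ennreal ((\<alpha> + \<beta> * a) / 2 + (\<alpha> + \<beta> * b) / 2)"
      using p[OF that(1)] p[OF that(2)] by (simp add: ennreal_plus divide_ennreal[symmetric])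
    also have "(\<alpha> + \<beta> * a) / 2 + (\<alpha> + \<beta> * b) / 2 = \<alpha> + \<beta> * ((a + b) / 2)"
      by (simp add: field_simps)
    finally show ?thesis .
  qed
  from this[of "2 * rarr s ''y'' 0 0 + 1" "-1"] this[of 1 "2 * rarr s ''y'' 0 0 - 1"] show ?thesis
    using assms by (subst coin_nn_integral) (simp add: Let_def abs_le_iff)
qed

text \<open>Affine test functions suffice for the analysis, because every function on
  \<open>{-1, 1}\<close> is affine; \<open>exp (a * y)\<close> is represented there by
  \<open>cosh a + y * sinh a\<close>.\<close>

lemma sign_linear:
  assumes "\<bar>rarr s ''y'' 0 0\<bar> \<le> 1" "\<bar>\<beta>\<bar> \<le> \<alpha>"
  shows "(\<integral>\<^sup>+ s'. ennreal (\<alpha> + \<beta> * rarr s' ''y'' 0 0) \<partial>measure_pmf (den prog_sign s)) \<le> ennreal (\<alpha> + \<beta> * rarr s ''y'' 0 0)"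
proof -
  let ?G = "\<lambda>_ r. ennreal (\<alpha> + \<beta> * r ''y'' 0 0)" and ?I = "\<lambda>_ r. \<bar>r ''y'' 0 0\<bar> \<le> 1"
  let ?c = "\<lambda>s. den prog_coin s"
  have seq: "(\<integral>\<^sup>+ s'. ?G 0 (rarr s') \<partial>measure_pmf (bind_pmf (den prog_coin s) D)) \<le> ?G 0 (rarr s)"
    if "?I 0 (rarr s)" "\<And>s1. ?I 0 (rarr s1) \<Longrightarrow> (\<integral>\<^sup>+ s'. ?G 0 (rarr s') \<partial>measure_pmf (D s1)) \<le> ?G 0 (rarr s1)"
    for s and D :: "state \<Rightarrow> state pmf"
  proof -
    have "(\<integral>\<^sup>+ s'. ?G 0 (rarr s') \<partial>measure_pmf (bind_pmf (den prog_coin s) D)) \<le> (\<integral>\<^sup>+ s'. ?G 0 (rarr s') \<partial>measure_pmf (den prog_coin s))"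
      using that coin_range by (auto intro!: nn_integral_mono_AE simp: AE_measure_pmf_iff)
    then show ?thesis using coin_linear[OF that(1) assms(2)] by simp
  qed
  have body: "(\<integral>\<^sup>+ s'. ?G 0 (rarr s') \<partial>measure_pmf (den (prog_coin ;; prog_coin ;; prog_coin ;; prog_coin) s)) \<le> ?G 0 (rarr s)"
    if "?I 0 (rarr s)" for s
    using that coin_linear[OF _ assms(2)] unfolding den.simps by (intro seq) auto
  show ?thesis
    unfolding prog_sign_def
    by (rule For_nn_integral[OF _ refl, where I = ?I and G = ?G])
      (use assms body in \<open>auto dest!: coin_range\<close>)
qed

lemma ennreal_inverse_power_mult: "ennreal (1 / 2 ^ Suc k) = ennreal (1 / 2 ^ k) / 2"
  using divide_ennreal[of "1 / 2 ^ k" 2] by (simp add: mult.commute)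

text \<open>One of the two outcomes of a coin is always \<open>-1\<close> or \<open>1\<close>, and
  both values are absorbing. The weight \<open>1 / 2 ^ k\<close> stands for \<open>k\<close> coins
  still to be thrown.\<close>

lemma coin_undecided:
  "(\<integral>\<^sup>+ s'. (if \<bar>rarr s' ''y'' 0 0\<bar> = 1 then 0 else ennreal (1 / 2 ^ k)) \<partial>measure_pmf (den prog_coin s))
    \<le> (if \<bar>rarr s ''y'' 0 0\<bar> = 1 then 0 else ennreal (1 / 2 ^ Suc k))"
  unfolding ennreal_inverse_power_mult
  using coin_nn_integral[where F = "\<lambda>y. if \<bar>y\<bar> = 1 then 0 else ennreal (1 / 2 ^ k)" and s = s]
  by (auto simp: Let_def)

text \<open>After \<open>l\<close> rounds \<open>4 * (n - l)\<close> coins remain. At the end the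
  weight is 1, so the integral is the probability of being undecided; at the start it is
  \<open>1 / 2 ^ (4 * n)\<close>.\<close>

lemma sign_undecided:
  assumes "ivar s ''n'' = n"
  shows "(\<integral>\<^sup>+ s'. (if \<bar>rarr s' ''y'' 0 0\<bar> = 1 then 0 else 1) \<partial>measure_pmf (den prog_sign s)) \<le> ennreal (1 / 16 ^ n)"
proof -
  let ?H = "\<lambda>k r. if \<bar>r ''y'' 0 0 :: real\<bar> = 1 then 0 else ennreal (1 / 2 ^ k)"
  let ?G = "\<lambda>l r. ?H (4 * (n - l)) r"
  have seq: "(\<integral>\<^sup>+ s'. ?H k (rarr s') \<partial>measure_pmf (bind_pmf (den prog_coin s) D)) \<le> ?H (Suc m) (rarr s)"
    if "\<And>s1. (\<integral>\<^sup>+ s'. ?H k (rarr s') \<partial>measure_pmf (D s1)) \<le> ?H m (rarr s1)"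
    for s k m and D :: "state \<Rightarrow> state pmf"
  proof -
    have "(\<integral>\<^sup>+ s'. ?H k (rarr s') \<partial>measure_pmf (bind_pmf (den prog_coin s) D)) \<le> (\<integral>\<^sup>+ s'. ?H m (rarr s') \<partial>measure_pmf (den prog_coin s))"
      unfolding nn_integral_bind_pmf by (intro nn_integral_mono that)
    also have "\<dots> \<le> ?H (Suc m) (rarr s)" by (rule coin_undecided)
    finally show ?thesis .
  qed
  have body: "(\<integral>\<^sup>+ s'. ?H k (rarr s') \<partial>measure_pmf (den (prog_coin ;; prog_coin ;; prog_coin ;; prog_coin) s)) \<le> ?H (Suc (Suc (Suc (Suc k)))) (rarr s)" for s k
    unfolding den.simps by (intro seq coin_undecided)
  have "(\<integral>\<^sup>+ s'. ?G n (rarr s') \<partial>measure_pmf (den prog_sign s)) \<le> ?G 0 (rarr s)"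
    unfolding prog_sign_def
  proof (rule For_nn_integral[OF _ assms, where I = "\<lambda>_ _. True" and G = ?G])
    fix k and s1 :: state assume "k < n"
    then have eq: "4 * (n - k) = Suc (Suc (Suc (Suc (4 * (n - Suc k)))))" by simp
    show "(\<integral>\<^sup>+ s'. ?G (Suc k) (rarr s') \<partial>measure_pmf (den (prog_coin ;; prog_coin ;; prog_coin ;; prog_coin) s1)) \<le> ?G k (rarr s1)"
      unfolding eq by (rule body)
  qed auto
  also have "\<dots> \<le> ennreal (1 / 16 ^ n)" by (simp add: power_mult)
  finally show ?thesis by (simp cong: if_cong)
qed

section \<open>One step of the self-balancing walk\<close>

abbreviation "prog_update \<equiv> PCond (BEq (cell ''y'') (num 1)) (set_vec ''chi'' ''i'' (num 1))
        (PCond (BEq (cell ''y'') (num (-1))) (set_vec ''chi'' ''i'' (num (-1)))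
          (set_vec ''chi'' ''i'' (num 1) ;; set_cell ''f'' (num 1))) ;;
      PFor ''j'' (set_vec ''w'' ''j'' (RPlus (entry ''w'' ''j'') (RTimes (entry ''chi'' ''i'') mat_v)))"

lemma update_spec:
  assumes s': "s' \<in> set_pmf (den prog_update s)" and n: "ivar s ''n'' = n" "ivar s ''i'' = i"
  defines "y \<equiv> rarr s ''y'' 0 0" and "z \<equiv> (if rarr s ''y'' 0 0 = -1 then -1 else 1 :: real)"
  shows "rarr s' ''chi'' 0 = (rarr s ''chi'' 0)(i := z)"
    and "\<forall>j<n. rarr s' ''w'' 0 j = rarr s ''w'' 0 j + z * rarr s ''v'' i j"
    and "rarr s' ''f'' 0 0 = (if \<bar>y\<bar> = 1 then rarr s ''f'' 0 0 else 1)"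
proof -
  let ?c = "PFor ''j'' (set_vec ''w'' ''j'' (RPlus (entry ''w'' ''j'') (RTimes (entry ''chi'' ''i'') mat_v)))"
  let ?s1 = "set_entry ''chi'' 0 i z s"
  define s2 where "s2 = (if \<bar>y\<bar> = 1 then ?s1 else set_entry ''f'' 0 0 1 ?s1)"
  have "s' \<in> set_pmf (den ?c s2)"
    using s' n by (auto simp: s2_def y_def z_def abs_if simp del: den.simps(6) split: if_splits)
  note s'' = this
  have s2: "ivar s2 = ivar s" "rarr s2 ''chi'' 0 = (rarr s ''chi'' 0)(i := z)" "rarr s2 ''w'' = rarr s ''w''"
      "rarr s2 ''v'' = rarr s ''v''" "rarr s2 ''f'' 0 0 = (if \<bar>y\<bar> = 1 then rarr s ''f'' 0 0 else 1)"
    by (auto simp: s2_def)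
  have "\<forall>j<n. rarr s' ''w'' 0 j = rarr s ''w'' 0 j + (if j < n then z * rarr s ''v'' i j else 0)"
    by (rule For_inv[OF _ s'', where N = n and I = "\<lambda>k r. \<forall>j<n. r ''w'' 0 j = rarr s ''w'' 0 j + (if j < k then z * rarr s ''v'' i j else 0)"])
      (use s2 n in \<open>simp_all add: less_Suc_eq\<close>)
  then show "\<forall>j<n. rarr s' ''w'' 0 j = rarr s ''w'' 0 j + z * rarr s ''v'' i j" by simp
  show "rarr s' ''chi'' 0 = (rarr s ''chi'' 0)(i := z)"
    "rarr s' ''f'' 0 0 = (if \<bar>y\<bar> = 1 then rarr s ''f'' 0 0 else 1)"
    using den_frame[OF s''] s2 by simp_all
qed

abbreviation "ok r \<equiv> r ''f'' 0 0 = (0 :: real)"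

text \<open>Failed states get weight 0. Hence the moment bounds hold without conditioning on
  success, and the probability of failure is estimated separately.\<close>

definition potential :: "nat \<Rightarrow> real \<Rightarrow> (nat \<Rightarrow> real) \<Rightarrow> (string \<Rightarrow> nat \<Rightarrow> nat \<Rightarrow> real) \<Rightarrow> ennreal" where
  "potential n \<kappa> \<theta> r = (if ok r then ennreal (exp (inner_dim n (r ''w'' 0) \<theta> + \<kappa>)) else 0)"

lemma den_PSeq: "den (c ;; d) = (\<lambda>s. bind_pmf (den c s) (den d))"
  by (rule ext) simp

text \<open>An active step factors into a preparation that computes the mean and tests its range,
  the drawing of the sign, and the update. The preparation \<open>D\<close> stays abstract: only the
  listed values on its support matter.\<close>

lemma step_cases:
  assumes n: "ivar s ''n'' = n" "ivar s ''i'' = i" "ivar s ''k'' = k"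
  defines "ip \<equiv> inner_dim n (rarr s ''v'' i) (rarr s ''w'' 0)" and "c \<equiv> rarr s ''c'' 0 0"
  shows "rarr s ''chi'' 0 i = rarr s ''S'' k i \<Longrightarrow> den prog_step s = return_pmf s"
    and "rarr s ''chi'' 0 i \<noteq> rarr s ''S'' k i \<Longrightarrow>
      \<exists>D :: state pmf. den prog_step s = bind_pmf D (\<lambda>t. bind_pmf (den prog_sign t) (den prog_update)) \<and>
      (\<forall>t\<in>set_pmf D. ivar t ''n'' = n \<and> ivar t ''i'' = i \<and> ivar t ''k'' = k \<and> rarr t ''chi'' = rarr s ''chi'' \<and> rarr t ''w'' = rarr s ''w'' \<and>
        rarr t ''v'' = rarr s ''v'' \<and> rarr t ''y'' 0 0 = - ip / c \<and>
        rarr t ''f'' 0 0 = (if \<bar>ip / c\<bar> \<le> 1 then rarr s ''f'' 0 0 else 1))"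
proof -
  show "den prog_step s = return_pmf s" if "rarr s ''chi'' 0 i = rarr s ''S'' k i"
    using that n by (simp add: prog_step_def)
  assume ne: "rarr s ''chi'' 0 i \<noteq> rarr s ''S'' k i"
  let ?p = "prog_dot ''w'' ;;
      set_cell ''y'' (RDiv (RMinus (num 0) (cell ''g'')) (cell ''c'')) ;;
      PCond (BAnd (BNot (RLess (cell ''y'') (num (-1)))) (BNot (RLess (num 1) (cell ''y'')))) PSkip (set_cell ''f'' (num 1))"
  have "den prog_step s = bind_pmf (den ?p s) (\<lambda>t. bind_pmf (den prog_sign t) (den prog_update))"
  proof -
    have "den prog_step s = den (prog_dot ''w'' ;;
      set_cell ''y'' (RDiv (RMinus (num 0) (cell ''g'')) (cell ''c'')) ;;
      PCond (BAnd (BNot (RLess (cell ''y'') (num (-1)))) (BNot (RLess (num 1) (cell ''y'')))) PSkip (set_cell ''f'' (num 1)) ;;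
      prog_sign ;; prog_update) s"
      unfolding prog_step_def by (subst den.simps(5)) (use ne n in \<open>auto simp del: den.simps\<close>)
    then show ?thesis by (simp only: den_PSeq bind_assoc_pmf)
  qed
  moreover have "ivar t ''n'' = n \<and> ivar t ''i'' = i \<and> ivar t ''k'' = k \<and> rarr t ''chi'' = rarr s ''chi'' \<and> rarr t ''w'' = rarr s ''w'' \<and>
        rarr t ''v'' = rarr s ''v'' \<and> rarr t ''y'' 0 0 = - ip / c \<and>
        rarr t ''f'' 0 0 = (if \<bar>ip / c\<bar> \<le> 1 then rarr s ''f'' 0 0 else 1)" if t: "t \<in> set_pmf (den ?p s)" for t
  proof -
    have fr: "ivar t ''n'' = n" "ivar t ''i'' = i" "ivar t ''k'' = k" "rarr t ''chi'' = rarr s ''chi''" "rarr t ''w'' = rarr s ''w''"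
        "rarr t ''v'' = rarr s ''v''"
      using den_frame[OF t] n by simp_all
    obtain t1 where t1: "t1 \<in> set_pmf (den (prog_dot ''w'') s)"
      and t2: "t \<in> set_pmf (den (set_cell ''y'' (RDiv (RMinus (num 0) (cell ''g'')) (cell ''c'')) ;;
        PCond (BAnd (BNot (RLess (cell ''y'') (num (-1)))) (BNot (RLess (num 1) (cell ''y'')))) PSkip (set_cell ''f'' (num 1))) t1)"
      using t by (auto simp only: den_PSeq set_bind_pmf)
    have t1': "rarr t1 ''g'' 0 0 = ip" "rarr t1 ''c'' 0 0 = c" "rarr t1 ''f'' 0 0 = rarr s ''f'' 0 0"
      using dot_spec[OF t1 n(1)] den_frame[OF t1] n by (simp_all add: ip_def c_def)
    have "t = (let t2 = set_entry ''y'' 0 0 (- ip / c) t1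
         in if - 1 \<le> - ip / c \<and> - ip / c \<le> 1 then t2 else set_entry ''f'' 0 0 1 t2)"
      using t2 t1' by (cases "- 1 \<le> - ip / c \<and> - ip / c \<le> 1") (auto simp: Let_def not_less)
    moreover have "\<bar>ip / c\<bar> \<le> 1 \<longleftrightarrow> - 1 \<le> - ip / c \<and> - ip / c \<le> 1" by (simp only: abs_le_iff) auto
    ultimately show ?thesis using fr t1' by (simp add: Let_def)
  qed
  ultimately show "\<exists>D :: state pmf. den prog_step s = bind_pmf D (\<lambda>t. bind_pmf (den prog_sign t) (den prog_update)) \<and>
      (\<forall>t\<in>set_pmf D. ivar t ''n'' = n \<and> ivar t ''i'' = i \<and> ivar t ''k'' = k \<and> rarr t ''chi'' = rarr s ''chi'' \<and> rarr t ''w'' = rarr s ''w'' \<and>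
        rarr t ''v'' = rarr s ''v'' \<and> rarr t ''y'' 0 0 = - ip / c \<and>
        rarr t ''f'' 0 0 = (if \<bar>ip / c\<bar> \<le> 1 then rarr s ''f'' 0 0 else 1))" by blast
qed

text \<open>Replacing the vectors of inactive coordinates by 0 makes all steps uniform: each of them
  adds a sign times \<open>active\<close>, whether or not it draws a sign.\<close>

definition active :: "nat \<Rightarrow> (nat \<Rightarrow> real) \<Rightarrow> (string \<Rightarrow> nat \<Rightarrow> nat \<Rightarrow> real) \<Rightarrow> nat \<Rightarrow> nat \<Rightarrow> real" where
  "active k x r i = (if x i = r ''S'' k i then (\<lambda>_. 0) else r ''v'' i)"

lemma nn_integral_pmf_le:
  assumes "\<And>x. x \<in> set_pmf p \<Longrightarrow> f x \<le> C"
  shows "(\<integral>\<^sup>+ x. f x \<partial>measure_pmf p) \<le> C"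
proof -
  have "(\<integral>\<^sup>+ x. f x \<partial>measure_pmf p) \<le> (\<integral>\<^sup>+ x. C \<partial>measure_pmf p)"
    using assms by (intro nn_integral_mono_AE) (simp add: AE_measure_pmf_iff)
  then show ?thesis by simp
qed

lemma nn_integral_pmf_mono:
  assumes "\<And>x. x \<in> set_pmf p \<Longrightarrow> f x \<le> g x"
  shows "(\<integral>\<^sup>+ x. f x \<partial>measure_pmf p) \<le> (\<integral>\<^sup>+ x. g x \<partial>measure_pmf p)"
  using assms by (intro nn_integral_mono_AE) (simp add: AE_measure_pmf_iff)

lemma step_support:
  assumes s': "s' \<in> set_pmf (den prog_step s)"
    and n: "ivar s ''n'' = n" "ivar s ''i'' = i" "ivar s ''k'' = k"
    and chi: "rarr s ''chi'' 0 i \<in> {-1, 1}"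
  obtains z where "z \<in> {-1, 1}" "rarr s' ''chi'' 0 = (rarr s ''chi'' 0)(i := z)"
    "\<forall>j<n. rarr s' ''w'' 0 j = rarr s ''w'' 0 j + z * active k (rarr s ''chi'' 0) (rarr s) i j"
    "rarr s ''chi'' 0 i = rarr s ''S'' k i \<longrightarrow> z = rarr s ''chi'' 0 i"
    "rarr s ''f'' 0 0 \<in> {0, 1} \<longrightarrow> rarr s' ''f'' 0 0 \<in> {0, 1}"
proof (cases "rarr s ''chi'' 0 i = rarr s ''S'' k i")
  case True
  then have "s' = s" using s' step_cases(1)[OF n] by simp
  then show ?thesis using that[of "rarr s ''chi'' 0 i"] chi True by (simp add: active_def fun_upd_idem)
next
  case False
  from step_cases(2)[OF n False] obtain D :: "state pmf" where
    D: "den prog_step s = bind_pmf D (\<lambda>t. bind_pmf (den prog_sign t) (den prog_update))" and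
    t: "\<forall>t\<in>set_pmf D. ivar t ''n'' = n \<and> ivar t ''i'' = i \<and> ivar t ''k'' = k \<and> rarr t ''chi'' = rarr s ''chi'' \<and> rarr t ''w'' = rarr s ''w'' \<and>
        rarr t ''v'' = rarr s ''v'' \<and> rarr t ''y'' 0 0 = - inner_dim n (rarr s ''v'' i) (rarr s ''w'' 0) / rarr s ''c'' 0 0 \<and>
        rarr t ''f'' 0 0 = (if \<bar>inner_dim n (rarr s ''v'' i) (rarr s ''w'' 0) / rarr s ''c'' 0 0\<bar> \<le> 1 then rarr s ''f'' 0 0 else 1)"
    by blast
  from s' obtain t1 t2 where t1: "t1 \<in> set_pmf D" and t2: "t2 \<in> set_pmf (den prog_sign t1)" and s'': "s' \<in> set_pmf (den prog_update t2)"
    unfolding D set_bind_pmf by blast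
  note f1 = t[rule_format, OF t1] and f2 = den_frame[OF t2]
  have n2: "ivar t2 ''n'' = n" "ivar t2 ''i'' = i" using f1 f2 by simp_all
  note u = update_spec[OF s'' n2]
  show ?thesis
    by (rule that[of "if rarr t2 ''y'' 0 0 = -1 then -1 else 1"]) (use u f1 f2 False in \<open>auto simp: active_def\<close>)
qed

text \<open>Reduces the expectation over an active step in range to one over the drawn value
  \<open>y\<close>. Used for the exponential moment and for the probability of failure.\<close>

lemma step_sign_integral:
  assumes n: "ivar s ''n'' = n" "ivar s ''i'' = i" "ivar s ''k'' = k"
    and ne: "rarr s ''chi'' 0 i \<noteq> rarr s ''S'' k i"
    and ok: "ok (rarr s)" and c: "0 < rarr s ''c'' 0 0"
    and ip: "\<bar>inner_dim n (rarr s ''v'' i) (rarr s ''w'' 0)\<bar> \<le> rarr s ''c'' 0 0"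
    and F: "\<And>t s'. t \<in> T \<Longrightarrow> \<bar>rarr t ''y'' 0 0\<bar> \<le> 1 \<Longrightarrow> s' \<in> set_pmf (den prog_update t) \<Longrightarrow> F s' \<le> G (rarr t ''y'' 0 0)"
    and G: "\<And>t. t \<in> T \<Longrightarrow> rarr t ''y'' 0 0 = - inner_dim n (rarr s ''v'' i) (rarr s ''w'' 0) / rarr s ''c'' 0 0 \<Longrightarrow>
      (\<integral>\<^sup>+ t'. G (rarr t' ''y'' 0 0) \<partial>measure_pmf (den prog_sign t)) \<le> C"
    and T: "T = {t. ivar t ''n'' = n \<and> ivar t ''i'' = i \<and> rarr t ''w'' = rarr s ''w'' \<and> rarr t ''v'' = rarr s ''v'' \<and> ok (rarr t)}"
  shows "(\<integral>\<^sup>+ s'. F s' \<partial>measure_pmf (den prog_step s)) \<le> C"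
proof -
  let ?ip = "inner_dim n (rarr s ''v'' i) (rarr s ''w'' 0)" and ?c = "rarr s ''c'' 0 0"
  have y: "\<bar>?ip / ?c\<bar> \<le> 1" using ip c by (simp add: abs_divide)
  from step_cases(2)[OF n ne] obtain D :: "state pmf" where
    D: "den prog_step s = bind_pmf D (\<lambda>t. bind_pmf (den prog_sign t) (den prog_update))" and
    t: "\<forall>t\<in>set_pmf D. ivar t ''n'' = n \<and> ivar t ''i'' = i \<and> ivar t ''k'' = k \<and> rarr t ''chi'' = rarr s ''chi'' \<and> rarr t ''w'' = rarr s ''w'' \<and>
        rarr t ''v'' = rarr s ''v'' \<and> rarr t ''y'' 0 0 = - ?ip / ?c \<and>
        rarr t ''f'' 0 0 = (if \<bar>?ip / ?c\<bar> \<le> 1 then rarr s ''f'' 0 0 else 1)"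
    by blast
  show ?thesis unfolding D nn_integral_bind_pmf
  proof (rule nn_integral_pmf_le)
    fix t1 assume t1: "t1 \<in> set_pmf D"
    have tT: "t1 \<in> T" and ty: "rarr t1 ''y'' 0 0 = - ?ip / ?c"
      using t[rule_format, OF t1] y ok by (simp_all add: T)
    have "(\<integral>\<^sup>+ t2. \<integral>\<^sup>+ s'. F s' \<partial>measure_pmf (den prog_update t2) \<partial>measure_pmf (den prog_sign t1)) \<le>
       (\<integral>\<^sup>+ t2. G (rarr t2 ''y'' 0 0) \<partial>measure_pmf (den prog_sign t1))"
    proof (rule nn_integral_pmf_mono, rule nn_integral_pmf_le)
      fix t2 s' assume t2: "t2 \<in> set_pmf (den prog_sign t1)" and s': "s' \<in> set_pmf (den prog_update t2)"
      have "\<bar>rarr t2 ''y'' 0 0\<bar> \<le> 1" using sign_range[OF t2] ty y by simp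
      moreover have "t2 \<in> T" using den_frame[OF t2] tT by (simp add: T)
      ultimately show "F s' \<le> G (rarr t2 ''y'' 0 0)" using F s' by blast
    qed
    also have "\<dots> \<le> C" by (rule G[OF tT ty])
    finally show "(\<integral>\<^sup>+ t2. \<integral>\<^sup>+ s'. F s' \<partial>measure_pmf (den prog_update t2) \<partial>measure_pmf (den prog_sign t1)) \<le> C" .
  qed
qed

text \<open>No branch of a step lowers the flag, and leaving the admissible range raises it.\<close>

lemma step_not_ok:
  assumes n: "ivar s ''n'' = n" "ivar s ''i'' = i" "ivar s ''k'' = k" and c: "0 < rarr s ''c'' 0 0"
    and f: "rarr s ''f'' 0 0 \<in> {0, 1}"
    and bad: "\<not> ok (rarr s) \<or> rarr s ''chi'' 0 i \<noteq> rarr s ''S'' k i \<and> rarr s ''c'' 0 0 < \<bar>inner_dim n (rarr s ''v'' i) (rarr s ''w'' 0)\<bar>"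
    and s': "s' \<in> set_pmf (den prog_step s)"
  shows "\<not> ok (rarr s')"
proof (cases "rarr s ''chi'' 0 i = rarr s ''S'' k i")
  case True
  then show ?thesis using step_cases(1)[OF n] s' bad by simp
next
  case False
  let ?ip = "inner_dim n (rarr s ''v'' i) (rarr s ''w'' 0)" and ?c = "rarr s ''c'' 0 0"
  from step_cases(2)[OF n False] obtain D :: "state pmf" where
    D: "den prog_step s = bind_pmf D (\<lambda>t. bind_pmf (den prog_sign t) (den prog_update))" and
    t: "\<forall>t\<in>set_pmf D. ivar t ''n'' = n \<and> ivar t ''i'' = i \<and> ivar t ''k'' = k \<and> rarr t ''chi'' = rarr s ''chi'' \<and> rarr t ''w'' = rarr s ''w'' \<and>
        rarr t ''v'' = rarr s ''v'' \<and> rarr t ''y'' 0 0 = - ?ip / ?c \<and>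
        rarr t ''f'' 0 0 = (if \<bar>?ip / ?c\<bar> \<le> 1 then rarr s ''f'' 0 0 else 1)"
    by blast
  from s' obtain t1 t2 where t1: "t1 \<in> set_pmf D" and t2: "t2 \<in> set_pmf (den prog_sign t1)" and s'': "s' \<in> set_pmf (den prog_update t2)"
    unfolding D set_bind_pmf by blast
  note f1 = t[rule_format, OF t1] and f2 = den_frame[OF t2]
  have n2: "ivar t2 ''n'' = n" "ivar t2 ''i'' = i" using f1 f2 by simp_all
  have "?c < \<bar>?ip\<bar> \<Longrightarrow> \<not> \<bar>?ip / ?c\<bar> \<le> 1" using c by (simp add: abs_divide)
  then have "rarr t1 ''f'' 0 0 = 1" using f1 f bad by auto
  then show ?thesis using update_spec(3)[OF s'' n2] f2 by simp
qed

text \<open>In range, the sign has mean \<open>y = - \<langle>w, u\<rangle> / c\<close>, and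
  \<open>cosh_sinh_le\<close> bounds its exponential moment at \<open>a\<close> by
  \<open>exp (a * y + a\<^sup>2 / 2)\<close>. Since \<open>a * y\<close> is linear in
  \<open>w\<close>, it can be absorbed into the test vector, which becomes \<theta> minus
  \<open>a / c\<close> times \<open>u\<close>. Out of range or after a failure the left-hand side is
  0.\<close>

lemma step_potential:
  fixes \<theta> :: "nat \<Rightarrow> real"
  assumes n: "ivar s ''n'' = n" "ivar s ''i'' = i" "ivar s ''k'' = k"
    and f: "rarr s ''f'' 0 0 \<in> {0, 1}"
    and c: "0 < rarr s ''c'' 0 0"
  defines "u \<equiv> active k (rarr s ''chi'' 0) (rarr s) i"
  defines "a \<equiv> inner_dim n u \<theta>"
  shows "(\<integral>\<^sup>+ s'. potential n \<kappa> \<theta> (rarr s') \<partial>measure_pmf (den prog_step s))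
    \<le> potential n (\<kappa> + a\<^sup>2 / 2) (\<lambda>j. \<theta> j - a / rarr s ''c'' 0 0 * u j) (rarr s)"
proof -
  let ?w = "rarr s ''w'' 0" and ?c = "rarr s ''c'' 0 0"
  have R: "inner_dim n ?w (\<lambda>j. \<theta> j - a / ?c * u j) = inner_dim n ?w \<theta> - a / ?c * inner_dim n ?w u"
    by (simp add: inner_dim_def right_diff_distrib sum_subtractf sum_distrib_left ac_simps)
  show ?thesis
  proof (cases "rarr s ''chi'' 0 i = rarr s ''S'' k i")
    case True
    then have "u = (\<lambda>_. 0)" by (simp add: u_def active_def)
    moreover from this have "a = 0" by (simp add: a_def inner_dim_def)
    ultimately show ?thesis using step_cases(1)[OF n True] by (simp add: nn_integral_return_pmf)
  next
    case False
    then have u: "u = rarr s ''v'' i" by (simp add: u_def active_def)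
    show ?thesis
    proof (cases "ok (rarr s) \<and> \<bar>inner_dim n (rarr s ''v'' i) ?w\<bar> \<le> ?c")
      case ne: False
      have "(\<integral>\<^sup>+ s'. potential n \<kappa> \<theta> (rarr s') \<partial>measure_pmf (den prog_step s)) \<le> 0"
      proof (rule nn_integral_pmf_le)
        fix s' assume "s' \<in> set_pmf (den prog_step s)"
        then have "\<not> ok (rarr s')" by (intro step_not_ok[OF n c f]) (use ne False in auto)
        then show "potential n \<kappa> \<theta> (rarr s') \<le> 0" by (simp add: potential_def)
      qed
      then show ?thesis using order_trans zero_le by blast
    next
      case True
      define E where "E = exp (inner_dim n ?w \<theta> + \<kappa>)"
      define y where "y = - inner_dim n (rarr s ''v'' i) ?w / ?c"
      have y: "\<bar>y\<bar> \<le> 1" using True c by (simp add: y_def abs_divide)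
      \<comment> \<open>The condition of \<open>sign_linear\<close> for the affine function
        below.\<close>
      have sc: "\<bar>E * sinh a\<bar> \<le> E * cosh a"
        using sinh_less_cosh_real[of a] sinh_less_cosh_real[of "- a"] by (auto simp: abs_mult E_def intro!: mult_left_mono abs_leI)
      have "(\<integral>\<^sup>+ s'. potential n \<kappa> \<theta> (rarr s') \<partial>measure_pmf (den prog_step s)) \<le> ennreal (E * cosh a + E * sinh a * y)"
      proof (rule step_sign_integral[OF n False _ c _ _ _ refl, where G = "\<lambda>y. ennreal (E * cosh a + E * sinh a * y)"])
        fix t s' assume t: "t \<in> {t. ivar t ''n'' = n \<and> ivar t ''i'' = i \<and> rarr t ''w'' = rarr s ''w'' \<and> rarr t ''v'' = rarr s ''v'' \<and> ok (rarr t)}"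
          and s': "s' \<in> set_pmf (den prog_update t)"
        let ?y = "rarr t ''y'' 0 0"
        have tn: "ivar t ''n'' = n" "ivar t ''i'' = i" using t by auto
        note up = update_spec[OF s' tn]
        show "potential n \<kappa> \<theta> (rarr s') \<le> ennreal (E * cosh a + E * sinh a * ?y)"
        proof (cases "\<bar>?y\<bar> = 1")
          case True
          have "inner_dim n (rarr s' ''w'' 0) \<theta> = inner_dim n (\<lambda>j. ?w j + ?y * rarr s ''v'' i j) \<theta>"
            by (rule inner_dim_cong) (use up(2) t True in auto)
          also have "\<dots> = inner_dim n ?w \<theta> + ?y * a"
            by (simp only: inner_dim_add inner_dim_scale a_def u)
          finally have "potential n \<kappa> \<theta> (rarr s') = ennreal (exp (inner_dim n ?w \<theta> + ?y * a + \<kappa>))"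
            using up(3) True t by (simp add: potential_def)
          also have "exp (inner_dim n ?w \<theta> + ?y * a + \<kappa>) = E * exp (?y * a)"
            by (simp add: E_def exp_add[symmetric] ac_simps)
          also have "exp (?y * a) = cosh a + sinh a * ?y"
            using True by (auto simp: abs_if cosh_plus_sinh cosh_minus_sinh split: if_splits)
          finally show ?thesis by (simp add: algebra_simps)
        next
          case False
          \<comment> \<open>An undecided sign raises the flag, so the left-hand side is 0.\<close>
          then show ?thesis using up(3) by (simp add: potential_def)
        qed
      next
        fix t :: state assume "t \<in> {t. ivar t ''n'' = n \<and> ivar t ''i'' = i \<and> rarr t ''w'' = rarr s ''w'' \<and> rarr t ''v'' = rarr s ''v'' \<and> ok (rarr t)}"
          "rarr t ''y'' 0 0 = - inner_dim n (rarr s ''v'' i) ?w / ?c"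
        then show "(\<integral>\<^sup>+ t'. ennreal (E * cosh a + E * sinh a * rarr t' ''y'' 0 0) \<partial>measure_pmf (den prog_sign t))
            \<le> ennreal (E * cosh a + E * sinh a * y)"
          using sign_linear[OF _ sc, of t] y by (simp add: y_def)
      qed (use True in auto)
      also have "\<dots> \<le> ennreal (exp (inner_dim n ?w (\<lambda>j. \<theta> j - a / ?c * u j) + (\<kappa> + a\<^sup>2 / 2)))"
      proof (rule ennreal_leI)
        have "E * cosh a + E * sinh a * y = E * (cosh a + y * sinh a)" by (simp add: algebra_simps)
        also have "\<dots> \<le> E * exp (a * y + a\<^sup>2 / 2)"
          using cosh_sinh_le[OF y] by (intro mult_left_mono) (auto simp: E_def)
        also have "\<dots> = exp (inner_dim n ?w (\<lambda>j. \<theta> j - a / ?c * u j) + (\<kappa> + a\<^sup>2 / 2))"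
          unfolding R by (simp add: E_def y_def u exp_add[symmetric] inner_dim_commute[of n ?w] algebra_simps)
        finally show "E * cosh a + E * sinh a * y \<le> exp (inner_dim n ?w (\<lambda>j. \<theta> j - a / ?c * u j) + (\<kappa> + a\<^sup>2 / 2))" .
      qed
      also have "\<dots> = potential n (\<kappa> + a\<^sup>2 / 2) (\<lambda>j. \<theta> j - a / ?c * u j) (rarr s)"
        using True by (simp add: potential_def)
      finally show ?thesis .
    qed
  qed
qed

abbreviation "fails r \<equiv> (if ok r then 0 else 1 :: ennreal)"

text \<open>A new failure is either an undecided sign or an inner product of absolute value above
  \<open>c\<close>. The indicator of the latter event is at most \<open>exp (\<langle>w, u\<rangle>
  - c) + exp (- \<langle>w, u\<rangle> - c)\<close>, which explains the two potentials with offset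
  \<open>- c\<close>.\<close>

lemma step_fails:
  assumes n: "ivar s ''n'' = n" "ivar s ''i'' = i" "ivar s ''k'' = k" and c: "0 < rarr s ''c'' 0 0"
  defines "u \<equiv> active k (rarr s ''chi'' 0) (rarr s) i"
  shows "(\<integral>\<^sup>+ s'. fails (rarr s') \<partial>measure_pmf (den prog_step s))
    \<le> fails (rarr s) + ennreal (1 / 16 ^ n) + (potential n (- rarr s ''c'' 0 0) u (rarr s) + potential n (- rarr s ''c'' 0 0) (\<lambda>j. - u j) (rarr s))"
    (is "?L \<le> fails (rarr s) + _ + ?P")
proof -
  let ?w = "rarr s ''w'' 0" and ?c = "rarr s ''c'' 0 0"
  have L1: "?L \<le> 1" by (rule nn_integral_pmf_le) auto
  consider "\<not> ok (rarr s)" | "ok (rarr s)" "rarr s ''chi'' 0 i = rarr s ''S'' k i"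
    | "ok (rarr s)" "rarr s ''chi'' 0 i \<noteq> rarr s ''S'' k i" "\<bar>inner_dim n (rarr s ''v'' i) ?w\<bar> \<le> ?c"
    | "ok (rarr s)" "rarr s ''chi'' 0 i \<noteq> rarr s ''S'' k i" "\<bar>inner_dim n (rarr s ''v'' i) ?w\<bar> > ?c"
    by linarith
  then show ?thesis
  proof cases
    case 1
    then have "?L \<le> fails (rarr s)" using L1 by simp
    then show ?thesis by (meson add_increasing2 zero_le)
  next
    case 2
    then have "?L = 0" using step_cases(1)[OF n] by (simp add: nn_integral_return_pmf)
    then show ?thesis by simp
  next
    case 3
    have "?L \<le> ennreal (1 / 16 ^ n)"
    proof (rule step_sign_integral[OF n 3(2,1) c 3(3) _ _ refl, where G = "\<lambda>y. if \<bar>y\<bar> = 1 then 0 else 1"])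
      fix t s' assume t: "t \<in> {t. ivar t ''n'' = n \<and> ivar t ''i'' = i \<and> rarr t ''w'' = rarr s ''w'' \<and> rarr t ''v'' = rarr s ''v'' \<and> ok (rarr t)}"
        and s': "s' \<in> set_pmf (den prog_update t)"
      have tn: "ivar t ''n'' = n" "ivar t ''i'' = i" using t by auto
      show "fails (rarr s') \<le> (if \<bar>rarr t ''y'' 0 0\<bar> = 1 then 0 else 1)"
        using update_spec(3)[OF s' tn] t by auto
    qed (auto intro: sign_undecided)
    then show ?thesis by (meson add_increasing add_increasing2 zero_le)
  next
    case 4
    have u: "u = rarr s ''v'' i" using 4 by (simp add: u_def active_def)
    have "1 \<le> ?P"
    proof (cases "inner_dim n ?w u > ?c")
      case True
      have "(1 :: ennreal) \<le> potential n (- ?c) u (rarr s)"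
        using True 4 by (simp add: potential_def ennreal_ge_1)
      then show ?thesis by (meson add_increasing2 zero_le)
    next
      case False
      moreover have "inner_dim n ?w (\<lambda>j. - u j) = - inner_dim n ?w u"
        by (simp add: inner_dim_def sum_negf)
      ultimately have "inner_dim n ?w (\<lambda>j. - u j) > ?c"
        using 4(3) by (auto simp: u inner_dim_commute[of n ?w] abs_if split: if_splits)
      then have "(1 :: ennreal) \<le> potential n (- ?c) (\<lambda>j. - u j) (rarr s)"
        using 4 by (simp add: potential_def ennreal_ge_1)
      then show ?thesis by (meson add_increasing zero_le)
    qed
    then have "?L \<le> ?P" using L1 by simp
    then show ?thesis by (meson add_increasing zero_le)
  qed
qed

text \<open>
  The exponential moment at \<open>\<theta>\<close> after steps \<open>i, \<dots>, i + r - 1\<close> is at most the one at the pulled back vector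
  before them, times the exponential of the gain.
\<close>

primrec pull_back :: "nat \<Rightarrow> real \<Rightarrow> (nat \<Rightarrow> nat \<Rightarrow> real) \<Rightarrow> nat \<Rightarrow> nat \<Rightarrow> (nat \<Rightarrow> real) \<Rightarrow> nat \<Rightarrow> real" where
  "pull_back n c U 0 i \<theta> = \<theta>"
| "pull_back n c U (Suc r) i \<theta> = (\<lambda>j. pull_back n c U r (Suc i) \<theta> j -
     inner_dim n (U i) (pull_back n c U r (Suc i) \<theta>) / c * U i j)"

primrec pull_back_gain :: "nat \<Rightarrow> real \<Rightarrow> (nat \<Rightarrow> nat \<Rightarrow> real) \<Rightarrow> nat \<Rightarrow> nat \<Rightarrow> (nat \<Rightarrow> real) \<Rightarrow> real" where
  "pull_back_gain n c U 0 i \<theta> = 0"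
| "pull_back_gain n c U (Suc r) i \<theta> = pull_back_gain n c U r (Suc i) \<theta> +
     (inner_dim n (U i) (pull_back n c U r (Suc i) \<theta>))\<^sup>2 / 2"

text \<open>One pull back changes the squared norm by \<open>- 2 * a\<^sup>2 / c + (a / c)\<^sup>2 *
  \<langle>u, u\<rangle>\<close>, which is at most \<open>- a\<^sup>2 / c\<close> because
  \<open>c\<close> is at least 1 and \<open>u\<close> has norm at most 1. Multiplied by
  \<open>c / 2\<close>, this decrease pays exactly for the gain
  \<open>a\<^sup>2 / 2\<close>.\<close>

lemma pull_back_contraction:
  assumes "c \<ge> 1" "\<forall>l. i \<le> l \<longrightarrow> l < i + r \<longrightarrow> inner_dim n (U l) (U l) \<le> 1"
  shows "pull_back_gain n c U r i \<theta> + c / 2 * inner_dim n (pull_back n c U r i \<theta>) (pull_back n c U r i \<theta>)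
    \<le> c / 2 * inner_dim n \<theta> \<theta>"
  using assms(2)
proof (induction r arbitrary: i)
  case (Suc r)
  let ?t = "pull_back n c U r (Suc i) \<theta>" and ?u = "U i"
  define a where "a = inner_dim n ?u ?t"
  have a': "inner_dim n ?t ?u = a" by (simp add: a_def inner_dim_commute)
  have "inner_dim n (\<lambda>j. ?t j - a / c * ?u j) (\<lambda>j. ?t j - a / c * ?u j) =
      inner_dim n ?t (\<lambda>j. ?t j - a / c * ?u j) - a / c * inner_dim n ?u (\<lambda>j. ?t j - a / c * ?u j)"
    by (simp only: inner_dim_diff inner_dim_scale)
  also have "inner_dim n ?t (\<lambda>j. ?t j - a / c * ?u j) = inner_dim n ?t ?t - a / c * a"
    by (subst inner_dim_commute, simp only: inner_dim_diff inner_dim_scale a_def)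
  also have "inner_dim n ?u (\<lambda>j. ?t j - a / c * ?u j) = a - a / c * inner_dim n ?u ?u"
    by (subst inner_dim_commute, simp only: inner_dim_diff inner_dim_scale a')
  finally have eq: "inner_dim n (\<lambda>j. ?t j - a / c * ?u j) (\<lambda>j. ?t j - a / c * ?u j) =
      inner_dim n ?t ?t - 2 * a\<^sup>2 / c + (a / c)\<^sup>2 * inner_dim n ?u ?u"
    by (simp add: power2_eq_square algebra_simps)
  have "(a / c)\<^sup>2 * inner_dim n ?u ?u \<le> (a / c)\<^sup>2 * 1"
    using Suc.prems by (intro mult_left_mono) auto
  also have "(a / c)\<^sup>2 * 1 \<le> a\<^sup>2 / c"
    using assms(1) mult_left_mono[of 1 c "a * a"]
    by (simp add: power_divide power2_eq_square field_simps)
  finally have "c / 2 * inner_dim n (\<lambda>j. ?t j - a / c * ?u j) (\<lambda>j. ?t j - a / c * ?u j) \<le>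
      c / 2 * (inner_dim n ?t ?t - a\<^sup>2 / c)"
    unfolding eq using assms(1) by (intro mult_left_mono) auto
  also have "\<dots> = c / 2 * inner_dim n ?t ?t - a\<^sup>2 / 2" using assms(1) by (simp add: field_simps)
  finally have "a\<^sup>2 / 2 + c / 2 * inner_dim n (\<lambda>j. ?t j - a / c * ?u j) (\<lambda>j. ?t j - a / c * ?u j)
     \<le> c / 2 * inner_dim n ?t ?t" by linarith
  moreover have "pull_back_gain n c U r (Suc i) \<theta> + c / 2 * inner_dim n ?t ?t \<le> c / 2 * inner_dim n \<theta> \<theta>"
    using Suc.prems by (intro Suc.IH) auto
  ultimately show ?case by (simp add: a_def)
qed simp

text \<open>Activity is decided by the state \<open>r0\<close> at the start of the level. Since
  coordinates from \<open>m\<close> on still have their initial color, step \<open>m\<close> sees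
  the same active vector; hence the vectors of the whole level are fixed in advance.\<close>

definition steps_inv :: "nat \<Rightarrow> nat \<Rightarrow> (string \<Rightarrow> nat \<Rightarrow> nat \<Rightarrow> real) \<Rightarrow> nat \<Rightarrow> (string \<Rightarrow> nat \<Rightarrow> nat \<Rightarrow> real) \<Rightarrow> bool" where
  "steps_inv n k r0 m r \<longleftrightarrow> (\<forall>i<n. m \<le> i \<longrightarrow> r ''chi'' 0 i = r0 ''chi'' 0 i) \<and> (\<forall>i<n. r ''chi'' 0 i \<in> {-1, 1}) \<and>
     r ''f'' 0 0 \<in> {0, 1} \<and>
     (\<forall>j<n. r ''w'' 0 j = r0 ''w'' 0 j + (\<Sum>i<m. r ''chi'' 0 i * active k (r0 ''chi'' 0) r0 i j)) \<and>
     (\<forall>i<m. r0 ''chi'' 0 i = r0 ''S'' k i \<longrightarrow> r ''chi'' 0 i = r0 ''chi'' 0 i)"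

lemma active_eq:
  assumes "r ''v'' = r0 ''v''" "r ''S'' = r0 ''S''" "x i = x0 i"
  shows "active k x r i = active k x0 r0 i"
  by (simp add: active_def assms)

lemma steps_inv_step:
  assumes I: "steps_inv n k r0 m (rarr s1)" and m: "m < n"
    and n: "ivar s1 ''n'' = n" "ivar s1 ''i'' = m" "ivar s1 ''k'' = k"
    and r0: "rarr s1 ''v'' = r0 ''v''" "rarr s1 ''S'' = r0 ''S''"
    and s2: "s2 \<in> set_pmf (den prog_step s1)"
  shows "steps_inv n k r0 (Suc m) (rarr s2)"
proof -
  have chi: "rarr s1 ''chi'' 0 m \<in> {-1, 1}" "rarr s1 ''chi'' 0 m = r0 ''chi'' 0 m"
    using I m by (auto simp: steps_inv_def)
  obtain z where z: "z \<in> {-1, 1}" "rarr s2 ''chi'' 0 = (rarr s1 ''chi'' 0)(m := z)"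
    "\<forall>j<n. rarr s2 ''w'' 0 j = rarr s1 ''w'' 0 j + z * active k (rarr s1 ''chi'' 0) (rarr s1) m j"
    "rarr s1 ''chi'' 0 m = rarr s1 ''S'' k m \<longrightarrow> z = rarr s1 ''chi'' 0 m"
    "rarr s1 ''f'' 0 0 \<in> {0, 1} \<longrightarrow> rarr s2 ''f'' 0 0 \<in> {0, 1}"
    using step_support[OF s2 n chi(1)] by metis
  have act: "active k (rarr s1 ''chi'' 0) (rarr s1) m = active k (r0 ''chi'' 0) r0 m"
    by (intro active_eq r0 chi(2))
  have "(\<Sum>i<m. rarr s2 ''chi'' 0 i * active k (r0 ''chi'' 0) r0 i j) = (\<Sum>i<m. rarr s1 ''chi'' 0 i * active k (r0 ''chi'' 0) r0 i j)" for j
    by (rule sum.cong) (auto simp: z(2))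
  then show ?thesis
    using I z m r0 chi unfolding act by (auto simp: steps_inv_def less_Suc_eq)
qed

section \<open>One level: rounding a single digit\<close>

locale level =
  fixes n k :: nat and s :: state
  assumes n: "ivar s ''n'' = n" "ivar s ''k'' = k"
    and chi: "\<forall>i<n. rarr s ''chi'' 0 i \<in> {-1, 1}"
    and f: "rarr s ''f'' 0 0 \<in> {0, 1}"
    and c: "rarr s ''c'' 0 0 \<ge> 1"
    and v: "\<forall>i<n. inner_dim n (rarr s ''v'' i) (rarr s ''v'' i) \<le> 1"
begin

abbreviation "U \<equiv> active k (rarr s ''chi'' 0) (rarr s)"
abbreviation "cc \<equiv> rarr s ''c'' 0 0"
abbreviation "steps \<equiv> PFor ''i'' prog_step"

lemma U_norm: "i < n \<Longrightarrow> inner_dim n (U i) (U i) \<le> 1"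
  using v by (auto simp: active_def inner_dim_def)

lemma inv0: "steps_inv n k (rarr s) 0 (rarr s)"
  using chi f by (auto simp: steps_inv_def)

lemma steps_support:
  assumes s': "s' \<in> set_pmf (den steps s)"
  shows "steps_inv n k (rarr s) n (rarr s')"
proof (rule For_inv[OF _ s' n(1), where I = "steps_inv n k (rarr s)"])
  fix m and s1 s2 :: state
  assume m: "m < n" "steps_inv n k (rarr s) m (rarr s1)" "ivar s1 ''i'' = m"
    "\<forall>z. z \<noteq> ''i'' \<longrightarrow> z \<notin> wvars prog_step \<longrightarrow> ivar s1 z = ivar s z"
    "\<forall>z. z \<notin> warrs prog_step \<longrightarrow> rarr s1 z = rarr s z" and s2: "s2 \<in> set_pmf (den prog_step s1)"
  have n1: "ivar s1 ''n'' = n" "ivar s1 ''k'' = k" "rarr s1 ''v'' = rarr s ''v''" "rarr s1 ''S'' = rarr s ''S''"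
    using m n by simp_all
  show "steps_inv n k (rarr s) (Suc m) (rarr s2)"
    by (rule steps_inv_step[OF m(2,1) n1(1) m(3) n1(2,3,4) s2])
qed (use inv0 in simp_all)

text \<open>A bound, as seen before step \<open>m\<close>, for the potential that is evaluated
  before step \<open>J\<close>; for \<open>m = J\<close> it is that potential itself.\<close>

abbreviation "pot J m \<kappa> \<theta> \<equiv> potential n (\<kappa> + pull_back_gain n cc U (J - m) m \<theta>) (pull_back n cc U (J - m) m \<theta>)"

lemma pot_step:
  assumes I: "steps_inv n k (rarr s) m (rarr s1)" and m: "m < J" "J \<le> n"
    and n1: "ivar s1 ''n'' = n" "ivar s1 ''i'' = m" "ivar s1 ''k'' = k"
    and r: "rarr s1 ''v'' = rarr s ''v''" "rarr s1 ''S'' = rarr s ''S''" "rarr s1 ''c'' = rarr s ''c''"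
  shows "(\<integral>\<^sup>+ s2. pot J (Suc m) \<kappa> \<theta> (rarr s2) \<partial>measure_pmf (den prog_step s1)) \<le> pot J m \<kappa> \<theta> (rarr s1)"
proof -
  have chi: "rarr s1 ''chi'' 0 m = rarr s ''chi'' 0 m" and f: "rarr s1 ''f'' 0 0 \<in> {0, 1}"
    using I m by (auto simp: steps_inv_def)
  have act: "active k (rarr s1 ''chi'' 0) (rarr s1) m = U m"
    by (intro active_eq r(1,2) chi)
  have J: "J - m = Suc (J - Suc m)" using m by simp
  show ?thesis
    using step_potential[OF n1 f, where \<theta> = "pull_back n cc U (J - Suc m) (Suc m) \<theta>"
        and \<kappa> = "\<kappa> + pull_back_gain n cc U (J - Suc m) (Suc m) \<theta>"] c
    unfolding J act r(3) by (simp add: add.assoc)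
qed

lemma steps_potential:
  "(\<integral>\<^sup>+ s'. potential n \<kappa> \<theta> (rarr s') \<partial>measure_pmf (den steps s)) \<le> pot n 0 \<kappa> \<theta> (rarr s)"
proof -
  have "(\<integral>\<^sup>+ s'. pot n n \<kappa> \<theta> (rarr s') \<partial>measure_pmf (den steps s)) \<le> pot n 0 \<kappa> \<theta> (rarr s)"
  proof (rule For_nn_integral[OF _ n(1), where I = "steps_inv n k (rarr s)" and G = "\<lambda>m. pot n m \<kappa> \<theta>"])
    fix m and s1 s2 :: state
    assume m: "m < n" "steps_inv n k (rarr s) m (rarr s1)" "ivar s1 ''i'' = m"
      "\<forall>z. z \<noteq> ''i'' \<longrightarrow> z \<notin> wvars prog_step \<longrightarrow> ivar s1 z = ivar s z"
      "\<forall>z. z \<notin> warrs prog_step \<longrightarrow> rarr s1 z = rarr s z"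
    have n1: "ivar s1 ''n'' = n" "ivar s1 ''k'' = k" "rarr s1 ''v'' = rarr s ''v''" "rarr s1 ''S'' = rarr s ''S''"
      "rarr s1 ''c'' = rarr s ''c''" using m n by simp_all
    show "steps_inv n k (rarr s) (Suc m) (rarr s2)" if "s2 \<in> set_pmf (den prog_step s1)"
      by (rule steps_inv_step[OF m(2,1) n1(1) m(3) n1(2,3,4) that])
    show "(\<integral>\<^sup>+ s2. pot n (Suc m) \<kappa> \<theta> (rarr s2) \<partial>measure_pmf (den prog_step s1)) \<le> pot n m \<kappa> \<theta> (rarr s1)"
      by (rule pot_step[OF m(2,1) order_refl n1(1) m(3) n1(2-5)])
  qed (use inv0 in simp_all)
  then show ?thesis by simp
qed

text \<open>A union bound written as a supermartingale: before step \<open>m\<close> the budget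
  consists of the flag, of one undecided sign for each remaining step, and of the pulled back
  overflow potentials of all steps \<open>J\<close> from \<open>m\<close> on. Step \<open>m\<close>
  spends the summand \<open>J = m\<close>, while \<open>pot_step\<close> carries the others
  forward.\<close>

lemma steps_fails:
  "(\<integral>\<^sup>+ s'. fails (rarr s') \<partial>measure_pmf (den steps s)) \<le> fails (rarr s) + of_nat n * ennreal (1 / 16 ^ n) +
     (\<Sum>J<n. pot J 0 (- cc) (U J) (rarr s) + pot J 0 (- cc) (\<lambda>j. - U J j) (rarr s))"
proof -
  let ?P = "\<lambda>J m r. pot J m (- cc) (U J) r + pot J m (- cc) (\<lambda>j. - U J j) r"
  let ?G = "\<lambda>m r. fails r + of_nat (n - m) * ennreal (1 / 16 ^ n) + (\<Sum>J\<in>{m..<n}. ?P J m r)"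
  have "(\<integral>\<^sup>+ s'. ?G n (rarr s') \<partial>measure_pmf (den steps s)) \<le> ?G 0 (rarr s)"
  proof (rule For_nn_integral[OF _ n(1), where I = "steps_inv n k (rarr s)" and G = ?G])
    fix m and s1 s2 :: state
    assume m: "m < n" "steps_inv n k (rarr s) m (rarr s1)" "ivar s1 ''i'' = m"
      "\<forall>z. z \<noteq> ''i'' \<longrightarrow> z \<notin> wvars prog_step \<longrightarrow> ivar s1 z = ivar s z"
      "\<forall>z. z \<notin> warrs prog_step \<longrightarrow> rarr s1 z = rarr s z"
    have n1: "ivar s1 ''n'' = n" "ivar s1 ''k'' = k" "rarr s1 ''v'' = rarr s ''v''" "rarr s1 ''S'' = rarr s ''S''"
      "rarr s1 ''c'' = rarr s ''c''" using m n by simp_all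
    show "steps_inv n k (rarr s) (Suc m) (rarr s2)" if "s2 \<in> set_pmf (den prog_step s1)"
      by (rule steps_inv_step[OF m(2,1) n1(1) m(3) n1(2,3,4) that])
    have chi: "rarr s1 ''chi'' 0 m = rarr s ''chi'' 0 m" using m by (auto simp: steps_inv_def)
    have act: "active k (rarr s1 ''chi'' 0) (rarr s1) m = U m"
      by (intro active_eq n1(3,4) chi)
    let ?D = "measure_pmf (den prog_step s1)"
    have "(\<integral>\<^sup>+ s2. ?G (Suc m) (rarr s2) \<partial>?D) = (\<integral>\<^sup>+ s2. fails (rarr s2) \<partial>?D) + of_nat (n - Suc m) * ennreal (1 / 16 ^ n)
       + (\<Sum>J\<in>{Suc m..<n}. \<integral>\<^sup>+ s2. ?P J (Suc m) (rarr s2) \<partial>?D)"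
      by (simp add: nn_integral_add nn_integral_sum)
    also have "\<dots> \<le> (fails (rarr s1) + ennreal (1 / 16 ^ n) + ?P m m (rarr s1)) + of_nat (n - Suc m) * ennreal (1 / 16 ^ n)
       + (\<Sum>J\<in>{Suc m..<n}. ?P J m (rarr s1))"
    proof (intro add_mono order_refl sum_mono)
      show "(\<integral>\<^sup>+ s2. fails (rarr s2) \<partial>?D) \<le> fails (rarr s1) + ennreal (1 / 16 ^ n) + ?P m m (rarr s1)"
        using step_fails[OF n1(1) m(3) n1(2)] c unfolding act n1(5) by simp
      fix J assume J: "J \<in> {Suc m..<n}"
      then have J': "m < J" "J \<le> n" by auto
      show "(\<integral>\<^sup>+ s2. ?P J (Suc m) (rarr s2) \<partial>?D) \<le> ?P J m (rarr s1)"
        by (subst nn_integral_add, simp, simp) (intro add_mono pot_step[OF m(2) J' n1(1) m(3) n1(2-5)])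
    qed
    also have "\<dots> = ?G m (rarr s1)"
    proof -
      have "n - m = Suc (n - Suc m)" using m by simp
      then have nm: "(of_nat (n - m) :: ennreal) = 1 + of_nat (n - Suc m)" by simp
      show ?thesis
        unfolding nm sum.atLeast_Suc_lessThan[OF m(1)] by (simp only: distrib_right mult_1_left ac_simps)
    qed
    finally show "(\<integral>\<^sup>+ s2. ?G (Suc m) (rarr s2) \<partial>?D) \<le> ?G m (rarr s1)" .
  qed (use inv0 in simp_all)
  then show ?thesis by (simp add: atLeast0LessThan)
qed

end

abbreviation "prog_zero \<equiv> PFor ''j'' (set_vec ''w'' ''j'' (num 0))"

lemma den_prog_level: "den prog_level s = bind_pmf (den prog_zero s) (den (PFor ''i'' prog_step))"
  by (simp only: prog_level_def den_PSeq)

lemma level_zero: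
  assumes "level n k s" and s1: "s1 \<in> set_pmf (den prog_zero s)"
  shows "level n k s1" "\<forall>j<n. rarr s1 ''w'' 0 j = 0" "z \<noteq> ''w'' \<Longrightarrow> rarr s1 z = rarr s z"
proof -
  interpret level n k s by fact
  have "\<forall>j<n. rarr s1 ''w'' 0 j = 0"
    by (rule For_inv[OF _ s1 n(1), where I = "\<lambda>k r. \<forall>j<k. r ''w'' 0 j = 0"]) (auto simp: less_Suc_eq)
  then show "\<forall>j<n. rarr s1 ''w'' 0 j = 0" .
  show "level n k s1" "z \<noteq> ''w'' \<Longrightarrow> rarr s1 z = rarr s z"
    using den_frame[OF s1] n chi f c v by (simp_all add: level_def)
qed

lemma inner_dim_zero: "\<forall>j<n. w j = 0 \<Longrightarrow> inner_dim n w \<theta> = 0"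
  by (simp add: inner_dim_def)

text \<open>The level starts with \<open>w = 0\<close>, so the pulled back vector contributes
  nothing and only the gain is left, which \<open>pull_back_contraction\<close> bounds by
  \<open>c / 2\<close> times the squared norm of \<theta>.\<close>

lemma level_potential:
  assumes "level n k s"
  shows "(\<integral>\<^sup>+ s'. potential n \<kappa> \<theta> (rarr s') \<partial>measure_pmf (den prog_level s))
    \<le> (if ok (rarr s) then ennreal (exp (\<kappa> + rarr s ''c'' 0 0 / 2 * inner_dim n \<theta> \<theta>)) else 0)"
  unfolding den_prog_level nn_integral_bind_pmf
proof (rule nn_integral_pmf_le)
  fix s1 assume s1: "s1 \<in> set_pmf (den prog_zero s)"
  note z = level_zero[OF assms s1]
  interpret l: level n k s1 by (rule z(1))
  have w: "\<forall>j<n. rarr s1 ''w'' 0 j = 0" and eq: "rarr s1 ''f'' = rarr s ''f''" "rarr s1 ''c'' = rarr s ''c''"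
    using z by simp_all
  have "(\<integral>\<^sup>+ s'. potential n \<kappa> \<theta> (rarr s') \<partial>measure_pmf (den (PFor ''i'' prog_step) s1)) \<le> l.pot n 0 \<kappa> \<theta> (rarr s1)"
    by (rule l.steps_potential)
  also have "\<dots> \<le> (if ok (rarr s) then ennreal (exp (\<kappa> + l.cc / 2 * inner_dim n \<theta> \<theta>)) else 0)"
  proof -
    have "pull_back_gain n l.cc l.U n 0 \<theta> \<le> pull_back_gain n l.cc l.U n 0 \<theta> +
      l.cc / 2 * inner_dim n (pull_back n l.cc l.U n 0 \<theta>) (pull_back n l.cc l.U n 0 \<theta>)"
      using l.c inner_dim_nonneg by simp
    also have "\<dots> \<le> l.cc / 2 * inner_dim n \<theta> \<theta>"
      by (rule pull_back_contraction) (use l.c l.U_norm in auto)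
    finally show ?thesis using w by (simp add: potential_def eq inner_dim_zero ennreal_leI)
  qed
  finally show "(\<integral>\<^sup>+ s'. potential n \<kappa> \<theta> (rarr s') \<partial>measure_pmf (den (PFor ''i'' prog_step) s1))
     \<le> (if ok (rarr s) then ennreal (exp (\<kappa> + rarr s ''c'' 0 0 / 2 * inner_dim n \<theta> \<theta>)) else 0)" unfolding eq .
qed

text \<open>Each overflow potential has offset \<open>- c\<close> and gain at most
  \<open>c / 2\<close>, because its test vector has norm at most 1; this leaves
  \<open>exp (- c / 2)\<close> for each of the two signs.\<close>

lemma level_fails:
  assumes "level n k s"
  shows "(\<integral>\<^sup>+ s'. fails (rarr s') \<partial>measure_pmf (den prog_level s))
    \<le> fails (rarr s) + ennreal (real n * (1 / 16 ^ n + 2 * exp (- rarr s ''c'' 0 0 / 2)))"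
  unfolding den_prog_level nn_integral_bind_pmf
proof (rule nn_integral_pmf_le)
  fix s1 assume s1: "s1 \<in> set_pmf (den prog_zero s)"
  note z = level_zero[OF assms s1]
  interpret l: level n k s1 by (rule z(1))
  have w: "\<forall>j<n. rarr s1 ''w'' 0 j = 0" and eq: "rarr s1 ''f'' = rarr s ''f''" "rarr s1 ''c'' = rarr s ''c''"
    using z by simp_all
  have P: "l.pot J 0 (- l.cc) \<theta> (rarr s1) \<le> ennreal (exp (- l.cc / 2))" if "J < n" "inner_dim n \<theta> \<theta> \<le> 1" for J \<theta>
  proof -
    have "pull_back_gain n l.cc l.U J 0 \<theta> \<le> pull_back_gain n l.cc l.U J 0 \<theta> +
      l.cc / 2 * inner_dim n (pull_back n l.cc l.U J 0 \<theta>) (pull_back n l.cc l.U J 0 \<theta>)"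
      using l.c inner_dim_nonneg by simp
    also have "\<dots> \<le> l.cc / 2 * inner_dim n \<theta> \<theta>"
      by (rule pull_back_contraction) (use l.c l.U_norm that in auto)
    also have "\<dots> \<le> l.cc / 2 * 1" using l.c that by (intro mult_left_mono) auto
    finally show ?thesis using w by (auto simp: potential_def inner_dim_zero intro!: ennreal_leI)
  qed
  have neg: "inner_dim n (\<lambda>j. - l.U J j) (\<lambda>j. - l.U J j) = inner_dim n (l.U J) (l.U J)" for J
    by (simp add: inner_dim_def)
  have "(\<integral>\<^sup>+ s'. fails (rarr s') \<partial>measure_pmf (den (PFor ''i'' prog_step) s1)) \<le> fails (rarr s1) + of_nat n * ennreal (1 / 16 ^ n) +
   (\<Sum>J<n. l.pot J 0 (- l.cc) (l.U J) (rarr s1) + l.pot J 0 (- l.cc) (\<lambda>j. - l.U J j) (rarr s1))"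
    by (rule l.steps_fails)
  also have "\<dots> \<le> fails (rarr s1) + of_nat n * ennreal (1 / 16 ^ n) + (\<Sum>J<n. ennreal (exp (- l.cc / 2)) + ennreal (exp (- l.cc / 2)))"
    using l.U_norm by (intro add_mono order_refl sum_mono P) (auto simp: neg)
  also have "\<dots> = fails (rarr s1) + ennreal (real n * (1 / 16 ^ n + 2 * exp (- l.cc / 2)))"
  proof -
    have of_nat: "of_nat n * ennreal x = ennreal (real n * x)" if "0 \<le> x" for x
      using that by (subst ennreal_mult) (simp_all add: ennreal_of_nat_eq_real_of_nat)
    have two: "ennreal x + ennreal x = ennreal (2 * x)" if "0 \<le> x" for x
      using that by (subst ennreal_plus[symmetric]) simp_all
    have "of_nat n * ennreal (1 / 16 ^ n) + (\<Sum>J<n. ennreal (exp (- l.cc / 2)) + ennreal (exp (- l.cc / 2)))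
      = ennreal (real n * (1 / 16 ^ n)) + ennreal (real n * (2 * exp (- l.cc / 2)))"
      unfolding two[OF exp_ge_zero] sum_constant card_lessThan by (simp only: of_nat zero_le_divide_1_iff zero_le_power zero_le_numeral mult_nonneg_nonneg exp_ge_zero)
    also have "\<dots> = ennreal (real n * (1 / 16 ^ n + 2 * exp (- l.cc / 2)))"
      by (subst ennreal_plus[symmetric]) (simp_all add: distrib_left)
    finally show ?thesis by (simp only: add.assoc)
  qed
  finally show "(\<integral>\<^sup>+ s'. fails (rarr s') \<partial>measure_pmf (den (PFor ''i'' prog_step) s1))
     \<le> fails (rarr s) + ennreal (real n * (1 / 16 ^ n + 2 * exp (- rarr s ''c'' 0 0 / 2)))" by (simp add: eq)
qed

text \<open>The recursion behind the geometric series: the old error is halved and the walk of this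
  level is added. An inactive coordinate keeps a color equal to the digit, and an active one has a
  digit opposite to its old color, so the identity holds coordinate by coordinate.\<close>

lemma level_support:
  assumes "level n k s" and s': "s' \<in> set_pmf (den prog_level s)"
    and S: "\<forall>i<n. rarr s ''S'' k i \<in> {-1, 1}"
  shows "\<forall>i<n. rarr s' ''chi'' 0 i \<in> {-1, 1}" and "rarr s' ''f'' 0 0 \<in> {0, 1}"
    and "\<forall>j<n. (\<Sum>i<n. (rarr s' ''chi'' 0 i - lam (rarr s ''S'') (Suc k) i) * rarr s ''v'' i j) =
      (\<Sum>i<n. (rarr s ''chi'' 0 i - lam (rarr s ''S'') k i) * rarr s ''v'' i j) / 2 + rarr s' ''w'' 0 j"
proof -
  interpret l0: level n k s by fact
  from s' obtain s1 where s1: "s1 \<in> set_pmf (den prog_zero s)"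
    and s2: "s' \<in> set_pmf (den (PFor ''i'' prog_step) s1)"
    unfolding den_prog_level set_bind_pmf by blast
  note z = level_zero[OF assms(1) s1]
  interpret l: level n k s1 by (rule z(1))
  have w: "\<forall>j<n. rarr s1 ''w'' 0 j = 0" and eq: "rarr s1 ''S'' = rarr s ''S''" "rarr s1 ''v'' = rarr s ''v''" "rarr s1 ''chi'' = rarr s ''chi''"
    using z by simp_all
  have I: "steps_inv n k (rarr s1) n (rarr s')" by (rule l.steps_support[OF s2])
  have "(\<Sum>i<n. (rarr s' ''chi'' 0 i - lam (rarr s ''S'') (Suc k) i) * rarr s ''v'' i j) =
      (\<Sum>i<n. (rarr s ''chi'' 0 i - lam (rarr s ''S'') k i) * rarr s ''v'' i j) / 2 + rarr s' ''w'' 0 j" if "j < n" for j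
  proof -
    have "rarr s' ''w'' 0 j = (\<Sum>i<n. rarr s' ''chi'' 0 i * active k (rarr s ''chi'' 0) (rarr s) i j)"
      using I w that by (simp add: steps_inv_def eq active_eq[of "rarr s1" "rarr s" "rarr s ''chi'' 0" _ "rarr s ''chi'' 0"])
    moreover have "(rarr s' ''chi'' 0 i - lam (rarr s ''S'') (Suc k) i) * rarr s ''v'' i j =
      (rarr s ''chi'' 0 i - lam (rarr s ''S'') k i) * rarr s ''v'' i j / 2 + rarr s' ''chi'' 0 i * active k (rarr s ''chi'' 0) (rarr s) i j"
      if i: "i < n" for i
    proof (cases "rarr s ''chi'' 0 i = rarr s ''S'' k i")
      case True
      then have "rarr s' ''chi'' 0 i = rarr s ''S'' k i" using I i by (simp add: steps_inv_def eq)
      then show ?thesis using True by (simp add: active_def field_simps)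
    next
      case False
      then have "rarr s ''S'' k i = - rarr s ''chi'' 0 i" using S i l0.chi by fastforce
      then show ?thesis using False by (simp add: active_def field_simps)
    qed
    ultimately show ?thesis by (simp add: sum.distrib sum_divide_distrib del: lam.simps)
  qed
  then show "\<forall>j<n. (\<Sum>i<n. (rarr s' ''chi'' 0 i - lam (rarr s ''S'') (Suc k) i) * rarr s ''v'' i j) =
      (\<Sum>i<n. (rarr s ''chi'' 0 i - lam (rarr s ''S'') k i) * rarr s ''v'' i j) / 2 + rarr s' ''w'' 0 j" by blast
  show "\<forall>i<n. rarr s' ''chi'' 0 i \<in> {-1, 1}" "rarr s' ''f'' 0 0 \<in> {0, 1}"
    using I by (auto simp: steps_inv_def)
qed

section \<open>Rounding all digits\<close>

definition err :: "nat \<Rightarrow> nat \<Rightarrow> (string \<Rightarrow> nat \<Rightarrow> nat \<Rightarrow> real) \<Rightarrow> nat \<Rightarrow> real" where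
  "err n k r j = (\<Sum>i<n. (r ''chi'' 0 i - lam (r ''S'') k i) * r ''v'' i j)"

definition err_potential :: "nat \<Rightarrow> nat \<Rightarrow> real \<Rightarrow> (nat \<Rightarrow> real) \<Rightarrow> (string \<Rightarrow> nat \<Rightarrow> nat \<Rightarrow> real) \<Rightarrow> ennreal" where
  "err_potential n k \<kappa> \<theta> r = (if ok r then ennreal (exp (inner_dim n (err n k r) \<theta> + \<kappa>)) else 0)"

text \<open>The halved old error is known before the level starts. Its inner product with \<theta>
  is therefore a constant \<mu>, which is added to the offset of the potential of the walk.\<close>

lemma level_err_potential:
  assumes l: "level n k s" and S: "\<forall>i<n. rarr s ''S'' k i \<in> {-1, 1}"
  shows "(\<integral>\<^sup>+ s'. err_potential n (Suc k) \<kappa> \<theta> (rarr s') \<partial>measure_pmf (den prog_level s))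
    \<le> err_potential n k (\<kappa> + rarr s ''c'' 0 0 / 2 * inner_dim n \<theta> \<theta>) (\<lambda>j. \<theta> j / 2) (rarr s)"
proof -
  define \<mu> where "\<mu> = inner_dim n (err n k (rarr s)) (\<lambda>j. \<theta> j / 2)"
  have "(\<integral>\<^sup>+ s'. err_potential n (Suc k) \<kappa> \<theta> (rarr s') \<partial>measure_pmf (den prog_level s)) \<le>
     (\<integral>\<^sup>+ s'. potential n (\<mu> + \<kappa>) \<theta> (rarr s') \<partial>measure_pmf (den prog_level s))"
  proof (rule nn_integral_pmf_mono)
    fix s' assume s': "s' \<in> set_pmf (den prog_level s)"
    note fr = den_frame[OF s']
    have "inner_dim n (err n (Suc k) (rarr s')) \<theta> = inner_dim n (\<lambda>j. err n k (rarr s) j / 2 + rarr s' ''w'' 0 j) \<theta>"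
      by (rule inner_dim_cong) (use level_support(3)[OF l s' S] fr in \<open>simp_all add: err_def del: lam.simps\<close>)
    also have "\<dots> = \<mu> + inner_dim n (rarr s' ''w'' 0) \<theta>"
      by (simp add: \<mu>_def inner_dim_add) (simp add: inner_dim_def)
    finally show "err_potential n (Suc k) \<kappa> \<theta> (rarr s') \<le> potential n (\<mu> + \<kappa>) \<theta> (rarr s')"
      by (simp add: err_potential_def potential_def ac_simps)
  qed
  also have "\<dots> \<le> (if ok (rarr s) then ennreal (exp (\<mu> + \<kappa> + rarr s ''c'' 0 0 / 2 * inner_dim n \<theta> \<theta>)) else 0)"
    by (rule level_potential[OF l])
  also have "\<dots> = err_potential n k (\<kappa> + rarr s ''c'' 0 0 / 2 * inner_dim n \<theta> \<theta>) (\<lambda>j. \<theta> j / 2) (rarr s)"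
    by (simp add: err_potential_def \<mu>_def ac_simps)
  finally show ?thesis .
qed

text \<open>The union bound over \<open>n\<close> levels of \<open>n\<close> steps: an undecided
  sign, or an overflow in one of two directions.\<close>

definition fail_bound :: "nat \<Rightarrow> real \<Rightarrow> real" where
  "fail_bound n c = real n * (real n * (1 / 16 ^ n + 2 * exp (- c / 2)))"

definition outcome :: "nat \<Rightarrow> (string \<Rightarrow> nat \<Rightarrow> nat \<Rightarrow> real) \<Rightarrow> bool" where
  "outcome n r \<longleftrightarrow> (\<forall>i<n. r ''chi'' 0 i \<in> {-1, 1}) \<and> r ''f'' 0 0 \<in> {0, 1}"

locale attempt =
  fixes n :: nat and s :: state
  assumes n: "ivar s ''n'' = n"
    and c: "rarr s ''c'' 0 0 \<ge> 1"
    and v: "\<forall>i<n. inner_dim n (rarr s ''v'' i) (rarr s ''v'' i) \<le> 1"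
    and S: "\<forall>k<n. \<forall>i<n. rarr s ''S'' k i \<in> {-1, 1}"
begin

abbreviation "cc \<equiv> rarr s ''c'' 0 0"
abbreviation "prog_init \<equiv> set_cell ''f'' (num 0) ;; prog_ones"

lemma den_attempt: "den prog_attempt s = bind_pmf (den prog_init s) (den (PFor ''k'' prog_level))"
  by (simp only: prog_attempt_def den_PSeq bind_assoc_pmf)

lemma init_spec:
  assumes "s1 \<in> set_pmf (den prog_init s)"
  shows "outcome n (rarr s1)" "ok (rarr s1)" "j < n \<Longrightarrow> err n 0 (rarr s1) j = 0"
    "x \<noteq> ''f'' \<Longrightarrow> x \<noteq> ''chi'' \<Longrightarrow> rarr s1 x = rarr s x" "ivar s1 ''n'' = n"
proof -
  let ?s = "set_entry ''f'' 0 0 0 s"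
  have s1: "s1 \<in> set_pmf (den prog_ones ?s)" using assms by simp
  have o: "\<forall>i<n. rarr s1 ''chi'' 0 i = 1" by (rule ones_spec[OF s1]) (simp add: n)
  have w: "wvars prog_ones = {''i''}" "warrs prog_ones = {''chi''}" by (simp_all add: prog_ones_def)
  show "ok (rarr s1)" using den_frame[OF s1] w by simp
  then show "outcome n (rarr s1)" using o by (simp add: outcome_def)
  show "j < n \<Longrightarrow> err n 0 (rarr s1) j = 0" using o by (simp add: err_def)
  show "x \<noteq> ''f'' \<Longrightarrow> x \<noteq> ''chi'' \<Longrightarrow> rarr s1 x = rarr s x" "ivar s1 ''n'' = n"
    using den_frame[OF s1] w n by simp_all
qed

lemma levels_level:
  assumes "ivar t ''n'' = n" "ivar t ''k'' = k" "outcome n (rarr t)"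
    "rarr t ''v'' = rarr s ''v''" "rarr t ''c'' = rarr s ''c''"
  shows "level n k t"
  using assms n c v by (auto simp: level_def outcome_def)

lemma levels_hyps:
  assumes k: "k < n" "outcome n (rarr t)" "ivar t ''k'' = k"
    and t0: "t0 \<in> set_pmf (den prog_init s)"
    and z: "\<forall>z. z \<noteq> ''k'' \<longrightarrow> z \<notin> wvars prog_level \<longrightarrow> ivar t z = ivar t0 z" "\<forall>z. z \<notin> warrs prog_level \<longrightarrow> rarr t z = rarr t0 z"
  shows "level n k t" "\<forall>i<n. rarr t ''S'' k i \<in> {-1, 1}" "rarr t ''c'' 0 0 = cc"
proof -
  have eq: "ivar t ''n'' = n" "rarr t ''v'' = rarr s ''v''" "rarr t ''c'' = rarr s ''c''" "rarr t ''S'' = rarr s ''S''"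
    using z init_spec(4,5)[OF t0] by simp_all
  then show "level n k t" using k by (intro levels_level) auto
  show "\<forall>i<n. rarr t ''S'' k i \<in> {-1, 1}" "rarr t ''c'' 0 0 = cc" using eq S k by simp_all
qed

lemma level_outcome:
  assumes "level n k t" "\<forall>i<n. rarr t ''S'' k i \<in> {-1, 1}" "t' \<in> set_pmf (den prog_level t)"
  shows "outcome n (rarr t')"
  using level_support(1,2)[OF assms(1,3,2)] by (simp add: outcome_def)

lemma attempt_outcome:
  assumes "s' \<in> set_pmf (den prog_attempt s)"
  shows "outcome n (rarr s')"
proof -
  from assms obtain t0 where t0: "t0 \<in> set_pmf (den prog_init s)" and s': "s' \<in> set_pmf (den (PFor ''k'' prog_level) t0)"
    unfolding den_attempt set_bind_pmf by blast
  show ?thesis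
  proof (rule For_inv[OF _ s' init_spec(5)[OF t0], where I = "\<lambda>_. outcome n"])
    fix k and t t' :: state
    assume k: "k < n" "outcome n (rarr t)" "ivar t ''k'' = k"
      and z: "\<forall>z. z \<noteq> ''k'' \<longrightarrow> z \<notin> wvars prog_level \<longrightarrow> ivar t z = ivar t0 z" "\<forall>z. z \<notin> warrs prog_level \<longrightarrow> rarr t z = rarr t0 z"
      and t': "t' \<in> set_pmf (den prog_level t)"
    show "outcome n (rarr t')"
      by (rule level_outcome[OF levels_hyps(1,2)[OF k t0 z] t'])
  qed (use init_spec(1)[OF t0] in simp_all)
qed

lemma attempt_fails:
  "(\<integral>\<^sup>+ s'. fails (rarr s') \<partial>measure_pmf (den prog_attempt s)) \<le> ennreal (fail_bound n cc)"
  unfolding den_attempt nn_integral_bind_pmf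
proof (rule nn_integral_pmf_le)
  fix t0 assume t0: "t0 \<in> set_pmf (den prog_init s)"
  define \<epsilon> where "\<epsilon> = real n * (1 / 16 ^ n + 2 * exp (- cc / 2))"
  have \<epsilon>: "\<epsilon> \<ge> 0" by (simp add: \<epsilon>_def)
  let ?G = "\<lambda>k r. fails r + ennreal (real (n - k) * \<epsilon>)"
  have "(\<integral>\<^sup>+ s'. ?G n (rarr s') \<partial>measure_pmf (den (PFor ''k'' prog_level) t0)) \<le> ?G 0 (rarr t0)"
  proof (rule For_nn_integral[OF _ init_spec(5)[OF t0], where I = "\<lambda>_. outcome n" and G = ?G])
    fix k and t t' :: state
    assume k: "k < n" "outcome n (rarr t)" "ivar t ''k'' = k"
      and z: "\<forall>z. z \<noteq> ''k'' \<longrightarrow> z \<notin> wvars prog_level \<longrightarrow> ivar t z = ivar t0 z" "\<forall>z. z \<notin> warrs prog_level \<longrightarrow> rarr t z = rarr t0 z"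
    note h = levels_hyps[OF k t0 z]
    show "outcome n (rarr t')" if "t' \<in> set_pmf (den prog_level t)"
      by (rule level_outcome[OF h(1,2) that])
    have "(\<integral>\<^sup>+ s'. ?G (Suc k) (rarr s') \<partial>measure_pmf (den prog_level t)) =
       (\<integral>\<^sup>+ s'. fails (rarr s') \<partial>measure_pmf (den prog_level t)) + ennreal (real (n - Suc k) * \<epsilon>)"
      by (subst nn_integral_add) simp_all
    also have "\<dots> \<le> (fails (rarr t) + ennreal \<epsilon>) + ennreal (real (n - Suc k) * \<epsilon>)"
      using level_fails[OF h(1)] by (intro add_mono) (simp_all add: h(3) \<epsilon>_def)
    also have "\<dots> = fails (rarr t) + ennreal (\<epsilon> + real (n - Suc k) * \<epsilon>)"
      using \<epsilon> by (subst ennreal_plus) (simp_all add: add.assoc)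
    also have "\<epsilon> + real (n - Suc k) * \<epsilon> = real (n - k) * \<epsilon>"
      using k(1) by (simp add: of_nat_diff algebra_simps)
    finally show "(\<integral>\<^sup>+ s'. ?G (Suc k) (rarr s') \<partial>measure_pmf (den prog_level t)) \<le> ?G k (rarr t)" .
  qed (use init_spec(1)[OF t0] in simp_all)
  then show "(\<integral>\<^sup>+ s'. fails (rarr s') \<partial>measure_pmf (den (PFor ''k'' prog_level) t0)) \<le> ennreal (fail_bound n cc)"
    using init_spec(2)[OF t0] by (simp add: fail_bound_def \<epsilon>_def del: den.simps)
qed

text \<open>Going back one level halves the test vector, so the contributions of the levels to the
  exponent form a geometric series of ratio 1/4 and stay below \<open>cc\<close> times the squared
  norm of \<theta>.\<close>

lemma attempt_potential:
  "(\<integral>\<^sup>+ s'. err_potential n n 0 \<theta> (rarr s') \<partial>measure_pmf (den prog_attempt s)) \<le> ennreal (exp (cc * inner_dim n \<theta> \<theta>))"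
  unfolding den_attempt nn_integral_bind_pmf
proof (rule nn_integral_pmf_le)
  fix t0 assume t0: "t0 \<in> set_pmf (den prog_init s)"
  define q where "q = inner_dim n \<theta> \<theta>"
  have q: "q \<ge> 0" by (simp add: q_def inner_dim_nonneg)
  \<comment> \<open>A closed form majorant of the contributions of levels \<open>k\<close> to
    \<open>n - 1\<close>; their sum is 2/3 of it.\<close>
  define \<kappa> where "\<kappa> k = cc * q * (1 - 1 / 4 ^ (n - k))" for k
  let ?G = "\<lambda>k. err_potential n k (\<kappa> k) (\<lambda>j. \<theta> j / 2 ^ (n - k))"
  have "(\<integral>\<^sup>+ s'. ?G n (rarr s') \<partial>measure_pmf (den (PFor ''k'' prog_level) t0)) \<le> ?G 0 (rarr t0)"
  proof (rule For_nn_integral[OF _ init_spec(5)[OF t0], where I = "\<lambda>_. outcome n" and G = ?G])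
    fix k and t t' :: state
    assume k: "k < n" "outcome n (rarr t)" "ivar t ''k'' = k"
      and z: "\<forall>z. z \<noteq> ''k'' \<longrightarrow> z \<notin> wvars prog_level \<longrightarrow> ivar t z = ivar t0 z" "\<forall>z. z \<notin> warrs prog_level \<longrightarrow> rarr t z = rarr t0 z"
    note h = levels_hyps[OF k t0 z]
    show "outcome n (rarr t')" if "t' \<in> set_pmf (den prog_level t)"
      by (rule level_outcome[OF h(1,2) that])
    obtain m where m: "n - k = Suc m" "n - Suc k = m" using k by (metis Suc_diff_Suc)
    have sq: "inner_dim n (\<lambda>j. \<theta> j / 2 ^ m) (\<lambda>j. \<theta> j / 2 ^ m) = q / 4 ^ m"
      by (simp add: inner_dim_def q_def sum_divide_distrib power_mult_distrib[symmetric])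
    have "\<kappa> (Suc k) + cc / 2 * (q / 4 ^ m) \<le> \<kappa> k"
    proof -
      define A where "A = cc * q / 4 ^ m"
      have "A \<ge> 0" using q c by (simp add: A_def)
      moreover have "\<kappa> (Suc k) = cc * q - A" "\<kappa> k = cc * q - A / 4" "cc / 2 * (q / 4 ^ m) = A / 2"
        by (simp_all add: \<kappa>_def A_def m right_diff_distrib)
      ultimately show ?thesis by linarith
    qed
    then have "err_potential n k (\<kappa> (Suc k) + cc / 2 * (q / 4 ^ m)) (\<lambda>j. \<theta> j / 2 ^ m / 2) (rarr t) \<le> ?G k (rarr t)"
      by (simp add: err_potential_def m ennreal_leI mult.commute)
    then show "(\<integral>\<^sup>+ s'. ?G (Suc k) (rarr s') \<partial>measure_pmf (den prog_level t)) \<le> ?G k (rarr t)"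
      using level_err_potential[OF h(1,2), of "\<kappa> (Suc k)" "\<lambda>j. \<theta> j / 2 ^ m"] by (simp add: m sq h(3))
  qed (use init_spec(1)[OF t0] in simp_all)
  also have "?G n = err_potential n n 0 \<theta>" by (simp add: \<kappa>_def)
  also have "?G 0 (rarr t0) \<le> ennreal (exp (cc * q))"
  proof -
    \<comment> \<open>The all-ones coloring coincides with \<open>lam\<close> at level 0, so the
      initial error vanishes.\<close>
    have "inner_dim n (err n 0 (rarr t0)) (\<lambda>j. \<theta> j / 2 ^ (n - 0)) = 0"
      by (rule inner_dim_zero) (use init_spec(3)[OF t0] in auto)
    moreover have "\<kappa> 0 \<le> cc * q" using c q by (simp add: \<kappa>_def algebra_simps)
    ultimately show ?thesis by (simp add: err_potential_def ennreal_leI)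
  qed
  finally show "(\<integral>\<^sup>+ s'. err_potential n n 0 \<theta> (rarr s') \<partial>measure_pmf (den (PFor ''k'' prog_level) t0)) \<le> ennreal (exp (cc * inner_dim n \<theta> \<theta>))"
    by (simp only: q_def)
qed

text \<open>Chernoff's bound, applied to \<theta> and its negative. The deviation is counted only
  together with success, since \<open>err_potential\<close> vanishes on failure.\<close>

lemma attempt_tail:
  assumes \<theta>: "inner_dim n \<theta> \<theta> = 1" and x: "x \<ge> 0"
  shows "(\<integral>\<^sup>+ s'. (if ok (rarr s') \<and> x \<le> \<bar>inner_dim n (err n n (rarr s')) \<theta>\<bar> then 1 else 0) \<partial>measure_pmf (den prog_attempt s))
    \<le> ennreal (2 * exp (- x\<^sup>2 / (4 * cc)))"
proof -
  \<comment> \<open>The minimizer of \<open>- \<tau> * x + cc * \<tau>\<^sup>2\<close>, with minimum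
    \<open>- x\<^sup>2 / (4 * cc)\<close>.\<close>
  define \<tau> where "\<tau> = x / (2 * cc)"
  have \<tau>: "\<tau> \<ge> 0" using x c by (simp add: \<tau>_def)
  let ?D = "measure_pmf (den prog_attempt s)"
  let ?P = "\<lambda>\<sigma>. err_potential n n 0 (\<lambda>j. \<sigma> * \<theta> j)"
  have P: "(\<integral>\<^sup>+ s'. ?P \<sigma> (rarr s') \<partial>?D) \<le> ennreal (exp (cc * \<tau>\<^sup>2))" if "\<sigma>\<^sup>2 = \<tau>\<^sup>2" for \<sigma>
  proof -
    have "inner_dim n (\<lambda>j. \<sigma> * \<theta> j) (\<lambda>j. \<sigma> * \<theta> j) = \<sigma>\<^sup>2 * inner_dim n \<theta> \<theta>"
      by (simp add: inner_dim_def sum_distrib_left power2_eq_square ac_simps)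
    then show ?thesis using attempt_potential[of "\<lambda>j. \<sigma> * \<theta> j"] \<theta> that by simp
  qed
  have "(\<integral>\<^sup>+ s'. (if ok (rarr s') \<and> x \<le> \<bar>inner_dim n (err n n (rarr s')) \<theta>\<bar> then 1 else 0) \<partial>?D) \<le>
      (\<integral>\<^sup>+ s'. ennreal (exp (- \<tau> * x)) * (?P \<tau> (rarr s') + ?P (- \<tau>) (rarr s')) \<partial>?D)"
  proof (rule nn_integral_pmf_mono)
    fix s' :: state
    let ?y = "inner_dim n (err n n (rarr s')) \<theta>"
    have i: "inner_dim n (err n n (rarr s')) (\<lambda>j. \<sigma> * \<theta> j) = \<sigma> * ?y" for \<sigma>
      by (simp add: inner_dim_def sum_distrib_left ac_simps)
    have P_eq: "?P \<sigma> (rarr s') = (if ok (rarr s') then ennreal (exp (\<sigma> * ?y)) else 0)" for \<sigma>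
      by (simp only: err_potential_def i add_0_right)
    have "1 \<le> exp (- \<tau> * x) * (exp (\<tau> * ?y) + exp (- \<tau> * ?y))" if xy: "x \<le> \<bar>?y\<bar>"
    proof -
      have "1 \<le> exp (\<tau> * (\<bar>?y\<bar> - x))" using \<tau> xy by simp
      also have "\<dots> = exp (- \<tau> * x) * exp (\<tau> * \<bar>?y\<bar>)" by (simp add: exp_add[symmetric] algebra_simps)
      also have "exp (\<tau> * \<bar>?y\<bar>) \<le> exp (\<tau> * ?y) + exp (- \<tau> * ?y)" by (cases "?y \<ge> 0") auto
      finally show ?thesis by simp
    qed
    then have "ennreal 1 \<le> ennreal (exp (- \<tau> * x) * (exp (\<tau> * ?y) + exp (- \<tau> * ?y)))" if "x \<le> \<bar>?y\<bar>"
      using that by (intro ennreal_leI) auto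
    then show "(if ok (rarr s') \<and> x \<le> \<bar>?y\<bar> then 1 else 0) \<le> ennreal (exp (- \<tau> * x)) * (?P \<tau> (rarr s') + ?P (- \<tau>) (rarr s'))"
      unfolding P_eq by (auto simp: ennreal_mult ennreal_plus)
  qed
  also have "\<dots> = ennreal (exp (- \<tau> * x)) * ((\<integral>\<^sup>+ s'. ?P \<tau> (rarr s') \<partial>?D) + (\<integral>\<^sup>+ s'. ?P (- \<tau>) (rarr s') \<partial>?D))"
    by (subst nn_integral_cmult, simp, subst nn_integral_add) simp_all
  also have "\<dots> \<le> ennreal (exp (- \<tau> * x)) * (ennreal (exp (cc * \<tau>\<^sup>2)) + ennreal (exp (cc * \<tau>\<^sup>2)))"
    by (intro mult_left_mono add_mono P) auto
  also have "\<dots> = ennreal (exp (- \<tau> * x) * (exp (cc * \<tau>\<^sup>2) + exp (cc * \<tau>\<^sup>2)))"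
    by (subst ennreal_mult, simp, simp, subst ennreal_plus) simp_all
  also have "exp (- \<tau> * x) * (exp (cc * \<tau>\<^sup>2) + exp (cc * \<tau>\<^sup>2)) = 2 * exp (- \<tau> * x + cc * \<tau>\<^sup>2)"
    by (simp add: mult_exp_exp)
  also have "- \<tau> * x + cc * \<tau>\<^sup>2 = - x\<^sup>2 / (4 * cc)"
    using c by (simp add: \<tau>_def power2_eq_square field_simps)
  finally show ?thesis .
qed

end

section \<open>Retrying failed attempts\<close>

abbreviation "prog_trial \<equiv> PCond (RLess (num 0) (cell ''f'')) prog_attempt PSkip"

text \<open>Bounds the probability of ending with a large deviation or with the flag raised when
  \<open>m\<close> trials are left. The term \<open>2 * E\<close> is the sum of
  \<open>E * (1 + 1/2 + 1/4 + ...)\<close>, and \<open>1 / 2 ^ m\<close> covers the event that all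
  remaining trials fail.\<close>

definition tail_potential :: "nat \<Rightarrow> real \<Rightarrow> real \<Rightarrow> (nat \<Rightarrow> real) \<Rightarrow> nat \<Rightarrow> (string \<Rightarrow> nat \<Rightarrow> nat \<Rightarrow> real) \<Rightarrow> ennreal" where
  "tail_potential n E x \<theta> m r = (if ok r then if x \<le> \<bar>inner_dim n (err n n r) \<theta>\<bar> then 1 else 0 else ennreal (2 * E + 1 / 2 ^ m))"

context attempt
begin

lemma trial_outcome:
  assumes "outcome n (rarr s)" "s' \<in> set_pmf (den prog_trial s)"
  shows "outcome n (rarr s')"
  using assms attempt_outcome by (auto split: if_splits)

text \<open>A trial succeeds with a large deviation with probability at most \<open>E\<close> and
  fails with probability at most 1/2, and \<open>E + (2 * E + 1 / 2 ^ m) / 2\<close> equals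
  \<open>2 * E + 1 / 2 ^ Suc m\<close>. A state that has already succeeded is left alone.\<close>

lemma trial_tail:
  assumes o: "outcome n (rarr s)" and \<theta>: "inner_dim n \<theta> \<theta> = 1" and x: "x \<ge> 0" and b: "fail_bound n cc \<le> 1 / 2"
  defines "E \<equiv> 2 * exp (- x\<^sup>2 / (4 * cc))"
  shows "(\<integral>\<^sup>+ s'. tail_potential n E x \<theta> m (rarr s') \<partial>measure_pmf (den prog_trial s)) \<le> tail_potential n E x \<theta> (Suc m) (rarr s)"
proof (cases "ok (rarr s)")
  case True
  then show ?thesis by (simp add: nn_integral_return_pmf tail_potential_def)
next
  case False
  then have f: "0 < rarr s ''f'' 0 0" using o by (auto simp: outcome_def)
  let ?D = "measure_pmf (den prog_attempt s)"
  define F where "F = 2 * E + 1 / 2 ^ m"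
  have F: "F \<ge> 0" "E \<ge> 0" by (simp_all add: F_def E_def)
  have fb: "fail_bound n cc \<ge> 0" by (simp add: fail_bound_def)
  have "(\<integral>\<^sup>+ s'. tail_potential n E x \<theta> m (rarr s') \<partial>?D) \<le>
     (\<integral>\<^sup>+ s'. (if ok (rarr s') \<and> x \<le> \<bar>inner_dim n (err n n (rarr s')) \<theta>\<bar> then 1 else 0) + fails (rarr s') * ennreal F \<partial>?D)"
    by (intro nn_integral_mono) (simp add: tail_potential_def F_def)
  also have "\<dots> = (\<integral>\<^sup>+ s'. (if ok (rarr s') \<and> x \<le> \<bar>inner_dim n (err n n (rarr s')) \<theta>\<bar> then 1 else 0) \<partial>?D) + (\<integral>\<^sup>+ s'. fails (rarr s') \<partial>?D) * ennreal F"
    by (subst nn_integral_add, simp, simp, subst nn_integral_multc) simp_all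
  also have "\<dots> \<le> ennreal E + ennreal (fail_bound n cc) * ennreal F"
    using attempt_tail[OF \<theta> x] attempt_fails by (intro add_mono mult_right_mono) (simp_all add: E_def)
  also have "\<dots> = ennreal (E + fail_bound n cc * F)"
    using F fb by (simp add: ennreal_plus ennreal_mult)
  also have "\<dots> \<le> ennreal (2 * E + 1 / 2 ^ Suc m)"
  proof (rule ennreal_leI)
    have "fail_bound n cc * F \<le> 1 / 2 * F" using b F by (intro mult_right_mono) auto
    moreover have "E + 1 / 2 * F = 2 * E + 1 / 2 ^ Suc m" by (simp add: F_def)
    ultimately show "E + fail_bound n cc * F \<le> 2 * E + 1 / 2 ^ Suc m" by linarith
  qed
  finally show ?thesis using False f by (simp add: tail_potential_def)
qed

lemma attempt_frame:
  assumes "ivar t ''n'' = n" "rarr t ''c'' = rarr s ''c''" "rarr t ''v'' = rarr s ''v''" "rarr t ''S'' = rarr s ''S''"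
  shows "attempt n t"
  using assms n c v S by (simp add: attempt_def)

lemma retry_outcome:
  assumes o: "outcome n (rarr s)" and s': "s' \<in> set_pmf (den prog_retry s)"
  shows "outcome n (rarr s')"
proof (rule For_inv[OF _ s'[unfolded prog_retry_def] n, where I = "\<lambda>_. outcome n"])
  fix t t' :: state
  assume o: "outcome n (rarr t)"
    and z: "\<forall>z. z \<noteq> ''a'' \<longrightarrow> z \<notin> wvars (PFor ''b'' prog_trial) \<longrightarrow> ivar t z = ivar s z"
      "\<forall>z. z \<notin> warrs (PFor ''b'' prog_trial) \<longrightarrow> rarr t z = rarr s z"
    and t': "t' \<in> set_pmf (den (PFor ''b'' prog_trial) t)"
  have tn: "ivar t ''n'' = n" using z n by simp
  show "outcome n (rarr t')"
  proof (rule For_inv[OF _ t' tn, where I = "\<lambda>_. outcome n"])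
    fix u u' :: state
    assume ou: "outcome n (rarr u)"
      and y: "\<forall>z. z \<noteq> ''b'' \<longrightarrow> z \<notin> wvars prog_trial \<longrightarrow> ivar u z = ivar t z"
        "\<forall>z. z \<notin> warrs prog_trial \<longrightarrow> rarr u z = rarr t z"
      and u': "u' \<in> set_pmf (den prog_trial u)"
    interpret u: attempt n u by (rule attempt_frame) (use y z n in simp_all)
    show "outcome n (rarr u')" by (rule u.trial_outcome[OF ou u'])
  qed (use o in simp_all)
qed (use o in simp_all)

lemma retry_tail:
  assumes o: "outcome n (rarr s)" and \<theta>: "inner_dim n \<theta> \<theta> = 1" and x: "x \<ge> 0" and b: "fail_bound n cc \<le> 1 / 2"
  defines "E \<equiv> 2 * exp (- x\<^sup>2 / (4 * cc))"
  shows "(\<integral>\<^sup>+ s'. tail_potential n E x \<theta> 0 (rarr s') \<partial>measure_pmf (den prog_retry s)) \<le> tail_potential n E x \<theta> (n * n) (rarr s)"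
proof -
  let ?G = "\<lambda>a. tail_potential n E x \<theta> (n * (n - a))"
  have "(\<integral>\<^sup>+ s'. ?G n (rarr s') \<partial>measure_pmf (den prog_retry s)) \<le> ?G 0 (rarr s)"
    unfolding prog_retry_def
  proof (rule For_nn_integral[OF _ n, where I = "\<lambda>_. outcome n" and G = ?G])
    fix a and t t' :: state
    assume a: "a < n" and o: "outcome n (rarr t)"
      and z: "\<forall>z. z \<noteq> ''a'' \<longrightarrow> z \<notin> wvars (PFor ''b'' prog_trial) \<longrightarrow> ivar t z = ivar s z"
        "\<forall>z. z \<notin> warrs (PFor ''b'' prog_trial) \<longrightarrow> rarr t z = rarr s z"
    have tn: "ivar t ''n'' = n" using z n by simp
    \<comment> \<open>The exponent counts the trials left: those of the later outer rounds plus the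
      rest of this one.\<close>
    let ?H = "\<lambda>l. tail_potential n E x \<theta> (n * (n - Suc a) + (n - l))"
    {
      fix l and u u' :: state
      assume l: "l < n" and ou: "outcome n (rarr u)"
        and y: "\<forall>z. z \<noteq> ''b'' \<longrightarrow> z \<notin> wvars prog_trial \<longrightarrow> ivar u z = ivar t z"
          "\<forall>z. z \<notin> warrs prog_trial \<longrightarrow> rarr u z = rarr t z"
      interpret u: attempt n u by (rule attempt_frame) (use y z n in simp_all)
      have "u' \<in> set_pmf (den prog_trial u) \<Longrightarrow> outcome n (rarr u')" by (rule u.trial_outcome[OF ou])
      moreover have "u.cc = cc" using y z by simp
      then have "(\<integral>\<^sup>+ s'. ?H (Suc l) (rarr s') \<partial>measure_pmf (den prog_trial u)) \<le> ?H l (rarr u)"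
        using u.trial_tail[OF ou \<theta> x, of "n * (n - Suc a) + (n - Suc l)"] b l
        by (simp add: E_def Suc_diff_Suc del: den.simps)
      ultimately have "u' \<in> set_pmf (den prog_trial u) \<Longrightarrow> outcome n (rarr u')"
        "(\<integral>\<^sup>+ s'. ?H (Suc l) (rarr s') \<partial>measure_pmf (den prog_trial u)) \<le> ?H l (rarr u)" by blast+
    } note trial = this
    show "outcome n (rarr t')" if t': "t' \<in> set_pmf (den (PFor ''b'' prog_trial) t)"
      by (rule For_inv[OF _ t' tn, where I = "\<lambda>_. outcome n"]) (use trial(1) o in simp_all)
    have "(\<integral>\<^sup>+ s'. ?H n (rarr s') \<partial>measure_pmf (den (PFor ''b'' prog_trial) t)) \<le> ?H 0 (rarr t)"
    proof (rule For_nn_integral[OF _ tn, where I = "\<lambda>_. outcome n" and G = ?H])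
      fix l and u u' :: state
      assume u: "l < n" "outcome n (rarr u)"
          "\<forall>z. z \<noteq> ''b'' \<longrightarrow> z \<notin> wvars prog_trial \<longrightarrow> ivar u z = ivar t z"
          "\<forall>z. z \<notin> warrs prog_trial \<longrightarrow> rarr u z = rarr t z"
      show "u' \<in> set_pmf (den prog_trial u) \<Longrightarrow> outcome n (rarr u')" by (rule trial(1)[OF u])
      show "(\<integral>\<^sup>+ s'. ?H (Suc l) (rarr s') \<partial>measure_pmf (den prog_trial u)) \<le> ?H l (rarr u)" by (rule trial(2)[OF u])
    qed (use o in simp_all)
    moreover have "n * (n - Suc a) + (n - 0) = n * (n - a)"
      using a by (metis Suc_diff_Suc add.commute diff_zero mult_Suc_right)
    ultimately show "(\<integral>\<^sup>+ s'. ?G (Suc a) (rarr s') \<partial>measure_pmf (den (PFor ''b'' prog_trial) t)) \<le> ?G a (rarr t)"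
      by (simp del: den.simps)
  qed (use o in simp_all)
  then show ?thesis by simp
qed

end

section \<open>The whole algorithm and its tail bound\<close>

definition prog_prepare :: prog where
  "prog_prepare = prog_const ;; prog_greedy ;; prog_digits ;; set_cell ''f'' (num 1) ;; prog_ones"

lemma den_prog_main: "den prog_main s = bind_pmf (den prog_prepare s) (den prog_retry)"
  by (simp only: prog_main_def prog_prepare_def den_PSeq bind_assoc_pmf)

lemma prepare_spec:
  assumes n: "n \<ge> 1" and v: "\<forall>i<n. inner_dim n (v i) (v i) \<le> 1" and t: "t \<in> zonotope n v"
    and s': "s' \<in> set_pmf (den prog_prepare (input_state n v t))"
  shows "attempt n s'" "outcome n (rarr s')" "\<not> ok (rarr s')" "rarr s' ''c'' 0 0 = 12 * harm n"
    "\<forall>i<n. \<forall>j<n. rarr s' ''v'' i j = v i j" "greedy_inv n v t (n * n) (rarr s')" "\<forall>i<n. digits_inv n 0 (rarr s') i"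
proof -
  let ?s = "input_state n v t"
  have w: "wvars prog_const = {''i''}" "warrs prog_const = {''q'', ''c''}"
    "wvars prog_greedy = {''a'', ''b'', ''i'', ''j''}" "warrs prog_greedy = {''g'', ''s'', ''A'', ''R'', ''K''}"
    "wvars prog_digits = {''i'', ''k''}" "warrs prog_digits = {''r'', ''S''}"
    "wvars prog_ones = {''i''}" "warrs prog_ones = {''chi''}"
    by (auto simp: prog_const_def prog_greedy_def prog_digits_def prog_ones_def Let_def)
  from s' obtain s1 s2 s3 where s1: "s1 \<in> set_pmf (den prog_const ?s)" and s2: "s2 \<in> set_pmf (den prog_greedy s1)"
    and s3: "s3 \<in> set_pmf (den prog_digits s2)" and s4: "s' \<in> set_pmf (den prog_ones (set_entry ''f'' 0 0 1 s3))"
    unfolding prog_prepare_def by auto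
  note f1 = den_frame[OF s1, unfolded w] and f2 = den_frame[OF s2, unfolded w] and f3 = den_frame[OF s3, unfolded w]
    and f4 = den_frame[OF s4, unfolded w]
  have i: "ivar ?s ''n'' = n" "rarr ?s ''q'' 0 0 = 0" "rarr ?s ''c'' 0 0 = 0" "rarr ?s ''K'' 0 0 = 0"
    "\<forall>i<n. rarr ?s ''A'' 0 i = 0" "\<forall>i<n. rarr ?s ''R'' 0 i = 0"
    "\<forall>i<n. \<forall>j<n. rarr ?s ''v'' i j = v i j" "\<forall>j<n. rarr ?s ''t'' 0 j = t j"
    by (simp_all add: input_state_def)
  have c: "rarr s1 ''c'' 0 0 = 12 * harm n" by (rule const_spec[OF s1 i(1-3)])
  have g: "greedy_inv n v t (n * n) (rarr s2)"
    by (rule greedy_spec[OF s2 _ _ _ v t]) (use f1 i in simp_all)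
  have d: "\<forall>i<n. digits_inv n 0 (rarr s3) i"
    by (rule digits_spec[OF s3]) (use f1 f2 i g in \<open>simp_all add: greedy_inv_def\<close>)
  have e: "rarr s' ''A'' = rarr s2 ''A''" "rarr s' ''K'' = rarr s2 ''K''" "rarr s' ''R'' = rarr s2 ''R''"
    "rarr s' ''S'' = rarr s3 ''S''" "rarr s' ''r'' = rarr s3 ''r''" "rarr s3 ''A'' = rarr s2 ''A''" "rarr s3 ''K'' = rarr s2 ''K''"
    using f3 f4 by simp_all
  show "greedy_inv n v t (n * n) (rarr s')" using g by (simp add: greedy_inv_def e)
  show d': "\<forall>i<n. digits_inv n 0 (rarr s') i" using d by (simp add: digits_inv_def e)
  show c': "rarr s' ''c'' 0 0 = 12 * harm n" using c f2 f3 f4 by simp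
  show v': "\<forall>i<n. \<forall>j<n. rarr s' ''v'' i j = v i j" using i f1 f2 f3 f4 by simp
  have "\<forall>i<n. rarr s' ''chi'' 0 i = 1"
    by (rule ones_spec[OF s4]) (use i f1 f2 f3 in simp_all)
  moreover have "rarr s' ''f'' 0 0 = 1" using f4 by simp
  ultimately show "outcome n (rarr s')" "\<not> ok (rarr s')" by (simp_all add: outcome_def)
  show "attempt n s'"
  proof
    show "ivar s' ''n'' = n" using i f1 f2 f3 f4 by simp
    have "harm 1 \<le> (harm n :: real)" using n by (rule harm_mono)
    then show "1 \<le> rarr s' ''c'' 0 0" using c' by (simp add: harm_expand)
    show "\<forall>k<n. \<forall>i<n. rarr s' ''S'' k i \<in> {-1, 1}" using d' by (simp add: digits_inv_def)
    have "inner_dim n (rarr s' ''v'' i) (rarr s' ''v'' i) = inner_dim n (v i) (v i)" if "i < n" for i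
      by (rule inner_dim_cong) (use v' that in auto)
    then show "\<forall>i<n. inner_dim n (rarr s' ''v'' i) (rarr s' ''v'' i) \<le> 1" using v by simp
  qed
qed

text \<open>Here the factor 12 in \<open>c\<close> is used: \<open>exp (- c / 2)\<close> is at most
  \<open>(n + 1) powr (- 6)\<close> because \<open>ln (n + 1)\<close> is at most the harmonic
  number, and the square \<open>n * n\<close> from the union bound still leaves at most 1/16.
  Undecided signs contribute at most 1/4, since \<open>n * n\<close> is at most
  \<open>4 ^ n\<close>.\<close>

lemma fail_bound_le:
  assumes n: "n \<ge> 1"
  shows "fail_bound n (12 * harm n) \<le> 1 / 2"
proof -
  have "n < 2 ^ n" by (rule less_exp)
  then have "real n \<le> 2 ^ n" by (metis less_imp_le of_nat_less_iff of_nat_numeral of_nat_power)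
  then have "real n * real n \<le> 2 ^ n * 2 ^ n" by (intro mult_mono) auto
  also have "\<dots> = 4 ^ n" by (simp add: power_mult_distrib[symmetric])
  finally have "real n * real n / 16 ^ n \<le> 4 ^ n / 16 ^ n" by (intro divide_right_mono) auto
  also have "\<dots> = (1 / 4) ^ n" by (simp add: power_divide[symmetric])
  also have "\<dots> \<le> (1 / 4) ^ 1" using n by (intro power_decreasing) auto
  finally have 1: "real n * real n / 16 ^ n \<le> 1 / 4" by simp
  let ?m = "real n + 1"
  have "exp (- (12 * harm n) / 2) \<le> exp (- (6 * ln ?m))" using ln_le_harm[of n] by simp
  also have "\<dots> = 1 / ?m ^ 6"
    using n exp_of_nat_mult[of 6 "ln ?m"] by (simp add: exp_minus divide_inverse)
  finally have "real n * real n * exp (- (12 * harm n) / 2) \<le> real n * real n * (1 / ?m ^ 6)"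
    by (intro mult_left_mono) auto
  also have "\<dots> \<le> ?m ^ 2 * (1 / ?m ^ 6)"
    by (intro mult_right_mono) (auto simp: power2_eq_square intro!: mult_mono)
  also have "\<dots> = (1 / ?m) ^ 4"
    using n by (simp add: field_simps power_divide)
  also have "\<dots> \<le> (1 / 2) ^ 4" using n by (intro power_mono) (auto simp: field_simps)
  finally have 2: "real n * real n * exp (- (12 * harm n) / 2) \<le> 1 / 16" by (simp add: power4_eq_xxxx)
  have "fail_bound n (12 * harm n) = real n * real n / 16 ^ n + 2 * (real n * real n * exp (- (12 * harm n) / 2))"
    by (simp add: fail_bound_def algebra_simps)
  then show ?thesis using 1 2 by linarith
qed

lemma main_outcome:
  assumes n: "n \<ge> 1" and v: "\<forall>i<n. inner_dim n (v i) (v i) \<le> 1" and t: "t \<in> zonotope n v"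
    and s': "s' \<in> set_pmf (den prog_main (input_state n v t))"
  shows "outcome n (rarr s')"
proof -
  from s' obtain s1 where s1: "s1 \<in> set_pmf (den prog_prepare (input_state n v t))" "s' \<in> set_pmf (den prog_retry s1)"
    unfolding den_prog_main set_bind_pmf by blast
  note p = prepare_spec[OF n v t s1(1)]
  show ?thesis by (rule attempt.retry_outcome[OF p(1,2) s1(2)])
qed

text \<open>By \<open>lam_error\<close>, a deviation of \<open>x\<close> from \<open>t\<close>
  forces a deviation of at least \<open>x - 3\<close> of the rounding error \<open>err\<close>. The
  bound is then \<open>tail_potential\<close> at the start, where the flag is raised and
  \<open>n * n\<close> trials are left.\<close>

lemma main_tail:
  assumes n1: "n \<ge> 1" and v1: "\<forall>i<n. inner_dim n (v i) (v i) \<le> 1" and t: "t \<in> zonotope n v"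
    and \<theta>: "inner_dim n \<theta> \<theta> = 1" and x: "x \<ge> 3"
  shows "measure (measure_pmf (den prog_main (input_state n v t)))
      {s. x \<le> \<bar>inner_dim n (\<lambda>j. (\<Sum>i<n. coloring s i * v i j) - t j) \<theta>\<bar>}
    \<le> 4 * exp (- (x - 3)\<^sup>2 / (48 * harm n)) + 1 / 2 ^ (n * n)"
proof -
  let ?D = "den prog_main (input_state n v t)" and ?A = "{s. x \<le> \<bar>inner_dim n (\<lambda>j. (\<Sum>i<n. coloring s i * v i j) - t j) \<theta>\<bar>}"
  define E where "E = 2 * exp (- (x - 3)\<^sup>2 / (4 * (12 * harm n)))"
  have E: "E \<ge> 0" by (simp add: E_def)
  have "emeasure (measure_pmf ?D) ?A = (\<integral>\<^sup>+ s1. \<integral>\<^sup>+ s'. indicator ?A s' \<partial>measure_pmf (den prog_retry s1) \<partial>measure_pmf (den prog_prepare (input_state n v t)))"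
    by (simp add: den_prog_main nn_integral_indicator[symmetric] del: nn_integral_indicator)
  also have "\<dots> \<le> ennreal (2 * E + 1 / 2 ^ (n * n))"
  proof (rule nn_integral_pmf_le)
    fix s1 assume s1: "s1 \<in> set_pmf (den prog_prepare (input_state n v t))"
    note p = prepare_spec[OF n1 v1 t s1]
    interpret attempt n s1 by (rule p(1))
    have "(\<integral>\<^sup>+ s'. indicator ?A s' \<partial>measure_pmf (den prog_retry s1)) \<le> (\<integral>\<^sup>+ s'. tail_potential n E (x - 3) \<theta> 0 (rarr s') \<partial>measure_pmf (den prog_retry s1))"
    proof (rule nn_integral_pmf_mono)
      fix s' assume s': "s' \<in> set_pmf (den prog_retry s1)"
      have w: "warrs prog_retry = {''g'', ''y'', ''f'', ''chi'', ''w''}" by (auto simp: prog_retry_def)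
      have fr: "rarr s' ''S'' = rarr s1 ''S''" "rarr s' ''v'' = rarr s1 ''v''" using den_frame[OF s'] by (simp_all add: w)
      let ?e = "\<lambda>j. (\<Sum>i<n. lam (rarr s1 ''S'') n i * v i j) - t j"
      have "err n n (rarr s') j = (\<Sum>i<n. (coloring s' i - lam (rarr s1 ''S'') n i) * v i j)" if "j < n" for j
        using that p(5) by (auto simp: err_def fr coloring_def intro!: sum.cong)
      then have "inner_dim n (\<lambda>j. (\<Sum>i<n. coloring s' i * v i j) - t j) \<theta> = inner_dim n (\<lambda>j. err n n (rarr s') j + ?e j) \<theta>"
        by (intro inner_dim_cong) (simp_all add: left_diff_distrib sum_subtractf)
      then have "inner_dim n (\<lambda>j. (\<Sum>i<n. coloring s' i * v i j) - t j) \<theta> = inner_dim n (err n n (rarr s')) \<theta> + inner_dim n ?e \<theta>"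
        by (simp only: inner_dim_add)
      moreover have "\<bar>inner_dim n ?e \<theta>\<bar> \<le> 3" by (rule lam_error[OF n1 v1 p(6,7) \<theta>])
      ultimately have "s' \<in> ?A \<Longrightarrow> x - 3 \<le> \<bar>inner_dim n (err n n (rarr s')) \<theta>\<bar>" by simp
      moreover have "(1 :: ennreal) \<le> ennreal (2 * E + 1)" using E by (simp add: ennreal_ge_1)
      ultimately show "indicator ?A s' \<le> tail_potential n E (x - 3) \<theta> 0 (rarr s')"
        by (auto simp: tail_potential_def indicator_def)
    qed
    also have "\<dots> \<le> tail_potential n E (x - 3) \<theta> (n * n) (rarr s1)"
      using retry_tail[OF p(2) \<theta>, of "x - 3"] x fail_bound_le[OF n1] by (simp add: p(4) E_def)
    finally show "(\<integral>\<^sup>+ s'. indicator ?A s' \<partial>measure_pmf (den prog_retry s1)) \<le> ennreal (2 * E + 1 / 2 ^ (n * n))"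
      using p(3) by (simp add: tail_potential_def)
  qed
  finally have "measure (measure_pmf ?D) ?A \<le> 2 * E + 1 / 2 ^ (n * n)"
    unfolding measure_pmf.emeasure_eq_measure using E by (subst (asm) ennreal_le_iff) simp_all
  then show ?thesis by (simp add: E_def)
qed

text \<open>Writing \<open>t\<close> with coefficients in \<open>[-1, 1]\<close>, every coefficient
  of the difference is at most 2 in absolute value. This deterministic bound covers the far tail,
  where the summand \<open>1 / 2 ^ (n * n)\<close> of \<open>main_tail\<close> would be too
  large.\<close>

lemma main_range:
  assumes n: "n \<ge> 1" and v: "\<forall>i<n. inner_dim n (v i) (v i) \<le> 1" and t: "t \<in> zonotope n v"
    and \<theta>: "inner_dim n \<theta> \<theta> = 1" and s: "s \<in> set_pmf (den prog_main (input_state n v t))"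
  shows "\<bar>inner_dim n (\<lambda>j. (\<Sum>i<n. coloring s i * v i j) - t j) \<theta>\<bar> \<le> 2 * real n"
proof -
  obtain l where l: "\<forall>i<n. l i \<in> {-1..1}" "\<forall>j<n. t j = (\<Sum>i<n. l i * v i j)"
    using t by (auto simp: zonotope_def)
  let ?d = "\<lambda>j. \<Sum>i<n. (coloring s i - l i) * v i j"
  have "\<bar>coloring s i - l i\<bar> \<le> 2" if "i < n" for i
  proof -
    have "coloring s i \<in> {-1, 1}" using main_outcome[OF n v t s] that by (simp add: outcome_def coloring_def)
    then show ?thesis using l(1) that by (auto simp: abs_le_iff)
  qed
  then have "inner_dim n ?d ?d \<le> (2 * real n)\<^sup>2" by (intro inner_dim_comb_bound v) auto
  then have "\<bar>inner_dim n ?d \<theta>\<bar> \<le> 2 * real n * 1" using \<theta> by (intro inner_dim_bound) auto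
  moreover have "inner_dim n (\<lambda>j. (\<Sum>i<n. coloring s i * v i j) - t j) \<theta> = inner_dim n ?d \<theta>"
    by (rule inner_dim_cong) (simp_all add: l(2) left_diff_distrib sum_subtractf)
  ultimately show ?thesis by simp
qed

text \<open>With \<open>y\<close> the target exponent, the lower bound on \<open>x\<close> gives
  \<open>y \<ge> 1 / 2\<close> and \<open>x > 6\<close>. Then \<open>(x - 3)\<^sup>2\<close> is at
  least \<open>x\<^sup>2 / 4\<close>, and \<open>harm n \<le> 3 * L\<close> makes the actual
  exponent at least \<open>8 * y\<close>, which absorbs the factor 4. The upper bound on
  \<open>x\<close> makes \<open>1 / 2 ^ (n * n)\<close> at most \<open>exp (- y)\<close>. Each
  summand thus pays for half of the factor 2.\<close>

lemma tail_arith: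
  fixes x L :: real
  assumes L: "L = ln (real n)" and n: "n \<ge> 2" and x: "2304 * L < x\<^sup>2" "0 \<le> x" "x \<le> 2 * real n"
  shows "4 * exp (- (x - 3)\<^sup>2 / (48 * harm n)) + 1 / 2 ^ (n * n) \<le> 2 * exp (- (x\<^sup>2 / (4608 * L)))"
proof -
  have half: "ln 2 \<ge> (1 / 2 :: real)"
    using ln2_ge_two_thirds by simp
  have "ln 2 \<le> L" using n by (simp add: L)
  then have L': "L \<ge> 1 / 2" using half by linarith
  \<comment> \<open>The difference decreases in \<open>n\<close>, so its value 1 at
    \<open>n = 1\<close> is an upper bound.\<close>
  have "harm n - ln (real n) \<le> harm 1 - ln (real 1)"
    using n by (intro euler_mascheroni_sequence_decreasing) auto
  then have "harm n \<le> 1 + L" by (simp add: L harm_expand)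
  then have h: "harm n \<le> 3 * L" using L' by linarith
  have h0: "harm n > (0 :: real)" using n by simp
  have "6\<^sup>2 < x\<^sup>2" using x(1) L' by simp
  then have "x > 6" using x(2) by (rule power_less_imp_less_base)
  then have "(x / 2)\<^sup>2 \<le> (x - 3)\<^sup>2" by (intro power_mono) auto
  then have sq: "x\<^sup>2 / 4 \<le> (x - 3)\<^sup>2" by (simp add: power_divide)
  define y where "y = x\<^sup>2 / (4608 * L)"
  have xy: "x\<^sup>2 = 4608 * L * y" using L' by (simp add: y_def)
  have y: "y \<ge> 1 / 2" using x(1) L' unfolding xy by (simp add: mult_less_cancel_left)
  have "8 * y = x\<^sup>2 / 4 / (144 * L)" using L' by (simp add: xy)
  also have "\<dots> \<le> (x - 3)\<^sup>2 / (48 * harm n)"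
    using sq h h0 L' by (intro frac_le) auto
  finally have "exp (- (x - 3)\<^sup>2 / (48 * harm n)) \<le> exp (- (8 * y))" by simp
  moreover have "4 * exp (- (8 * y)) \<le> exp (- y)"
  proof -
    have "4 \<le> 1 + 7 * y" using y by simp
    also have "\<dots> \<le> exp (7 * y)" by (rule exp_ge_add_one_self)
    finally have "4 * exp (- (8 * y)) \<le> exp (7 * y) * exp (- (8 * y))" by (intro mult_right_mono) auto
    also have "\<dots> = exp (- y)" by (simp add: mult_exp_exp)
    finally show ?thesis .
  qed
  moreover have "1 / 2 ^ (n * n) \<le> exp (- y)"
  proof -
    have "x\<^sup>2 \<le> (2 * real n)\<^sup>2" using x by (intro power_mono) auto
    then have "4608 * L * y \<le> 4 * (real n)\<^sup>2" by (simp add: xy power_mult_distrib)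
    moreover have "4608 * (1 / 2) * y \<le> 4608 * L * y" using L' y by (intro mult_right_mono) auto
    ultimately have "4608 * (1 / 2) * y \<le> 4 * (real n)\<^sup>2" by linarith
    then have "y \<le> real (n * n) * (1 / 2)" using y by (simp add: power2_eq_square)
    also have "\<dots> \<le> real (n * n) * ln 2" using half by (intro mult_left_mono) auto
    finally have "exp y \<le> exp (real (n * n) * ln 2)" by simp
    also have "\<dots> = 2 ^ (n * n)" by (subst exp_of_nat_mult) simp
    finally show ?thesis by (simp add: exp_minus field_simps)
  qed
  ultimately show ?thesis unfolding y_def[symmetric] by linarith
qed

text \<open>Three ranges of \<open>x\<close>: for small \<open>x\<close> the right-hand side is at
  least \<open>2 * exp (- 1 / 2)\<close> and hence at least 1; in the middle range
  \<open>main_tail\<close> and \<open>tail_arith\<close> apply; beyond \<open>2 * n\<close> the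
  event is impossible by \<open>main_range\<close>.\<close>

lemma main_subgaussian_bound:
  assumes n: "n \<ge> 2" and v: "\<forall>i<n. inner_dim n (v i) (v i) \<le> 1" and t: "t \<in> zonotope n v"
    and \<theta>: "inner_dim n \<theta> \<theta> = 1" and x: "x \<ge> 0"
  shows "measure (measure_pmf (den prog_main (input_state n v t)))
      {s. x \<le> \<bar>inner_dim n (\<lambda>j. (\<Sum>i<n. coloring s i * v i j) - t j) \<theta>\<bar>}
    \<le> 2 * exp (- (x\<^sup>2 / (4608 * ln (real n))))" (is "measure ?M ?A \<le> _")
proof -
  have n1: "n \<ge> 1" and L: "ln (real n) > 0" using n by auto
  have half: "ln 2 \<ge> (1 / 2 :: real)"
    using ln2_ge_two_thirds by simp
  have L2: "ln 2 \<le> ln (real n)" using n by simp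
  consider "x\<^sup>2 \<le> 2304 * ln (real n)" | "2304 * ln (real n) < x\<^sup>2" "x \<le> 2 * real n" | "x > 2 * real n" by linarith
  then show ?thesis
  proof cases
    case 1
    then have "x\<^sup>2 / (4608 * ln (real n)) \<le> 1 / 2" using L by (simp add: field_simps)
    then have "exp (- (1 / 2)) \<le> exp (- (x\<^sup>2 / (4608 * ln (real n))))" by simp
    moreover have "exp (1 / 2 :: real) \<le> exp (ln 2)" using half by (simp only: exp_le_cancel_iff)
    then have "1 \<le> 2 * exp (- (1 / 2 :: real))" by (simp add: exp_minus field_simps)
    moreover have "measure ?M ?A \<le> 1" by simp
    ultimately show ?thesis by linarith
  next
    case 2
    have "3\<^sup>2 \<le> x\<^sup>2" using 2(1) half L2 by simp
    then have x3: "x \<ge> 3" using x by (rule power2_le_imp_le)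
    show ?thesis
      using main_tail[OF n1 v t \<theta> x3] tail_arith[OF refl n 2(1) x 2(2)] by linarith
  next
    case 3
    then have "set_pmf (den prog_main (input_state n v t)) \<inter> ?A = {}"
      using main_range[OF n1 v t \<theta>] by fastforce
    then have "measure ?M ?A = 0" by (simp add: measure_pmf_zero_iff)
    then show ?thesis by simp
  qed
qed

theorem theorem1p4:
  shows "\<exists>C>0. \<exists>alg :: com. \<exists>p :: real poly.
    \<forall>n\<ge>1. \<forall>(v :: nat \<Rightarrow> nat \<Rightarrow> real) (t :: nat \<Rightarrow> real).
      (\<forall>i<n. L2_set (v i) {..<n} \<le> 1) \<longrightarrow> t \<in> zonotope n v \<longrightarrow>
        lossless_spmf (run alg (input_state n v t)) \<and>
        expected_time alg (input_state n v t) \<le> ennreal (poly p (real n)) \<and>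
        (\<forall>(s, m) \<in> set_spmf (run alg (input_state n v t)). \<forall>i<n. coloring s i \<in> {-1, 1}) \<and>
        (n \<ge> 2 \<longrightarrow>
          subgaussian n (C * sqrt (ln (real n))) (measure_spmf (run alg (input_state n v t)))
            (\<lambda>(s, m) j. (\<Sum>i<n. coloring s i * v i j) - t j))"
proof -
  obtain p :: "real poly" where p: "\<And>n. real (tcost prog_main n) = poly p (real n)"
    using poly_tcost by metis
  show ?thesis
  \<comment> \<open>The constant 48 satisfies \<open>2 * 48\<^sup>2 = 4608\<close>, which matches
    the exponent of \<open>main_subgaussian_bound\<close>.\<close>
  proof (rule exI[of _ 48], intro conjI, simp, rule exI[of _ "compile prog_main"], rule exI[of _ p], intro allI impI)
    fix n :: nat and v :: "nat \<Rightarrow> nat \<Rightarrow> real" and t :: "nat \<Rightarrow> real"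
    assume n: "1 \<le> n" and v2: "\<forall>i<n. L2_set (v i) {..<n} \<le> 1" and t: "t \<in> zonotope n v"
    have v: "\<forall>i<n. inner_dim n (v i) (v i) \<le> 1"
      using v2 by (simp add: L2_set_def inner_dim_def power2_eq_square)
    let ?s = "input_state n v t"
    let ?r = "run (compile prog_main) ?s" and ?D = "den prog_main ?s"
    note ex = exec_compile[OF wf_main, of ?s 0, folded run_def]
    have fst: "map_spmf fst ?r = spmf_of_pmf ?D" using ex by blast
    have time: "z \<in> set_spmf ?r \<Longrightarrow> snd z \<le> tcost prog_main n" for z
      using ex by (auto simp: input_state_def)
    \<comment> \<open>Forgetting the clock preserves the total mass, and the image is a genuine
      probability distribution; hence the run terminates almost surely.\<close>
    have "lossless_spmf (map_spmf fst ?r)" unfolding fst by simp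
    then have "lossless_spmf ?r" by simp
    moreover have "expected_time (compile prog_main) ?s \<le> ennreal (poly p (real n))"
    proof -
      have "expected_time (compile prog_main) ?s \<le> (\<integral>\<^sup>+ z. of_nat (tcost prog_main n) \<partial>measure_spmf ?r)"
        unfolding expected_time_def
        by (intro nn_integral_mono_AE) (use time in \<open>auto simp: AE_measure_spmf_iff\<close>)
      also have "\<dots> \<le> of_nat (tcost prog_main n) * 1"
        unfolding nn_integral_const by (intro mult_left_mono measure_spmf.subprob_emeasure_le_1) auto
      also have "\<dots> = ennreal (poly p (real n))"
        unfolding p[symmetric] by (simp add: ennreal_of_nat_eq_real_of_nat)
      finally show ?thesis .
    qed
    moreover have "\<forall>z \<in> set_spmf ?r. \<forall>i<n. coloring (fst z) i \<in> {-1, 1}"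
    proof (intro ballI allI impI)
      fix z i assume "z \<in> set_spmf ?r" and i: "i < n"
      from set_spmf_fst[OF fst this(1)] have "outcome n (rarr (fst z))" using main_outcome[OF n v t] by simp
      then show "coloring (fst z) i \<in> {-1, 1}" using i by (simp add: outcome_def coloring_def)
    qed
    then have "\<forall>(s, m) \<in> set_spmf ?r. \<forall>i<n. coloring s i \<in> {-1, 1}" by (simp add: split_def)
    moreover have "subgaussian n (48 * sqrt (ln (real n))) (measure_spmf ?r)
        (\<lambda>(s, m) j. (\<Sum>i<n. coloring s i * v i j) - t j)" if n2: "n \<ge> 2"
      unfolding subgaussian_def
    proof (intro allI impI)
      fix \<theta> :: "nat \<Rightarrow> real" and x :: real
      assume "L2_set \<theta> {..<n} = 1" and x: "0 \<le> x"
      then have \<theta>: "inner_dim n \<theta> \<theta> = 1" by (simp add: L2_set_def inner_dim_def power2_eq_square)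
      let ?A = "{s. x \<le> \<bar>inner_dim n (\<lambda>j. (\<Sum>i<n. coloring s i * v i j) - t j) \<theta>\<bar>}"
      have "{\<omega> \<in> space (measure_spmf ?r). x \<le> \<bar>inner_dim n ((\<lambda>(s, m) j. (\<Sum>i<n. coloring s i * v i j) - t j) \<omega>) \<theta>\<bar>} = fst -` ?A"
        by (auto simp: space_measure_spmf)
      then have "measure (measure_spmf ?r) {\<omega> \<in> space (measure_spmf ?r). x \<le> \<bar>inner_dim n ((\<lambda>(s, m) j. (\<Sum>i<n. coloring s i * v i j) - t j) \<omega>) \<theta>\<bar>}
        = measure (measure_spmf (map_spmf fst ?r)) ?A" by (simp add: measure_map_spmf)
      also have "\<dots> = measure (measure_pmf ?D) ?A" unfolding fst by simp
      also have "\<dots> \<le> 2 * exp (- (x\<^sup>2 / (4608 * ln (real n))))"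
        by (rule main_subgaussian_bound[OF n2 v t \<theta> x])
      also have "x\<^sup>2 / (4608 * ln (real n)) = (x / (48 * sqrt (ln (real n))))\<^sup>2 / 2"
        using n2 by (simp add: power_divide power_mult_distrib)
      finally show "measure (measure_spmf ?r) {\<omega> \<in> space (measure_spmf ?r). x \<le> \<bar>inner_dim n ((\<lambda>(s, m) j. (\<Sum>i<n. coloring s i * v i j) - t j) \<omega>) \<theta>\<bar>}
        \<le> 2 * exp (- ((x / (48 * sqrt (ln (real n))))\<^sup>2 / 2))" .
    qed
    ultimately show "lossless_spmf ?r \<and> expected_time (compile prog_main) ?s \<le> ennreal (poly p (real n)) \<and>
        (\<forall>(s, m) \<in> set_spmf ?r. \<forall>i<n. coloring s i \<in> {-1, 1}) \<and>
        (n \<ge> 2 \<longrightarrow> subgaussian n (48 * sqrt (ln (real n))) (measure_spmf ?r)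
            (\<lambda>(s, m) j. (\<Sum>i<n. coloring s i * v i j) - t j))" by blast
  qed
qed

end
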